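(* Let $n\ge3$, and let $H^3\times\mathbb{R}^{n-3}$ be the product of the three-dimensional Heisenberg group and the abelian Lie group, with Lie algebra $\mathfrak h_3\oplus\mathfrak g_{\mathbb{R}^{n-3}}$ having a basis $\{e_1,\dots,e_n\}$, where $\{e_1,e_2,e_3\}$ is a basis of $\mathfrak h_3$ with $[e_1,e_2]=e_3$, $\{e_4,\dots,e_n\}$ is a basis of $\mathfrak g_{\mathbb{R}^{n-3}}$, and all other brackets are trivial. Let $\{x_1,\dots,x_n\}$ be the dual basis, $g$ the left-invariant Riemannian metric for which $\{e_1,\dots,e_n\}$ is orthonormal, and $w_0:=x_1x_1+x_2x_2+x_3x_3\in S^2(\mathfrak h_3^* )\cong\mathrm{Homog}_2(x_1,x_2,x_3)$. Then $$S^3_{\mathrm{CS}}((\mathfrak h_3\oplus\mathfrak g_{\mathbb{R}^{n-3}})^*,g)=\{w_0p_1+p_3\mid p_1\in S^1(\mathfrak g_{\mathbb{R}^{n-3}}^* ),\ p_3\in S^3(\mathfrak g_{\mathbb{R}^{n-3}}^* )\},\qquad S^3_{\mathrm{DF}}((\mathfrak h_3\oplus\mathfrak g_{\mathbb{R}^{n-3}})^*,g)=\emptyset.$$ Moreover, for each $C\in S^3_{\mathrm{CS}}((\mathfrak h_3\oplus\mathfrak g_{\mathbb{R}^{n-3}})^*,g)$ we have $\nabla^gC=0$ and $\mathrm{Sect}^\nabla_g(e_1,e_3)\ge1/4>0$, where $\nabla$ is the statistical connection corresponding to $(g,C)$. Furthermore (with $\cong$ meaning homeomorphic), $$\mathcal{ML}\mathrm{Stat}(H^3\times\mathbb{R}^{n-3})\cong(S(O(2)\times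 O(1))\times O(n-3))\backslash\mathrm{Homog}_3(x_1,\dots,x_n),$$ $$\mathcal{ML}\mathrm{Stat}^{\mathrm{CS}}(H^3\times\mathbb{R}^{n-3})\cong O(n-3)\backslash(\mathrm{Homog}_1(x_4,\dots,x_n)\oplus\mathrm{Homog}_3(x_4,\dots,x_n)),$$ $$\mathcal{ML}\mathrm{Stat}^{\mathrm{DF}}(H^3\times\mathbb{R}^{n-3})=\emptyset.$$
   Context: A statistical structure on a manifold $M$ is a pair $(g,\nabla)$ of a Riemannian metric $g$ and a torsion-free affine connection $\nabla$ such that the $(0,3)$-tensor field $C:=\nabla g$, $C(X,Y,Z)=(\nabla_X g)(Y,Z)$ (the cubic form), is totally symmetric. For fixed $g$, $\nabla\mapsto\nabla g$ is a bijection onto the symmetric $(0,3)$-tensor fields; the statistical connection corresponding to $(g,C)$ is the one with $\nabla g=C$, and $(g,C)$ is also called a statistical structure. $\nabla^g$ is the Levi-Civita connection. The dual connection $\overline\nabla$ is defined by $Xg(Y,Z)=g(\nabla_XY,Z)+g(Y,\overline\nabla_XZ)$. With $R^\nabla(X,Y)Z=\nabla_X\nabla_YZ-\nabla_Y\nabla_XZ-\nabla_{[X,Y]}Z$, $(g,\nabla)$ is conjugate symmetric if $R^\nabla=R^{\overline\nabla}$, and dually flat if $R^\nabla=0$. For conjugate symmetric $(g,\nabla)$ and linearly independent tangent vectors $v,w$, $\mathrm{Sect}^\nabla_g(v,w):=\dfrac{g(R^\nabla(v,w)w,v)}{g(v,v)g(w,w)-g(v,w)^2}$. For a Lie group $G$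 with Lie algebra $\mathfrak g$, a statistical structure $(g,\nabla)$ is left-invariant if both $g$ and $\nabla$ are invariant under left translations; left-invariant cubic forms are elements of $S^3(\mathfrak g^* )$. $S^3_{\mathrm{CS}}(\mathfrak g^*,g)$ and $S^3_{\mathrm{DF}}(\mathfrak g^*,g)$ are the sets of $C\in S^3(\mathfrak g^* )$ with $(g,C)$ conjugate symmetric, resp. dually flat. $\mathcal{L}\mathrm{Stat}(G)$, the set of left-invariant statistical structures, is identified via $(g,\nabla)\mapsto(g,\nabla g)$ with $\widetilde{\mathfrak M}(G)\times S^3(\mathfrak g^* )$ ($\widetilde{\mathfrak M}(G)$ = left-invariant metrics = inner products on $\mathfrak g$) and carries the corresponding topology. $\mathbb{R}_{>0}\times\mathrm{Aut}(G)$ acts by $(r,\varphi).(g,\nabla)=(r\,(\varphi^{-1})^*g,(\varphi^{-1})^*\nabla)$; $\mathcal{ML}\mathrm{Stat}(G)$, $\mathcal{ML}\mathrm{Stat}^{\mathrm{CS}}(G)$, $\mathcal{ML}\mathrm{Stat}^{\mathrm{DF}}(G)$ are the orbit spaces, with quotient topology, of $\mathcal{L}\mathrm{Stat}(G)$ and of its invariant subsets of conjugate symmetric, resp. dually flat, structures. $S^k(\mathfrak g^* )$ denotes symmetric $k$-tensors, with products $(x_1\cdots x_k)(X_1,\dots,X_k)=\frac1{k!}\sum_{\sigma\in\mathfrak S_k}\prod_i x_{\sigma(i)}(X_i)$, identified with the homogeneous polynomials $\mathrm{Homog}_k$ of degree $k$ in the dual basis. In the basis $\{e_i\}$, $S(O(2)\times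 O(1))\times O(n-3)$ is the group of block matrices $\mathrm{diag}(A,\det A,B)$ with $A\in O(2)$, $B\in O(n-3)$, acting by $h.C=C(h^{-1}\cdot,h^{-1}\cdot,h^{-1}\cdot)$; $O(n-3)$ acts likewise on polynomials in $x_4,\dots,x_n$. *)

theory Defs
  imports "HOL-Analysis.Analysis"
begin

section \<open>Calculus on a vector space regarded as a manifold\<close>

text \<open>
  The Lie group \<open>H\<^sup>3 \<times> \<real>\<^sup>n\<^sup>-\<^sup>3\<close> is diffeomorphic to \<open>\<real>\<^sup>n\<close>, so manifolds are only needed with one global
  chart: the manifold is a Euclidean space \<open>'a\<close>, every tangent space is \<open>'a\<close>, and vector fields are
  maps \<open>'a \<Rightarrow> 'a\<close>.
\<close>

type_synonym 'a vfield = "'a \<Rightarrow> 'a"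
type_synonym 'a tensor2 = "'a \<Rightarrow> 'a \<Rightarrow> 'a \<Rightarrow> real"
type_synonym 'a tensor3 = "'a \<Rightarrow> 'a \<Rightarrow> 'a \<Rightarrow> 'a \<Rightarrow> real"
type_synonym 'a connection = "'a vfield \<Rightarrow> 'a vfield \<Rightarrow> 'a vfield"

text \<open>\<open>C\<^sup>\<infinity>\<close>: differentiable everywhere, and so are all iterated directional derivatives.\<close>

coinductive smooth :: "('a::euclidean_space \<Rightarrow> 'b::real_normed_vector) \<Rightarrow> bool" where
  "\<lbrakk>\<And>x. f differentiable (at x); \<And>v. smooth (\<lambda>x. frechet_derivative f (at x) v)\<rbrakk> \<Longrightarrow> smooth f"

definition diffeo :: "('a::euclidean_space \<Rightarrow> 'a) \<Rightarrow> bool" where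
  "diffeo \<phi> \<longleftrightarrow> bij \<phi> \<and> smooth \<phi> \<and> smooth (inv \<phi>)"

definition lie_deriv :: "'a::euclidean_space vfield \<Rightarrow> ('a \<Rightarrow> real) \<Rightarrow> 'a \<Rightarrow> real" where
  "lie_deriv X f p = frechet_derivative f (at p) (X p)"

definition lie_bracket :: "'a::euclidean_space vfield \<Rightarrow> 'a vfield \<Rightarrow> 'a vfield" where
  "lie_bracket X Y p = frechet_derivative Y (at p) (X p) - frechet_derivative X (at p) (Y p)"

definition pushforward :: "('a::euclidean_space \<Rightarrow> 'a) \<Rightarrow> 'a vfield \<Rightarrow> 'a vfield" where
  "pushforward \<phi> X q = frechet_derivative \<phi> (at (inv \<phi> q)) (X (inv \<phi> q))"

section \<open>Metrics, connections, statistical structures\<close>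

definition inner_product :: "('a::euclidean_space \<Rightarrow> 'a \<Rightarrow> real) \<Rightarrow> bool" where
  "inner_product b \<longleftrightarrow> bilinear b \<and> (\<forall>u v. b u v = b v u) \<and> (\<forall>u. u \<noteq> 0 \<longrightarrow> b u u > 0)"

definition riemannian_metric :: "'a::euclidean_space tensor2 \<Rightarrow> bool" where
  "riemannian_metric g \<longleftrightarrow> (\<forall>p. inner_product (g p)) \<and> (\<forall>u v. smooth (\<lambda>p. g p u v))"

text \<open>
  An affine connection is an operator on smooth vector fields. As functions in HOL are total, it is
  normalised to be 0 when an argument is not smooth; equality of connections as functions is then
  equality as operators on smooth fields.
\<close>

definition affine_connection :: "'a::euclidean_space connection \<Rightarrow> bool" where
  "affine_connection D \<longleftrightarrow>
     (\<forall>X Y. smooth X \<longrightarrow> smooth Y \<longrightarrow> smooth (D X Y)) \<and>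
     (\<forall>X X' Y. smooth X \<longrightarrow> smooth X' \<longrightarrow> smooth Y \<longrightarrow>
        D (\<lambda>p. X p + X' p) Y = (\<lambda>p. D X Y p + D X' Y p)) \<and>
     (\<forall>f X Y. smooth f \<longrightarrow> smooth X \<longrightarrow> smooth Y \<longrightarrow>
        D (\<lambda>p. f p *\<^sub>R X p) Y = (\<lambda>p. f p *\<^sub>R D X Y p)) \<and>
     (\<forall>X Y Y'. smooth X \<longrightarrow> smooth Y \<longrightarrow> smooth Y' \<longrightarrow>
        D X (\<lambda>p. Y p + Y' p) = (\<lambda>p. D X Y p + D X Y' p)) \<and>
     (\<forall>f X Y. smooth f \<longrightarrow> smooth X \<longrightarrow> smooth Y \<longrightarrow>
        D X (\<lambda>p. f p *\<^sub>R Y p) = (\<lambda>p. lie_deriv X f p *\<^sub>R Y p + f p *\<^sub>R D X Y p)) \<and>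
     (\<forall>X Y. \<not> (smooth X \<and> smooth Y) \<longrightarrow> D X Y = (\<lambda>p. 0))"

definition torsion_free :: "'a::euclidean_space connection \<Rightarrow> bool" where
  "torsion_free D \<longleftrightarrow>
     (\<forall>X Y. smooth X \<longrightarrow> smooth Y \<longrightarrow> (\<forall>p. D X Y p - D Y X p = lie_bracket X Y p))"

text \<open>\<open>cubic D g X Y Z\<close> is the function \<open>(\<nabla>\<^sub>X g)(Y, Z)\<close>.\<close>

definition cubic :: "'a::euclidean_space connection \<Rightarrow> 'a tensor2 \<Rightarrow>
    'a vfield \<Rightarrow> 'a vfield \<Rightarrow> 'a vfield \<Rightarrow> 'a \<Rightarrow> real" where
  "cubic D g X Y Z p =
     lie_deriv X (\<lambda>q. g q (Y q) (Z q)) p - g p (D X Y p) (Z p) - g p (Y p) (D X Z p)"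

definition cubic_eq :: "'a::euclidean_space connection \<Rightarrow> 'a tensor2 \<Rightarrow> 'a tensor3 \<Rightarrow> bool" where
  "cubic_eq D g C \<longleftrightarrow> (\<forall>X Y Z. smooth X \<longrightarrow> smooth Y \<longrightarrow> smooth Z \<longrightarrow>
     (\<forall>p. cubic D g X Y Z p = C p (X p) (Y p) (Z p)))"

text \<open>
  The value of the tensor field \<open>\<nabla>g\<close> at \<open>p\<close> on tangent vectors does not depend on the vector fields
  chosen to extend them; the fields that are constant in the chart are used.
\<close>

definition cubic_at :: "'a::euclidean_space connection \<Rightarrow> 'a tensor2 \<Rightarrow> 'a tensor3" where
  "cubic_at D g p u v w = cubic D g (\<lambda>_. u) (\<lambda>_. v) (\<lambda>_. w) p"

definition statistical_structure :: "'a::euclidean_space tensor2 \<Rightarrow> 'a connection \<Rightarrow> bool" where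
  "statistical_structure g D \<longleftrightarrow> riemannian_metric g \<and> affine_connection D \<and> torsion_free D \<and>
     (\<forall>X Y Z. smooth X \<longrightarrow> smooth Y \<longrightarrow> smooth Z \<longrightarrow>
        cubic D g X Y Z = cubic D g Y X Z \<and> cubic D g X Y Z = cubic D g X Z Y)"

definition statistical_connection :: "'a::euclidean_space tensor2 \<Rightarrow> 'a tensor3 \<Rightarrow> 'a connection" where
  "statistical_connection g C = (THE D. affine_connection D \<and> torsion_free D \<and> cubic_eq D g C)"

definition levi_civita :: "'a::euclidean_space tensor2 \<Rightarrow> 'a connection" where
  "levi_civita g = (THE D. affine_connection D \<and> torsion_free D \<and> cubic_eq D g (\<lambda>p u v w. 0))"

definition dual_connection :: "'a::euclidean_space tensor2 \<Rightarrow> 'a connection \<Rightarrow> 'a connection" where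
  "dual_connection g D = (THE D'. affine_connection D' \<and>
     (\<forall>X Y Z. smooth X \<longrightarrow> smooth Y \<longrightarrow> smooth Z \<longrightarrow>
        (\<forall>p. lie_deriv X (\<lambda>q. g q (Y q) (Z q)) p = g p (D X Y p) (Z p) + g p (Y p) (D' X Z p))))"

definition curvature :: "'a::euclidean_space connection \<Rightarrow>
    'a vfield \<Rightarrow> 'a vfield \<Rightarrow> 'a vfield \<Rightarrow> 'a vfield" where
  "curvature D X Y Z p = D X (D Y Z) p - D Y (D X Z) p - D (lie_bracket X Y) Z p"

definition curvature_at :: "'a::euclidean_space connection \<Rightarrow> 'a \<Rightarrow> 'a \<Rightarrow> 'a \<Rightarrow> 'a \<Rightarrow> 'a" where
  "curvature_at D p u v w = curvature D (\<lambda>_. u) (\<lambda>_. v) (\<lambda>_. w) p"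

definition conjugate_symmetric :: "'a::euclidean_space tensor2 \<Rightarrow> 'a connection \<Rightarrow> bool" where
  "conjugate_symmetric g D \<longleftrightarrow> (\<forall>X Y Z. smooth X \<longrightarrow> smooth Y \<longrightarrow> smooth Z \<longrightarrow>
     curvature D X Y Z = curvature (dual_connection g D) X Y Z)"

definition dually_flat :: "'a::euclidean_space connection \<Rightarrow> bool" where
  "dually_flat D \<longleftrightarrow> (\<forall>X Y Z. smooth X \<longrightarrow> smooth Y \<longrightarrow> smooth Z \<longrightarrow> curvature D X Y Z = (\<lambda>p. 0))"

definition sect :: "'a::euclidean_space tensor2 \<Rightarrow> 'a connection \<Rightarrow> 'a \<Rightarrow> 'a \<Rightarrow> 'a \<Rightarrow> real" where
  "sect g D p v w =
     g p (curvature_at D p v w w) v / (g p v v * g p w w - (g p v w)\<^sup>2)"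

text \<open>\<open>cov_deriv3 D C W X Y Z\<close> is the function \<open>(\<nabla>\<^sub>W C)(X, Y, Z)\<close>.\<close>

definition cov_deriv3 :: "'a::euclidean_space connection \<Rightarrow> 'a tensor3 \<Rightarrow>
    'a vfield \<Rightarrow> 'a vfield \<Rightarrow> 'a vfield \<Rightarrow> 'a vfield \<Rightarrow> 'a \<Rightarrow> real" where
  "cov_deriv3 D C W X Y Z p = lie_deriv W (\<lambda>q. C q (X q) (Y q) (Z q)) p
     - C p (D W X p) (Y p) (Z p) - C p (X p) (D W Y p) (Z p) - C p (X p) (Y p) (D W Z p)"

definition parallel3 :: "'a::euclidean_space connection \<Rightarrow> 'a tensor3 \<Rightarrow> bool" where
  "parallel3 D C \<longleftrightarrow> (\<forall>W X Y Z. smooth W \<longrightarrow> smooth X \<longrightarrow> smooth Y \<longrightarrow> smooth Z \<longrightarrow>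
     cov_deriv3 D C W X Y Z = (\<lambda>p. 0))"

definition pullback_metric :: "('a::euclidean_space \<Rightarrow> 'a) \<Rightarrow> 'a tensor2 \<Rightarrow> 'a tensor2" where
  "pullback_metric \<phi> g p u v =
     g (\<phi> p) (frechet_derivative \<phi> (at p) u) (frechet_derivative \<phi> (at p) v)"

definition pullback_connection :: "('a::euclidean_space \<Rightarrow> 'a) \<Rightarrow> 'a connection \<Rightarrow> 'a connection" where
  "pullback_connection \<phi> D X Y = pushforward (inv \<phi>) (D (pushforward \<phi> X) (pushforward \<phi> Y))"

section \<open>Left-invariant structures\<close>

text \<open>
  In this section \<open>mul\<close> is a Lie group multiplication on \<open>'a\<close> with unit element 0, and the Lie algebra
  is the tangent space at 0, a vector \<open>v\<close> corresponding to the left-invariant field \<open>lfield mul v\<close>.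
\<close>

definition lfield :: "('a::euclidean_space \<Rightarrow> 'a \<Rightarrow> 'a) \<Rightarrow> 'a \<Rightarrow> 'a vfield" where
  "lfield mul v p = frechet_derivative (mul p) (at 0) v"

definition left_invariant_metric :: "('a::euclidean_space \<Rightarrow> 'a \<Rightarrow> 'a) \<Rightarrow> 'a tensor2 \<Rightarrow> bool" where
  "left_invariant_metric mul g \<longleftrightarrow> riemannian_metric g \<and> (\<forall>a. pullback_metric (mul a) g = g)"

definition left_invariant_connection :: "('a::euclidean_space \<Rightarrow> 'a \<Rightarrow> 'a) \<Rightarrow> 'a connection \<Rightarrow> bool" where
  "left_invariant_connection mul D \<longleftrightarrow>
     affine_connection D \<and> (\<forall>a. pullback_connection (mul a) D = D)"

definition S1 :: "('a::euclidean_space \<Rightarrow> real) set" where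
  "S1 = {p. linear p}"

definition S3 :: "('a::euclidean_space \<Rightarrow> 'a \<Rightarrow> 'a \<Rightarrow> real) set" where
  "S3 = {c. (\<forall>v w. linear (\<lambda>u. c u v w)) \<and> (\<forall>u v w. c u v w = c v u w \<and> c u v w = c u w v)}"

text \<open>The left-invariant cubic form with value \<open>c\<close> at the unit element.\<close>

definition left_form3 :: "('a::euclidean_space \<Rightarrow> 'a \<Rightarrow> 'a) \<Rightarrow>
    ('a \<Rightarrow> 'a \<Rightarrow> 'a \<Rightarrow> real) \<Rightarrow> 'a tensor3" where
  "left_form3 mul c p u v w =
     (let \<theta> = frechet_derivative (inv (mul p)) (at p) in c (\<theta> u) (\<theta> v) (\<theta> w))"

definition S3_CS :: "('a::euclidean_space \<Rightarrow> 'a \<Rightarrow> 'a) \<Rightarrow> 'a tensor2 \<Rightarrow>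
    ('a \<Rightarrow> 'a \<Rightarrow> 'a \<Rightarrow> real) set" where
  "S3_CS mul g =
     {c \<in> S3. conjugate_symmetric g (statistical_connection g (left_form3 mul c))}"

definition S3_DF :: "('a::euclidean_space \<Rightarrow> 'a \<Rightarrow> 'a) \<Rightarrow> 'a tensor2 \<Rightarrow>
    ('a \<Rightarrow> 'a \<Rightarrow> 'a \<Rightarrow> real) set" where
  "S3_DF mul g = {c \<in> S3. dually_flat (statistical_connection g (left_form3 mul c))}"

definition LStat :: "('a::euclidean_space \<Rightarrow> 'a \<Rightarrow> 'a) \<Rightarrow> ('a tensor2 \<times> 'a connection) set" where
  "LStat mul = {(g, D). statistical_structure g D \<and>
     left_invariant_metric mul g \<and> left_invariant_connection mul D}"

text \<open>
  The topology comes from the identification of \<open>(g, \<nabla>)\<close> with the values of \<open>g\<close> and \<open>\<nabla>g\<close> at the unit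
  element. Spaces of multilinear forms carry the topology of pointwise convergence, which on these
  finite-dimensional spaces is the usual one.
\<close>

definition LStat_topology :: "('a::euclidean_space \<Rightarrow> 'a \<Rightarrow> 'a) \<Rightarrow>
    ('a tensor2 \<times> 'a connection) topology" where
  "LStat_topology mul =
     pullback_topology (LStat mul) (\<lambda>(g, D). (g 0, cubic_at D g 0)) euclidean"

definition lie_Aut :: "('a::euclidean_space \<Rightarrow> 'a \<Rightarrow> 'a) \<Rightarrow> ('a \<Rightarrow> 'a) set" where
  "lie_Aut mul = {\<phi>. diffeo \<phi> \<and> (\<forall>x y. \<phi> (mul x y) = mul (\<phi> x) (\<phi> y))}"

definition stat_act :: "real \<times> ('a::euclidean_space \<Rightarrow> 'a) \<Rightarrow>
    'a tensor2 \<times> 'a connection \<Rightarrow> 'a tensor2 \<times> 'a connection" where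
  "stat_act = (\<lambda>(r, \<phi>) (g, D).
     (\<lambda>p u v. r * pullback_metric (inv \<phi>) g p u v, pullback_connection (inv \<phi>) D))"

section \<open>Orbit spaces\<close>

definition orbit :: "('k \<Rightarrow> 'x \<Rightarrow> 'x) \<Rightarrow> 'k set \<Rightarrow> 'x \<Rightarrow> 'x set" where
  "orbit act K x = (\<lambda>k. act k x) ` K"

definition orbit_space :: "('k \<Rightarrow> 'x \<Rightarrow> 'x) \<Rightarrow> 'k set \<Rightarrow> 'x topology \<Rightarrow> 'x set topology" where
  "orbit_space act K T = topology (\<lambda>U. U \<subseteq> orbit act K ` topspace T \<and>
     openin T {x \<in> topspace T. orbit act K x \<in> U})"

lemma openin_orbit_space:
  "openin (orbit_space act K T) U \<longleftrightarrow>
     U \<subseteq> orbit act K ` topspace T \<and> openin T {x \<in> topspace T. orbit act K x \<in> U}"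
proof -
  have "istopology (\<lambda>U. U \<subseteq> orbit act K ` topspace T \<and>
     openin T {x \<in> topspace T. orbit act K x \<in> U})"
    unfolding istopology_def
  proof (intro conjI allI impI)
    fix U V
    assume "U \<subseteq> orbit act K ` topspace T \<and> openin T {x \<in> topspace T. orbit act K x \<in> U}"
      and "V \<subseteq> orbit act K ` topspace T \<and> openin T {x \<in> topspace T. orbit act K x \<in> V}"
    moreover have "{x \<in> topspace T. orbit act K x \<in> U \<inter> V} =
        {x \<in> topspace T. orbit act K x \<in> U} \<inter> {x \<in> topspace T. orbit act K x \<in> V}"
      by auto
    ultimately show "U \<inter> V \<subseteq> orbit act K ` topspace T"
        "openin T {x \<in> topspace T. orbit act K x \<in> U \<inter> V}"
      by auto
  next
    fix \<K> assume *: "\<forall>U\<in>\<K>. U \<subseteq> orbit act K ` topspace T \<and>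
        openin T {x \<in> topspace T. orbit act K x \<in> U}"
    then show "\<Union>\<K> \<subseteq> orbit act K ` topspace T" by blast
    have "{x \<in> topspace T. orbit act K x \<in> \<Union>\<K>} =
        (\<Union>U\<in>\<K>. {x \<in> topspace T. orbit act K x \<in> U})"
      by auto
    with * show "openin T {x \<in> topspace T. orbit act K x \<in> \<Union>\<K>}"
      by auto
  qed
  then show ?thesis
    by (simp add: orbit_space_def topology_inverse')
qed

lemma topspace_orbit_space: "topspace (orbit_space act K T) = orbit act K ` topspace T"
proof -
  have "openin (orbit_space act K T) (orbit act K ` topspace T)"
  proof -
    have "{x \<in> topspace T. orbit act K x \<in> orbit act K ` topspace T} = topspace T" by auto
    then show ?thesis by (simp add: openin_orbit_space)
  qed
  moreover have "U \<subseteq> orbit act K ` topspace T" if "openin (orbit_space act K T) U" for U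
    using that by (simp add: openin_orbit_space)
  ultimately show ?thesis
    by (metis openin_subset openin_topspace subset_antisym)
qed

definition MLStat :: "('a::euclidean_space \<Rightarrow> 'a \<Rightarrow> 'a) \<Rightarrow>
    ('a tensor2 \<times> 'a connection) set topology" where
  "MLStat mul = orbit_space stat_act ({0<..} \<times> lie_Aut mul) (LStat_topology mul)"

definition MLStat_CS :: "('a::euclidean_space \<Rightarrow> 'a \<Rightarrow> 'a) \<Rightarrow>
    ('a tensor2 \<times> 'a connection) set topology" where
  "MLStat_CS mul = orbit_space stat_act ({0<..} \<times> lie_Aut mul)
     (subtopology (LStat_topology mul) {(g, D). conjugate_symmetric g D})"

definition MLStat_DF :: "('a::euclidean_space \<Rightarrow> 'a \<Rightarrow> 'a) \<Rightarrow>
    ('a tensor2 \<times> 'a connection) set topology" where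
  "MLStat_DF mul = orbit_space stat_act ({0<..} \<times> lie_Aut mul)
     (subtopology (LStat_topology mul) {(g, D). dually_flat D})"

section \<open>The group \<open>H\<^sup>3 \<times> \<real>\<^sup>n\<^sup>-\<^sup>3\<close>\<close>

text \<open>
  Coordinates are numbered by \<open>1, ..., n\<close> through a bijection \<open>\<iota>\<close> from \<open>{1..n}\<close> onto the index type
  (\<open>n = 3\<close> must be allowed, so the index type cannot be split as \<open>3 + 'm\<close>). The first three are the
  exponential coordinates of the Heisenberg group, the others are those of \<open>\<real>\<^sup>n\<^sup>-\<^sup>3\<close>.
\<close>

definition basis_vec :: "(nat \<Rightarrow> 'n::finite) \<Rightarrow> nat \<Rightarrow> real ^ 'n" where
  "basis_vec \<iota> i = axis (\<iota> i) 1"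

definition coord :: "(nat \<Rightarrow> 'n::finite) \<Rightarrow> nat \<Rightarrow> real ^ 'n \<Rightarrow> real" where
  "coord \<iota> i x = x $ \<iota> i"

definition heis_mul :: "(nat \<Rightarrow> 'n::finite) \<Rightarrow> real ^ 'n \<Rightarrow> real ^ 'n \<Rightarrow> real ^ 'n" where
  "heis_mul \<iota> x y = x + y +
     ((coord \<iota> 1 x * coord \<iota> 2 y - coord \<iota> 2 x * coord \<iota> 1 y) / 2) *\<^sub>R basis_vec \<iota> 3"

lemma heis_mul_nth:
  fixes \<iota> :: "nat \<Rightarrow> 'n::finite"
  shows "heis_mul \<iota> x y $ k = x $ k + y $ k +
     (if k = \<iota> 3 then (x $ \<iota> 1 * y $ \<iota> 2 - x $ \<iota> 2 * y $ \<iota> 1) / 2 else 0)"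
  by (simp add: heis_mul_def coord_def basis_vec_def axis_def)

text \<open>The first three coordinates form the group of unitriangular matrices.\<close>

lemma heis_mul_unitriangular:
  fixes \<iota> :: "nat \<Rightarrow> 'n::finite"
  defines "U \<equiv> \<lambda>x. vector [vector [1, x $ \<iota> 1, x $ \<iota> 3 + x $ \<iota> 1 * x $ \<iota> 2 / 2],
                           vector [0, 1, x $ \<iota> 2], vector [0, 0, 1]] :: real ^ 3 ^ 3"
  assumes "inj_on \<iota> {1..3}"
  shows "U (heis_mul \<iota> x y) = U x ** U y"
proof -
  have ne: "\<iota> 1 \<noteq> \<iota> 3" "\<iota> 2 \<noteq> \<iota> 3"
    using assms(2) by (auto dest: inj_onD)
  show ?thesis
    unfolding U_def
    by (simp add: vec_eq_iff forall_3 matrix_matrix_mult_def sum_3 vector_3 heis_mul_nth ne ne[simplified])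
       (simp add: field_simps)
qed

lemma heis_mul_group:
  fixes \<iota> :: "nat \<Rightarrow> 'n::finite"
  assumes "inj_on \<iota> {1..3}"
  shows "heis_mul \<iota> (heis_mul \<iota> x y) z = heis_mul \<iota> x (heis_mul \<iota> y z)"
    "heis_mul \<iota> 0 x = x" "heis_mul \<iota> x 0 = x" "heis_mul \<iota> (- x) x = 0"
proof -
  have ne: "\<iota> 1 \<noteq> \<iota> 3" "\<iota> 2 \<noteq> \<iota> 3"
    using assms by (auto dest: inj_onD)
  have "heis_mul \<iota> (heis_mul \<iota> x y) z $ k = heis_mul \<iota> x (heis_mul \<iota> y z) $ k" for k
    by (cases "k = \<iota> 3") (simp_all add: heis_mul_nth ne ne[simplified] add_divide_distrib diff_divide_distrib algebra_simps)
  then show "heis_mul \<iota> (heis_mul \<iota> x y) z = heis_mul \<iota> x (heis_mul \<iota> y z)"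
    by (simp add: vec_eq_iff)
  show "heis_mul \<iota> 0 x = x" "heis_mul \<iota> x 0 = x" "heis_mul \<iota> (- x) x = 0"
    by (simp_all add: vec_eq_iff heis_mul_nth)
qed

lemma lfield_heis:
  fixes \<iota> :: "nat \<Rightarrow> 'n::finite"
  shows "lfield (heis_mul \<iota>) v = (\<lambda>p. v +
     ((coord \<iota> 1 p * coord \<iota> 2 v - coord \<iota> 2 p * coord \<iota> 1 v) / 2) *\<^sub>R basis_vec \<iota> 3)"
proof
  fix p
  have "linear (\<lambda>v. v +
     ((coord \<iota> 1 p * coord \<iota> 2 v - coord \<iota> 2 p * coord \<iota> 1 v) / 2) *\<^sub>R basis_vec \<iota> 3)"
    by (rule linearI) (simp_all add: coord_def vec_eq_iff field_simps)
  from has_derivative_add[OF has_derivative_const linear_imp_has_derivative[OF this], of p "at 0"]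
  have "(heis_mul \<iota> p has_derivative (\<lambda>v. v +
     ((coord \<iota> 1 p * coord \<iota> 2 v - coord \<iota> 2 p * coord \<iota> 1 v) / 2) *\<^sub>R basis_vec \<iota> 3)) (at 0)"
    by (simp add: heis_mul_def[abs_def] add.assoc)
  from frechet_derivative_at[OF this, THEN fun_cong, of v]
  show "lfield (heis_mul \<iota>) v p = v +
     ((coord \<iota> 1 p * coord \<iota> 2 v - coord \<iota> 2 p * coord \<iota> 1 v) / 2) *\<^sub>R basis_vec \<iota> 3"
    unfolding lfield_def by (rule sym)
qed

text \<open>In particular \<open>[e\<^sub>1, e\<^sub>2] = e\<^sub>3\<close>, and all other brackets of basis fields vanish.\<close>

lemma lie_bracket_lfield_heis:
  fixes \<iota> :: "nat \<Rightarrow> 'n::finite"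
  assumes "inj_on \<iota> {1..3}"
  shows "lie_bracket (lfield (heis_mul \<iota>) v) (lfield (heis_mul \<iota>) w) =
    lfield (heis_mul \<iota>) ((coord \<iota> 1 v * coord \<iota> 2 w - coord \<iota> 2 v * coord \<iota> 1 w) *\<^sub>R basis_vec \<iota> 3)"
proof
  fix p
  have ne: "\<iota> 1 \<noteq> \<iota> 3" "\<iota> 2 \<noteq> \<iota> 3"
    using assms by (auto dest: inj_onD)
  have D: "frechet_derivative (lfield (heis_mul \<iota>) v) (at p) =
      (\<lambda>u. ((coord \<iota> 1 u * coord \<iota> 2 v - coord \<iota> 2 u * coord \<iota> 1 v) / 2) *\<^sub>R basis_vec \<iota> 3)" for v
  proof -
    have "linear (\<lambda>u.
        ((coord \<iota> 1 u * coord \<iota> 2 v - coord \<iota> 2 u * coord \<iota> 1 v) / 2) *\<^sub>R basis_vec \<iota> 3)"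
      by (rule linearI) (simp_all add: coord_def vec_eq_iff field_simps)
    from has_derivative_add[OF has_derivative_const linear_imp_has_derivative[OF this], of v "at p"]
    have "(lfield (heis_mul \<iota>) v has_derivative
      (\<lambda>u. ((coord \<iota> 1 u * coord \<iota> 2 v - coord \<iota> 2 u * coord \<iota> 1 v) / 2) *\<^sub>R basis_vec \<iota> 3)) (at p)"
      by (simp add: lfield_heis)
    from frechet_derivative_at[OF this] show ?thesis by simp
  qed
  have "lie_bracket (lfield (heis_mul \<iota>) v) (lfield (heis_mul \<iota>) w) p $ k =
    lfield (heis_mul \<iota>) ((coord \<iota> 1 v * coord \<iota> 2 w - coord \<iota> 2 v * coord \<iota> 1 w) *\<^sub>R basis_vec \<iota> 3) p $ k" for k
    unfolding lie_bracket_def D using ne ne[simplified]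
    by (cases "k = \<iota> 3")
       (simp_all add: lfield_heis coord_def basis_vec_def axis_def
         add_divide_distrib diff_divide_distrib algebra_simps)
  then show "lie_bracket (lfield (heis_mul \<iota>) v) (lfield (heis_mul \<iota>) w) p =
    lfield (heis_mul \<iota>) ((coord \<iota> 1 v * coord \<iota> 2 w - coord \<iota> 2 v * coord \<iota> 1 w) *\<^sub>R basis_vec \<iota> 3) p"
    by (simp add: vec_eq_iff)
qed

text \<open>
  \<open>S\<^sup>k\<close> of the dual of the abelian factor, as a subspace of \<open>S\<^sup>k\<close> of the dual of the whole Lie algebra:
  forms pulled back along the projection to the abelian factor.
\<close>

definition ab_proj :: "(nat \<Rightarrow> 'n::finite) \<Rightarrow> nat \<Rightarrow> real ^ 'n \<Rightarrow> real ^ 'n" where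
  "ab_proj \<iota> n x = (\<Sum>i\<in>{4..n}. coord \<iota> i x *\<^sub>R basis_vec \<iota> i)"

definition S1_ab :: "(nat \<Rightarrow> 'n::finite) \<Rightarrow> nat \<Rightarrow> (real ^ 'n \<Rightarrow> real) set" where
  "S1_ab \<iota> n = (\<lambda>p u. p (ab_proj \<iota> n u)) ` S1"

definition S3_ab :: "(nat \<Rightarrow> 'n::finite) \<Rightarrow> nat \<Rightarrow> (real ^ 'n \<Rightarrow> real ^ 'n \<Rightarrow> real ^ 'n \<Rightarrow> real) set" where
  "S3_ab \<iota> n = (\<lambda>p u v w. p (ab_proj \<iota> n u) (ab_proj \<iota> n v) (ab_proj \<iota> n w)) ` S3"

definition sym_prod :: "('a \<Rightarrow> real) list \<Rightarrow> 'a list \<Rightarrow> real" where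
  "sym_prod xs Xs = 1 / fact (length xs) *
     (\<Sum>\<sigma> | \<sigma> permutes {..<length xs}. \<Prod>i<length xs. (xs ! \<sigma> i) (Xs ! i))"

text \<open>\<open>w\<^sub>0 p = x\<^sub>1x\<^sub>1p + x\<^sub>2x\<^sub>2p + x\<^sub>3x\<^sub>3p\<close> for \<open>p \<in> S\<^sup>1\<close>.\<close>

definition w0_prod :: "(nat \<Rightarrow> 'n::finite) \<Rightarrow> (real ^ 'n \<Rightarrow> real) \<Rightarrow>
    real ^ 'n \<Rightarrow> real ^ 'n \<Rightarrow> real ^ 'n \<Rightarrow> real" where
  "w0_prod \<iota> p u v w = (\<Sum>i\<in>{1..3}. sym_prod [coord \<iota> i, coord \<iota> i, p] [u, v, w])"

text \<open>
  Homogeneous polynomials of degree \<open>k\<close> in the coordinates indexed by \<open>I\<close>, as polynomial functions;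
  a monomial is given by its exponents \<open>m\<close>.
\<close>

definition homog :: "'n::finite set \<Rightarrow> nat \<Rightarrow> (real ^ 'n \<Rightarrow> real) set" where
  "homog I k = {f. \<exists>a. f = (\<lambda>x.
     \<Sum>m | (\<forall>i. i \<notin> I \<longrightarrow> m i = 0) \<and> (\<Sum>i\<in>UNIV. m i) = k. a m * (\<Prod>i\<in>UNIV. (x $ i) ^ m i))}"

definition poly_act :: "real ^ 'n ^ 'n \<Rightarrow> (real ^ 'n \<Rightarrow> real) \<Rightarrow> real ^ 'n \<Rightarrow> real" where
  "poly_act h f x = f (matrix_inv h *v x)"

text \<open>
  Orthogonal block matrices \<open>diag(A, c, B)\<close> with blocks of size 2, 1, \<open>n - 3\<close>. A block diagonal matrix
  is orthogonal iff its blocks are.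
\<close>

definition orth_blocks :: "(nat \<Rightarrow> 'n::finite) \<Rightarrow> nat \<Rightarrow> (real ^ 'n ^ 'n) set" where
  "orth_blocks \<iota> n = {h. orthogonal_matrix h \<and>
     (\<forall>i\<in>{1..n}. \<forall>j\<in>{1..n}. h $ \<iota> i $ \<iota> j \<noteq> 0 \<longrightarrow>
        {i, j} \<subseteq> {1, 2} \<or> {i, j} \<subseteq> {3} \<or> {i, j} \<subseteq> {4..n})}"

definition upper_block :: "(nat \<Rightarrow> 'n::finite) \<Rightarrow> real ^ 'n ^ 'n \<Rightarrow> real ^ 2 ^ 2" where
  "upper_block \<iota> h = vector [vector [h $ \<iota> 1 $ \<iota> 1, h $ \<iota> 1 $ \<iota> 2],
                           vector [h $ \<iota> 2 $ \<iota> 1, h $ \<iota> 2 $ \<iota> 2]]"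

text \<open>\<open>S(O(2) \<times> O(1)) \<times> O(n - 3)\<close>\<close>

definition SO21_O :: "(nat \<Rightarrow> 'n::finite) \<Rightarrow> nat \<Rightarrow> (real ^ 'n ^ 'n) set" where
  "SO21_O \<iota> n = {h \<in> orth_blocks \<iota> n. h $ \<iota> 3 $ \<iota> 3 = det (upper_block \<iota> h)}"

text \<open>\<open>O(n - 3)\<close>, as the matrices \<open>diag(1, 1, 1, B)\<close>\<close>

definition O_ab :: "(nat \<Rightarrow> 'n::finite) \<Rightarrow> nat \<Rightarrow> (real ^ 'n ^ 'n) set" where
  "O_ab \<iota> n = {h \<in> orth_blocks \<iota> n. upper_block \<iota> h = mat 1 \<and> h $ \<iota> 3 $ \<iota> 3 = 1}"

end

theory Submission
  imports Defs
begin

text \<open>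
  In the left-invariant frame a left-invariant connection has constant coefficients, a bilinear map
  \<open>\<Gamma>\<close> on the Lie algebra, and torsion, cubic form and curvature become algebraic expressions in \<open>\<Gamma>\<close>
  and the bracket (\<open>fr_lie_bracket\<close>, \<open>cubic_conn\<close>, \<open>fr_curvature_conn\<close>). The Koszul formula with the
  cubic form added therefore identifies left-invariant statistical structures with pairs \<open>(b, c)\<close> of
  an inner product and a symmetric cubic form (\<open>lstruct_LStat\<close>, \<open>LStat_cases\<close>), and the dual
  connection belongs to \<open>(b, - c)\<close>. Smooth automorphisms of the group are linear in exponential
  coordinates, so the group acts on the pairs through rescalings and Lie algebra automorphisms
  (\<open>lie_Aut_eq\<close>, \<open>stat_act_lstruct\<close>).

  For the standard inner product, \<open>(b, c)\<close> is conjugate symmetric iff \<open>\<nabla>\<^sup>gc\<close> is totally symmetric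
  (\<open>curv_dual_eq_iff\<close>). The endomorphisms \<open>\<nabla>\<^sup>g\<^sub>x\<close> are infinitesimal rotations of the span of
  \<open>e\<^sub>1, e\<^sub>2, e\<^sub>3\<close>; they annihilate \<open>w\<^sub>0\<close> and every form on the abelian factor, so all \<open>w\<^sub>0 p\<^sub>1 + p\<^sub>3\<close> are
  parallel, and a linear system of full rank shows that there are no other solutions
  (\<open>symmetric_cov_imp_CS\<close>). For them the sectional curvature of \<open>e\<^sub>1, e\<^sub>3\<close> is \<open>1/4 + |p\<^sub>1|\<^sup>2/36\<close>
  (\<open>curv_CS_13\<close>). The dual of a flat connection is flat, so flat structures are conjugate symmetric,
  and the positive curvature excludes them.

  For the moduli spaces, Gram-Schmidt in the order \<open>e\<^sub>3, e\<^sub>4, \<dots>, e\<^sub>n, e\<^sub>2, e\<^sub>1\<close> yields, continuously in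
  \<open>b\<close>, a rescaling and an automorphism that carry \<open>b\<close> to the standard inner product
  (\<open>lact_normal_form\<close>, \<open>continuous_on_nf_form\<close>). The stabilizer of the standard inner product consists
  of the isometric automorphisms, which form \<open>S(O(2) \<times> O(1)) \<times> O(n - 3)\<close> (\<open>similar_aut_isometric\<close>,
  \<open>SO21_O_iff\<close>). Hence an orbit space of pairs is the orbit space of the cubic forms over the standard
  inner product, and polarization identifies these forms with homogeneous polynomials
  (\<open>homog_3_iff\<close>). On conjugate symmetric forms only the block of \<open>O(n - 3)\<close> acts effectively
  (\<open>orbit_pair_act_eq\<close>).
\<close>

section \<open>Calculus of smooth maps\<close>

primrec smooth_upto :: "nat \<Rightarrow> ('a::euclidean_space \<Rightarrow> 'b::real_normed_vector) \<Rightarrow> bool" where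
  "smooth_upto 0 f = True"
| "smooth_upto (Suc k) f = ((\<forall>x. f differentiable (at x)) \<and>
     (\<forall>v. smooth_upto k (\<lambda>x. frechet_derivative f (at x) v)))"

lemma smooth_imp_differentiable: "smooth f \<Longrightarrow> f differentiable (at x)"
  by (erule smooth.cases) simp

lemma smooth_frechet_derivative: "smooth f \<Longrightarrow> smooth (\<lambda>x. frechet_derivative f (at x) v)"
  by (erule smooth.cases) simp

lemma smooth_has_derivative:
  "smooth f \<Longrightarrow> (f has_derivative frechet_derivative f (at x)) (at x)"
  using smooth_imp_differentiable frechet_derivative_works by blast

lemma smooth_linear_derivative: "smooth f \<Longrightarrow> linear (frechet_derivative f (at x))"
  using smooth_has_derivative has_derivative_linear by blast

lemma smooth_continuous: "smooth f \<Longrightarrow> continuous (at x) f"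
  using smooth_imp_differentiable differentiable_imp_continuous_within by blast

text \<open>
  The coinductive notion is the intersection of the finite orders of differentiability, so closure
  properties of smooth maps can be proved by induction on the order.
\<close>

lemma smooth_iff_smooth_upto: "smooth f \<longleftrightarrow> (\<forall>k. smooth_upto k f)"
proof
  have "smooth f \<Longrightarrow> smooth_upto k f" for k
    by (induction k arbitrary: f)
       (simp_all add: smooth_imp_differentiable smooth_frechet_derivative)
  then show "smooth f \<Longrightarrow> \<forall>k. smooth_upto k f" by blast
next
  assume "\<forall>k. smooth_upto k f"
  then show "smooth f"
  proof (coinduction arbitrary: f)
    case smooth
    have "f differentiable (at x)" for x
      using spec[OF smooth, of 1] by simp
    moreover have "smooth_upto k (\<lambda>x. frechet_derivative f (at x) v)" for k v
      using spec[OF smooth, of "Suc k"] by simp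
    ultimately show ?case by auto
  qed
qed

lemma smooth_upto_mono: "smooth_upto (Suc k) f \<Longrightarrow> smooth_upto k f"
  by (induction k arbitrary: f) auto

lemma smooth_upto_const: "smooth_upto k (\<lambda>x. c)"
  by (induction k arbitrary: c) simp_all

lemma frechet_derivative_add_differentiable:
  "f differentiable (at x) \<Longrightarrow> g differentiable (at x) \<Longrightarrow> frechet_derivative (\<lambda>x. f x + g x) (at x) v =
     frechet_derivative f (at x) v + frechet_derivative g (at x) v"
  using frechet_derivative_at[OF has_derivative_add[OF iffD1[OF frechet_derivative_works] iffD1[OF frechet_derivative_works]],
      of f x g, THEN fun_cong, of v] by simp

lemma smooth_upto_add:
  "smooth_upto k f \<Longrightarrow> smooth_upto k g \<Longrightarrow> smooth_upto k (\<lambda>x. f x + g x)"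
proof (induction k arbitrary: f g)
  case (Suc k)
  have "frechet_derivative (\<lambda>x. f x + g x) (at x) v =
      frechet_derivative f (at x) v + frechet_derivative g (at x) v" for x v
    using Suc.prems by (intro frechet_derivative_add_differentiable) auto
  with Suc show ?case by (auto intro: differentiable_add)
qed simp

lemma smooth_upto_sum:
  "finite A \<Longrightarrow> (\<And>i. i \<in> A \<Longrightarrow> smooth_upto k (f i)) \<Longrightarrow> smooth_upto k (\<lambda>x. \<Sum>i\<in>A. f i x)"
  by (induction A rule: finite_induct) (auto simp: smooth_upto_const smooth_upto_add)

lemma smooth_upto_bilinear:
  assumes "bounded_bilinear B"
  shows "smooth_upto k f \<Longrightarrow> smooth_upto k g \<Longrightarrow> smooth_upto k (\<lambda>x. B (f x) (g x))"
proof (induction k arbitrary: f g)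
  case (Suc k)
  have d: "(f has_derivative frechet_derivative f (at x)) (at x)"
      "(g has_derivative frechet_derivative g (at x)) (at x)" for x
    using Suc.prems by (auto simp flip: frechet_derivative_works)
  have B: "((\<lambda>x. B (f x) (g x)) has_derivative
      (\<lambda>v. B (f x) (frechet_derivative g (at x) v) + B (frechet_derivative f (at x) v) (g x))) (at x)" for x
    by (rule bounded_bilinear.FDERIV[OF assms d])
  have "frechet_derivative (\<lambda>x. B (f x) (g x)) (at x) v =
      B (f x) (frechet_derivative g (at x) v) + B (frechet_derivative f (at x) v) (g x)" for x v
    using frechet_derivative_at[OF B, THEN fun_cong] by simp
  moreover have "smooth_upto k (\<lambda>x. B (f x) (frechet_derivative g (at x) v) + B (frechet_derivative f (at x) v) (g x))" for v
    using Suc.prems by (intro smooth_upto_add Suc.IH smooth_upto_mono[of k f] smooth_upto_mono[of k g]) auto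
  moreover have "(\<lambda>x. B (f x) (g x)) differentiable (at x)" for x
    unfolding differentiable_def by (rule exI, rule B)
  ultimately show ?case by simp
qed simp

text \<open>
  The chain rule is used in the form \<open>D\<^sub>v(f \<circ> g) = \<Sum>\<^sub>i (D\<^sub>v g)\<^sub>i (D\<^sub>i f \<circ> g)\<close>: every term is again a
  product of a composition and a derivative, both of lower order.
\<close>

lemma smooth_upto_compose:
  fixes f :: "'b::euclidean_space \<Rightarrow> 'c::real_normed_vector" and g :: "'a::euclidean_space \<Rightarrow> 'b"
  shows "smooth_upto k f \<Longrightarrow> smooth_upto k g \<Longrightarrow> smooth_upto k (\<lambda>x. f (g x))"
proof (induction k arbitrary: f g)
  case (Suc k)
  have d: "(f has_derivative frechet_derivative f (at y)) (at y)"
      "(g has_derivative frechet_derivative g (at x)) (at x)" for x y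
    using Suc.prems by (auto simp flip: frechet_derivative_works)
  have C: "((\<lambda>x. f (g x)) has_derivative
      (\<lambda>v. frechet_derivative f (at (g x)) (frechet_derivative g (at x) v))) (at x)" for x
    by (rule has_derivative_compose[OF d(2) d(1)])
  have lin: "linear (frechet_derivative f (at y))" for y
    using d(1) has_derivative_linear by blast
  have "frechet_derivative (\<lambda>x. f (g x)) (at x) v =
      (\<Sum>b\<in>Basis. (frechet_derivative g (at x) v \<bullet> b) *\<^sub>R frechet_derivative f (at (g x)) b)" for x v
  proof -
    have "frechet_derivative (\<lambda>x. f (g x)) (at x) v =
        frechet_derivative f (at (g x)) (frechet_derivative g (at x) v)"
      using frechet_derivative_at[OF C, THEN fun_cong] by simp
    also have "\<dots> = frechet_derivative f (at (g x))
        (\<Sum>b\<in>Basis. (frechet_derivative g (at x) v \<bullet> b) *\<^sub>R b)"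
      by (simp add: euclidean_representation)
    also have "\<dots> = (\<Sum>b\<in>Basis. (frechet_derivative g (at x) v \<bullet> b) *\<^sub>R frechet_derivative f (at (g x)) b)"
      using lin by (simp add: linear_sum linear_scale)
    finally show ?thesis .
  qed
  moreover have "smooth_upto k (\<lambda>x. \<Sum>b\<in>Basis. (frechet_derivative g (at x) v \<bullet> b) *\<^sub>R
      frechet_derivative f (at (g x)) b)" for v
  proof (intro smooth_upto_sum smooth_upto_bilinear[OF bounded_bilinear_scaleR] finite_Basis)
    fix b :: 'b
    show "smooth_upto k (\<lambda>x. frechet_derivative g (at x) v \<bullet> b)"
      using Suc.prems by (intro smooth_upto_bilinear[OF bounded_bilinear_inner] smooth_upto_const) auto
    show "smooth_upto k (\<lambda>x. frechet_derivative f (at (g x)) b)"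
      using Suc.prems by (intro Suc.IH[of "\<lambda>y. frechet_derivative f (at y) b"] smooth_upto_mono[of k g]) auto
  qed
  moreover have "(\<lambda>x. f (g x)) differentiable (at x)" for x
    unfolding differentiable_def by (rule exI, rule C)
  ultimately show ?case by simp
qed simp

lemma smooth_const [simp]: "smooth (\<lambda>x. c)"
  by (simp add: smooth_iff_smooth_upto smooth_upto_const)

lemma smooth_add: "smooth f \<Longrightarrow> smooth g \<Longrightarrow> smooth (\<lambda>x. f x + g x)"
  by (simp add: smooth_iff_smooth_upto smooth_upto_add)

lemma smooth_sum:
  "finite A \<Longrightarrow> (\<And>i. i \<in> A \<Longrightarrow> smooth (f i)) \<Longrightarrow> smooth (\<lambda>x. \<Sum>i\<in>A. f i x)"
  by (simp add: smooth_iff_smooth_upto smooth_upto_sum)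

lemma smooth_bounded_bilinear:
  "bounded_bilinear B \<Longrightarrow> smooth f \<Longrightarrow> smooth g \<Longrightarrow> smooth (\<lambda>x. B (f x) (g x))"
  by (simp add: smooth_iff_smooth_upto smooth_upto_bilinear)

lemma smooth_compose: "smooth f \<Longrightarrow> smooth g \<Longrightarrow> smooth (\<lambda>x. f (g x))"
  by (simp add: smooth_iff_smooth_upto smooth_upto_compose)

lemma smooth_scaleR: "smooth f \<Longrightarrow> smooth g \<Longrightarrow> smooth (\<lambda>x. f x *\<^sub>R g x)"
  by (rule smooth_bounded_bilinear[OF bounded_bilinear_scaleR])

lemma smooth_inner: "smooth f \<Longrightarrow> smooth g \<Longrightarrow> smooth (\<lambda>x. f x \<bullet> g x)"
  by (rule smooth_bounded_bilinear[OF bounded_bilinear_inner])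

lemma smooth_linear:
  fixes f :: "'a::euclidean_space \<Rightarrow> 'b::real_normed_vector"
  assumes "linear f" shows "smooth f"
proof (rule smooth.intros)
  have d: "(f has_derivative f) (at x)" for x
    by (rule linear_imp_has_derivative[OF assms])
  show "f differentiable (at x)" for x
    using d differentiable_def by blast
  have "frechet_derivative f (at x) = f" for x
    by (rule frechet_derivative_at[OF d, symmetric])
  then show "smooth (\<lambda>x. frechet_derivative f (at x) v)" for v by simp
qed

lemma smooth_diff: "smooth f \<Longrightarrow> smooth g \<Longrightarrow> smooth (\<lambda>x. f x - g x)"
  using smooth_add[of f "\<lambda>x. (-1) *\<^sub>R g x"] smooth_scaleR[of "\<lambda>_. -1" g] by simp

lemma smooth_bilinear:
  fixes B :: "'b::euclidean_space \<Rightarrow> 'c::euclidean_space \<Rightarrow> 'd::real_normed_vector"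
  shows "bilinear B \<Longrightarrow> smooth f \<Longrightarrow> smooth g \<Longrightarrow> smooth (\<lambda>x. B (f x) (g x))"
  by (rule smooth_bounded_bilinear) (simp add: bilinear_conv_bounded_bilinear)

lemma linear_eq_sum_Basis:
  fixes f :: "'a::euclidean_space \<Rightarrow> 'b::real_vector"
  shows "linear f \<Longrightarrow> f v = (\<Sum>b\<in>Basis. (v \<bullet> b) *\<^sub>R f b)"
  using linear_sum[of f "\<lambda>b. (v \<bullet> b) *\<^sub>R b" Basis] by (simp add: euclidean_representation linear_scale)

lemma smooth_derivative_along:
  assumes "smooth f" "smooth X"
  shows "smooth (\<lambda>x. frechet_derivative f (at x) (X x))"
proof -
  have "smooth (\<lambda>x. \<Sum>b\<in>Basis. (X x \<bullet> b) *\<^sub>R frechet_derivative f (at x) b)"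
    using assms by (intro smooth_sum smooth_scaleR smooth_inner smooth_frechet_derivative) auto
  moreover have "(\<lambda>x. \<Sum>b\<in>Basis. (X x \<bullet> b) *\<^sub>R frechet_derivative f (at x) b) =
      (\<lambda>x. frechet_derivative f (at x) (X x))"
    by (rule ext, rule linear_eq_sum_Basis[OF smooth_linear_derivative[OF assms(1)], symmetric])
  ultimately show ?thesis by simp
qed

lemma frechet_derivative_bilinear:
  fixes B :: "'b::euclidean_space \<Rightarrow> 'c::euclidean_space \<Rightarrow> 'd::real_normed_vector"
  assumes "bilinear B" "smooth f" "smooth g"
  shows "frechet_derivative (\<lambda>x. B (f x) (g x)) (at x) v =
    B (f x) (frechet_derivative g (at x) v) + B (frechet_derivative f (at x) v) (g x)"
proof -
  have "((\<lambda>x. B (f x) (g x)) has_derivative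
      (\<lambda>v. B (f x) (frechet_derivative g (at x) v) + B (frechet_derivative f (at x) v) (g x))) (at x)"
    by (rule bounded_bilinear.FDERIV)
       (simp_all add: assms smooth_has_derivative flip: bilinear_conv_bounded_bilinear)
  from frechet_derivative_at[OF this, THEN fun_cong, of v] show ?thesis by simp
qed

lemma frechet_derivative_linear_compose:
  fixes A :: "'b::euclidean_space \<Rightarrow> 'c::euclidean_space"
  assumes "linear A" "smooth f"
  shows "frechet_derivative (\<lambda>x. A (f x)) (at x) v = A (frechet_derivative f (at x) v)"
  by (rule frechet_derivative_at[OF has_derivative_compose[OF smooth_has_derivative[OF assms(2)]
      linear_imp_has_derivative[OF assms(1)]], THEN fun_cong, symmetric])

lemma frechet_derivative_compose_smooth:
  assumes "smooth f" "smooth g"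
  shows "frechet_derivative (\<lambda>x. f (g x)) (at x) v =
    frechet_derivative f (at (g x)) (frechet_derivative g (at x) v)"
  by (rule frechet_derivative_at[OF has_derivative_compose[OF smooth_has_derivative[OF assms(2)]
      smooth_has_derivative[OF assms(1)]], THEN fun_cong, symmetric])

lemma frechet_derivative_add_smooth:
  "smooth f \<Longrightarrow> smooth g \<Longrightarrow> frechet_derivative (\<lambda>x. f x + g x) (at x) v =
     frechet_derivative f (at x) v + frechet_derivative g (at x) v"
  by (simp add: frechet_derivative_add_differentiable smooth_imp_differentiable)

lemma frechet_derivative_linear:
  fixes f :: "'a::euclidean_space \<Rightarrow> 'b::real_normed_vector"
  shows "linear f \<Longrightarrow> frechet_derivative f (at x) = f"
  by (rule frechet_derivative_at[OF linear_imp_has_derivative, symmetric])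

lemma has_derivative_on_line:
  fixes f :: "'a::euclidean_space \<Rightarrow> real"
  assumes "smooth f"
  shows "((\<lambda>s. f (p + s *\<^sub>R u)) has_real_derivative frechet_derivative f (at (p + s *\<^sub>R u)) u) (at s)"
proof -
  have "((\<lambda>s. p + s *\<^sub>R u) has_derivative (\<lambda>s. s *\<^sub>R u)) (at s)"
    by (auto intro!: derivative_eq_intros)
  from has_derivative_compose[OF this smooth_has_derivative[OF assms]]
  have "((\<lambda>s. f (p + s *\<^sub>R u)) has_derivative (\<lambda>t. frechet_derivative f (at (p + s *\<^sub>R u)) (t *\<^sub>R u))) (at s)" .
  moreover have "(\<lambda>t. frechet_derivative f (at (p + s *\<^sub>R u)) (t *\<^sub>R u)) =
      (*) (frechet_derivative f (at (p + s *\<^sub>R u)) u)"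
    by (rule ext) (simp only: linear_scale[OF smooth_linear_derivative[OF assms]] real_scaleR_def mult.commute)
  ultimately show ?thesis
    by (simp only: has_field_derivative_def)
qed

text \<open>
  A second difference is a second derivative at an intermediate point, by two applications of the
  mean value theorem; it is symmetric in the two directions.
\<close>

lemma second_difference_mean_value:
  fixes f :: "'a::euclidean_space \<Rightarrow> real"
  assumes "smooth f" "h > 0"
  shows "\<exists>s t. 0 < s \<and> s < h \<and> 0 < t \<and> t < h \<and>
    f (p + h *\<^sub>R u + h *\<^sub>R v) - f (p + h *\<^sub>R u) - f (p + h *\<^sub>R v) + f p =
    h * h * frechet_derivative (\<lambda>x. frechet_derivative f (at x) u) (at (p + s *\<^sub>R u + t *\<^sub>R v)) v"
proof -
  define fu where "fu = (\<lambda>x. frechet_derivative f (at x) u)"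
  have fu: "smooth fu"
    unfolding fu_def by (rule smooth_frechet_derivative[OF assms(1)])
  define q where "q = (\<lambda>s. f (p + h *\<^sub>R v + s *\<^sub>R u) - f (p + s *\<^sub>R u))"
  have "(q has_real_derivative (fu (p + h *\<^sub>R v + s *\<^sub>R u) - fu (p + s *\<^sub>R u))) (at s)" for s
    unfolding q_def fu_def by (intro DERIV_diff has_derivative_on_line assms)
  from MVT2[OF assms(2), of q, OF this] obtain s where s: "0 < s" "s < h"
    "q h - q 0 = h * (fu (p + s *\<^sub>R u + h *\<^sub>R v) - fu (p + s *\<^sub>R u))"
    by (auto simp: add_ac)
  have "((\<lambda>t. fu (p + s *\<^sub>R u + t *\<^sub>R v)) has_real_derivative
      frechet_derivative fu (at (p + s *\<^sub>R u + t *\<^sub>R v)) v) (at t)" for t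
    by (intro has_derivative_on_line fu)
  from MVT2[OF assms(2), of "\<lambda>t. fu (p + s *\<^sub>R u + t *\<^sub>R v)", OF this] obtain t where t: "0 < t" "t < h"
    "fu (p + s *\<^sub>R u + h *\<^sub>R v) - fu (p + s *\<^sub>R u) = h * frechet_derivative fu (at (p + s *\<^sub>R u + t *\<^sub>R v)) v"
    by auto
  have "f (p + h *\<^sub>R u + h *\<^sub>R v) - f (p + h *\<^sub>R u) - f (p + h *\<^sub>R v) + f p = q h - q 0"
    by (simp add: q_def add_ac)
  also have "\<dots> = h * h * frechet_derivative fu (at (p + s *\<^sub>R u + t *\<^sub>R v)) v"
    using s(3) t(3) by simp
  finally show ?thesis
    using s t unfolding fu_def by blast
qed

text \<open>
  As the step tends to 0, the quotient of the second difference by its square tends to both mixed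
  derivatives.
\<close>

lemma symmetric_second_derivative_real:
  fixes f :: "'a::euclidean_space \<Rightarrow> real"
  assumes "smooth f"
  shows "frechet_derivative (\<lambda>x. frechet_derivative f (at x) u) (at p) v =
         frechet_derivative (\<lambda>x. frechet_derivative f (at x) v) (at p) u"
proof -
  define G where "G = (\<lambda>u v x. frechet_derivative (\<lambda>x. frechet_derivative f (at x) u) (at x) v)"
  have cont: "isCont (G u v) p" for u v
    unfolding G_def by (intro smooth_continuous smooth_frechet_derivative assms)
  have lim: "((\<lambda>h. (f (p + h *\<^sub>R u + h *\<^sub>R v) - f (p + h *\<^sub>R u) - f (p + h *\<^sub>R v) + f p) / (h * h))
      \<longlongrightarrow> G u v p) (at_right 0)" for u v
  proof -
    have "\<forall>h. \<exists>s t. h > 0 \<longrightarrow> 0 < s \<and> s < h \<and> 0 < t \<and> t < h \<and>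
      f (p + h *\<^sub>R u + h *\<^sub>R v) - f (p + h *\<^sub>R u) - f (p + h *\<^sub>R v) + f p = h * h * G u v (p + s *\<^sub>R u + t *\<^sub>R v)"
      using second_difference_mean_value[OF assms] unfolding G_def by meson
    then obtain s t where st: "\<And>h. h > 0 \<Longrightarrow> 0 < s h \<and> s h < h \<and> 0 < t h \<and> t h < h \<and>
      f (p + h *\<^sub>R u + h *\<^sub>R v) - f (p + h *\<^sub>R u) - f (p + h *\<^sub>R v) + f p = h * h * G u v (p + s h *\<^sub>R u + t h *\<^sub>R v)"
      by metis
    have pos: "eventually (\<lambda>h::real. h > 0) (at_right 0)"
      by (simp add: eventually_at_right_less)
    have h: "((\<lambda>h::real. h) \<longlongrightarrow> 0) (at_right 0)"
      by (rule tendsto_ident_at)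
    have s0: "(s \<longlongrightarrow> 0) (at_right 0)"
      by (rule tendsto_sandwich[OF _ _ tendsto_const h]; rule eventually_mono[OF pos])
         (use st in \<open>auto intro: less_imp_le\<close>)
    have t0: "(t \<longlongrightarrow> 0) (at_right 0)"
      by (rule tendsto_sandwich[OF _ _ tendsto_const h]; rule eventually_mono[OF pos])
         (use st in \<open>auto intro: less_imp_le\<close>)
    have "((\<lambda>h. p + s h *\<^sub>R u + t h *\<^sub>R v) \<longlongrightarrow> p + 0 *\<^sub>R u + 0 *\<^sub>R v) (at_right 0)"
      by (intro tendsto_intros s0 t0)
    then have "((\<lambda>h. G u v (p + s h *\<^sub>R u + t h *\<^sub>R v)) \<longlongrightarrow> G u v p) (at_right 0)"
      using isCont_tendsto_compose[OF cont] by simp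
    moreover have "\<forall>\<^sub>F h in at_right 0. G u v (p + s h *\<^sub>R u + t h *\<^sub>R v) =
        (f (p + h *\<^sub>R u + h *\<^sub>R v) - f (p + h *\<^sub>R u) - f (p + h *\<^sub>R v) + f p) / (h * h)"
      by (rule eventually_mono[OF pos]) (use st in auto)
    ultimately show ?thesis
      by (rule Lim_transform_eventually)
  qed
  have "f (p + h *\<^sub>R v + h *\<^sub>R u) - f (p + h *\<^sub>R v) - f (p + h *\<^sub>R u) + f p =
      f (p + h *\<^sub>R u + h *\<^sub>R v) - f (p + h *\<^sub>R u) - f (p + h *\<^sub>R v) + f p" for h
    by (simp add: algebra_simps)
  with lim[of v u] have "((\<lambda>h. (f (p + h *\<^sub>R u + h *\<^sub>R v) - f (p + h *\<^sub>R u) - f (p + h *\<^sub>R v) + f p) / (h * h))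
      \<longlongrightarrow> G v u p) (at_right 0)"
    by (simp only:)
  then have "G u v p = G v u p"
    using tendsto_unique[OF _ lim[of u v]] by simp
  then show ?thesis by (simp add: G_def)
qed

lemma symmetric_second_derivative:
  fixes f :: "'a::euclidean_space \<Rightarrow> 'b::euclidean_space"
  assumes "smooth f"
  shows "frechet_derivative (\<lambda>x. frechet_derivative f (at x) u) (at p) v =
         frechet_derivative (\<lambda>x. frechet_derivative f (at x) v) (at p) u"
proof (rule euclidean_eqI)
  fix b :: 'b
  have lin: "linear (\<lambda>y. y \<bullet> b)"
    by (simp add: linearI inner_add_left)
  have comp: "frechet_derivative (\<lambda>x. f x \<bullet> b) (at x) u = frechet_derivative f (at x) u \<bullet> b"
    if "smooth f" for f :: "'a \<Rightarrow> 'b" and x u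
    by (rule frechet_derivative_linear_compose[OF lin that])
  have "smooth (\<lambda>x. f x \<bullet> b)"
    by (intro smooth_inner assms smooth_const)
  from symmetric_second_derivative_real[OF this]
  show "frechet_derivative (\<lambda>x. frechet_derivative f (at x) u) (at p) v \<bullet> b =
        frechet_derivative (\<lambda>x. frechet_derivative f (at x) v) (at p) u \<bullet> b"
    by (simp add: comp assms smooth_frechet_derivative)
qed

section \<open>Connections in the left-invariant frame\<close>

abbreviation dderiv :: "('a::euclidean_space \<Rightarrow> 'b::real_normed_vector) \<Rightarrow> 'a \<Rightarrow> 'a \<Rightarrow> 'b" where
  "dderiv f p \<equiv> frechet_derivative f (at p)"

lemma smooth_ident: "smooth (\<lambda>x. x)"
  by (rule smooth_linear) (simp add: linearI)

lemma frechet_derivative_id_smooth: "dderiv (\<lambda>x. x) p v = v"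
  by (subst frechet_derivative_linear) (simp_all add: linearI)

locale heisenberg =
  fixes \<iota> :: "nat \<Rightarrow> 'n::finite" and n :: nat
  assumes n3: "n \<ge> 3" and bij: "bij_betw \<iota> {1..n} UNIV"
begin

abbreviation mul where "mul \<equiv> heis_mul \<iota>"

abbreviation E where "E i \<equiv> basis_vec \<iota> i"

text \<open>
  The bracket of the Lie algebra. The coordinates of the group are exponential coordinates, so
  \<open>mul x y = x + y + [x, y] / 2\<close>.
\<close>

definition br :: "real ^ 'n \<Rightarrow> real ^ 'n \<Rightarrow> real ^ 'n" where
  "br u v = (coord \<iota> 1 u * coord \<iota> 2 v - coord \<iota> 2 u * coord \<iota> 1 v) *\<^sub>R E 3"

text \<open>The left-invariant coframe: it sends a tangent vector at \<open>p\<close> to its value in the Lie algebra.\<close>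

definition th :: "real ^ 'n \<Rightarrow> real ^ 'n \<Rightarrow> real ^ 'n" where
  "th p v = v - (1/2) *\<^sub>R br p v"

text \<open>\<open>fr X\<close> is the field \<open>X\<close> written in the left-invariant frame, as a map into the Lie algebra.\<close>

definition fr :: "(real ^ 'n) vfield \<Rightarrow> (real ^ 'n) vfield" where
  "fr X p = th p (X p)"

abbreviation L :: "real ^ 'n \<Rightarrow> real ^ 'n \<Rightarrow> real ^ 'n" where
  "L p v \<equiv> lfield mul v p"

text \<open>
  The connection with constant coefficients \<open>\<Gamma>\<close> in the left-invariant frame. These are the
  left-invariant connections.
\<close>

definition conn :: "(real ^ 'n \<Rightarrow> real ^ 'n \<Rightarrow> real ^ 'n) \<Rightarrow> (real ^ 'n) connection" where
  "conn \<Gamma> X Y = (if smooth X \<and> smooth Y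
     then (\<lambda>p. L p (dderiv (fr Y) p (X p) + \<Gamma> (fr X p) (fr Y p))) else (\<lambda>p. 0))"

lemma inj_iota: "i \<in> {1..n} \<Longrightarrow> j \<in> {1..n} \<Longrightarrow> \<iota> i = \<iota> j \<longleftrightarrow> i = j"
  by (rule inj_on_eq_iff[OF bij_betw_imp_inj_on[OF bij]])

lemma coord_E: "i \<in> {1..n} \<Longrightarrow> j \<in> {1..n} \<Longrightarrow> coord \<iota> i (E j) = (if i = j then 1 else 0)"
  by (auto simp: coord_def basis_vec_def axis_def inj_iota)

lemma coord_linear [simp]:
  "coord \<iota> i (u + v) = coord \<iota> i u + coord \<iota> i v"
  "coord \<iota> i (u - v) = coord \<iota> i u - coord \<iota> i v"
  "coord \<iota> i (- u) = - coord \<iota> i u"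
  "coord \<iota> i (r *\<^sub>R u) = r * coord \<iota> i u"
  "coord \<iota> i 0 = 0"
  by (simp_all add: coord_def)

lemma coord_E3 [simp]: "coord \<iota> 1 (E 3) = 0" "coord \<iota> 2 (E 3) = 0"
  "coord \<iota> (Suc 0) (E 3) = 0"
  using n3 by (simp_all add: coord_E)

lemma bilinear_br: "bilinear br"
  unfolding bilinear_def br_def by (auto intro!: linearI simp: algebra_simps)

lemma br_linear [simp]:
  "br (u + v) w = br u w + br v w" "br u (v + w) = br u v + br u w"
  "br (u - v) w = br u w - br v w" "br u (v - w) = br u v - br u w"
  "br (r *\<^sub>R u) w = r *\<^sub>R br u w" "br u (r *\<^sub>R w) = r *\<^sub>R br u w"
  "br (- u) w = - br u w" "br u (- w) = - br u w" "br 0 w = 0" "br u 0 = 0"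
  using bilinear_br
  by (simp_all add: bilinear_ladd bilinear_radd bilinear_lmul bilinear_rmul bilinear_lsub
      bilinear_rsub bilinear_lneg bilinear_rneg bilinear_lzero bilinear_rzero)

lemma br_central [simp]: "br u (br v w) = 0" "br (br u v) w = 0"
  by (simp_all add: br_def)

lemma br_self [simp]: "br u u = 0"
  by (simp add: br_def)

lemma br_anti: "br v u = - br u v"
  unfolding br_def scaleR_minus_left[symmetric] by (simp add: algebra_simps)

lemma mul_eq: "mul x y = x + y + (1/2) *\<^sub>R br x y"
  by (simp add: heis_mul_def br_def)

lemma L_eq: "L p v = v + (1/2) *\<^sub>R br p v"
  by (simp add: lfield_heis br_def)

lemma L_th [simp]: "L p (th p v) = v"
  by (simp add: L_eq th_def)

lemma th_L [simp]: "th p (L p v) = v"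
  by (simp add: L_eq th_def)

lemma th_linear [simp]:
  "th p (u + v) = th p u + th p v" "th p (u - v) = th p u - th p v"
  "th p (r *\<^sub>R u) = r *\<^sub>R th p u" "th p (- u) = - th p u" "th p 0 = 0"
  by (simp_all add: th_def algebra_simps)

lemma L_linear [simp]:
  "L p (u + v) = L p u + L p v" "L p (u - v) = L p u - L p v"
  "L p (r *\<^sub>R u) = r *\<^sub>R L p u" "L p (- u) = - L p u" "L p 0 = 0"
  by (simp_all add: L_eq algebra_simps)

lemma th_0 [simp]: "th 0 v = v"
  by (simp add: th_def)

lemma L_0 [simp]: "L 0 v = v"
  by (simp add: L_eq)

lemma L_fr [simp]: "L p (fr X p) = X p"
  by (simp add: fr_def)

lemma fr_L [simp]: "fr (\<lambda>p. L p (x p)) = x"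
  by (simp add: fr_def fun_eq_iff)

lemma smooth_br: "smooth f \<Longrightarrow> smooth g \<Longrightarrow> smooth (\<lambda>x. br (f x) (g x))"
  by (rule smooth_bilinear[OF bilinear_br])

lemma smooth_fr: "smooth X \<Longrightarrow> smooth (fr X)"
  unfolding fr_def[abs_def] th_def
  by (intro smooth_diff smooth_scaleR smooth_br smooth_ident smooth_const)

lemma smooth_L: "smooth x \<Longrightarrow> smooth (\<lambda>p. L p (x p))"
  unfolding L_eq by (intro smooth_add smooth_scaleR smooth_br smooth_ident smooth_const)

lemma smooth_lf [simp]: "smooth (lfield mul v)"
  using smooth_L[of "\<lambda>_. v"] by simp

lemma dderiv_fr:
  assumes "smooth X"
  shows "dderiv (fr X) p h = dderiv X p h - (1/2) *\<^sub>R (br p (dderiv X p h) + br h (X p))"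
proof -
  have eq: "fr X = (\<lambda>p. X p + (-1/2) *\<^sub>R br p (X p))"
    by (simp add: fr_def th_def fun_eq_iff)
  have "dderiv (fr X) p h = dderiv X p h + dderiv (\<lambda>p. (-1/2) *\<^sub>R br p (X p)) p h"
    unfolding eq by (intro frechet_derivative_add_smooth smooth_scaleR smooth_br smooth_ident smooth_const assms)
  also have "dderiv (\<lambda>p. (-1/2) *\<^sub>R br p (X p)) p h = (-1/2) *\<^sub>R dderiv (\<lambda>p. br p (X p)) p h"
    by (rule frechet_derivative_linear_compose)
       (simp_all add: linearI algebra_simps assms smooth_br smooth_ident)
  also have "dderiv (\<lambda>p. br p (X p)) p h = br p (dderiv X p h) + br h (X p)"
    by (subst frechet_derivative_bilinear[OF bilinear_br smooth_ident assms])
       (simp add: frechet_derivative_id_smooth)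
  finally show ?thesis by simp
qed

text \<open>
  The left-invariant frame is not a coordinate frame; the failure of its fields to commute contributes
  the bracket of the components.
\<close>

lemma fr_lie_bracket:
  assumes "smooth X" "smooth Y"
  shows "fr (lie_bracket X Y) p = dderiv (fr Y) p (X p) - dderiv (fr X) p (Y p) + br (fr X p) (fr Y p)"
proof -
  have "br (fr X p) (fr Y p) = br (X p) (Y p)"
    by (simp add: fr_def th_def)
  moreover have "br (Y p) (X p) = - br (X p) (Y p)"
    by (rule br_anti)
  moreover have "(1/2::real) *\<^sub>R a + (1/2) *\<^sub>R a = a" for a :: "real ^ 'n"
    by (simp flip: scaleR_add_left)
  ultimately show ?thesis
    by (simp add: fr_def[of "lie_bracket X Y"] lie_bracket_def dderiv_fr assms th_def algebra_simps)
qed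

lemma fr_add: "fr (\<lambda>p. X p + Y p) = (\<lambda>p. fr X p + fr Y p)"
  and fr_scaleR: "fr (\<lambda>p. f p *\<^sub>R X p) = (\<lambda>p. f p *\<^sub>R fr X p)"
  by (simp_all add: fr_def fun_eq_iff)

lemma fr_lf [simp]: "fr (lfield mul v) = (\<lambda>p. v)"
  using fr_L[of "\<lambda>_. v"] by simp

lemma conn_smooth_args: "smooth X \<Longrightarrow> smooth Y \<Longrightarrow>
    conn \<Gamma> X Y p = L p (dderiv (fr Y) p (X p) + \<Gamma> (fr X p) (fr Y p))"
  by (simp add: conn_def)

lemma fr_conn: "smooth X \<Longrightarrow> smooth Y \<Longrightarrow>
    fr (conn \<Gamma> X Y) p = dderiv (fr Y) p (X p) + \<Gamma> (fr X p) (fr Y p)"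
  by (simp add: fr_def conn_smooth_args)

lemma smooth_conn:
  assumes "bilinear \<Gamma>" "smooth X" "smooth Y"
  shows "smooth (conn \<Gamma> X Y)"
proof -
  have "smooth (\<lambda>p. L p (dderiv (fr Y) p (X p) + \<Gamma> (fr X p) (fr Y p)))"
    by (intro smooth_L smooth_add smooth_derivative_along smooth_bilinear[OF assms(1)] smooth_fr assms)
  then show ?thesis
    using assms by (simp add: conn_def)
qed

lemma affine_connection_conn:
  assumes "bilinear \<Gamma>"
  shows "affine_connection (conn \<Gamma>)"
  unfolding affine_connection_def
proof (intro conjI allI impI ext)
  note lin = linear_add[OF smooth_linear_derivative] linear_scale[OF smooth_linear_derivative]
  note bil = bilinear_ladd[OF assms] bilinear_radd[OF assms] bilinear_lmul[OF assms] bilinear_rmul[OF assms]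
  fix X Y :: "(real ^ 'n) vfield" assume X: "smooth X" and Y: "smooth Y"
  show "smooth (conn \<Gamma> X Y)" by (rule smooth_conn[OF assms X Y])
  show "conn \<Gamma> (\<lambda>p. X p + X' p) Y p = conn \<Gamma> X Y p + conn \<Gamma> X' Y p" if "smooth X'" for X' p
    using X Y that by (simp add: conn_smooth_args smooth_add fr_add smooth_fr lin bil algebra_simps)
  show "conn \<Gamma> X (\<lambda>p. Y p + Y' p) p = conn \<Gamma> X Y p + conn \<Gamma> X Y' p" if "smooth Y'" for Y' p
    using X Y that by (simp add: conn_smooth_args smooth_add fr_add smooth_fr lin bil
      frechet_derivative_add_smooth algebra_simps)
  fix f :: "real ^ 'n \<Rightarrow> real" and p assume f: "smooth f"
  show "conn \<Gamma> (\<lambda>p. f p *\<^sub>R X p) Y p = f p *\<^sub>R conn \<Gamma> X Y p"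
    using X Y f by (simp add: conn_smooth_args smooth_scaleR fr_scaleR smooth_fr lin bil algebra_simps)
  have "bilinear (\<lambda>(r::real) (v :: real ^ 'n). r *\<^sub>R v)"
    by (simp add: bilinear_conv_bounded_bilinear bounded_bilinear_scaleR)
  from frechet_derivative_bilinear[OF this f smooth_fr[OF Y]]
  show "conn \<Gamma> X (\<lambda>p. f p *\<^sub>R Y p) p = lie_deriv X f p *\<^sub>R Y p + f p *\<^sub>R conn \<Gamma> X Y p"
    using X Y f by (simp add: conn_smooth_args smooth_scaleR fr_scaleR smooth_fr lin bil
      lie_deriv_def algebra_simps)
qed (auto simp: conn_def)

subsection \<open>Every connection in the frame\<close>

lemma affine_connectionD:
  assumes "affine_connection D"
  shows "smooth X \<Longrightarrow> smooth Y \<Longrightarrow> smooth (D X Y)"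
    "smooth X \<Longrightarrow> smooth X' \<Longrightarrow> smooth Y \<Longrightarrow> D (\<lambda>p. X p + X' p) Y = (\<lambda>p. D X Y p + D X' Y p)"
    "smooth f \<Longrightarrow> smooth X \<Longrightarrow> smooth Y \<Longrightarrow> D (\<lambda>p. f p *\<^sub>R X p) Y = (\<lambda>p. f p *\<^sub>R D X Y p)"
    "smooth X \<Longrightarrow> smooth Y \<Longrightarrow> smooth Y' \<Longrightarrow> D X (\<lambda>p. Y p + Y' p) = (\<lambda>p. D X Y p + D X Y' p)"
    "smooth f \<Longrightarrow> smooth X \<Longrightarrow> smooth Y \<Longrightarrow>
       D X (\<lambda>p. f p *\<^sub>R Y p) = (\<lambda>p. lie_deriv X f p *\<^sub>R Y p + f p *\<^sub>R D X Y p)"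
    "\<not> (smooth X \<and> smooth Y) \<Longrightarrow> D X Y = (\<lambda>p. 0)"
  using assms unfolding affine_connection_def by blast+

lemma affine_connection_zero:
  assumes "affine_connection D" "smooth X"
  shows "D (\<lambda>p. 0) X = (\<lambda>p. 0)" "D X (\<lambda>p. 0) = (\<lambda>p. 0)"
proof -
  show "D (\<lambda>p. 0) X = (\<lambda>p. 0)"
    using affine_connectionD(3)[OF assms(1), of "\<lambda>_. 0" X X] assms(2) by simp
  have "lie_deriv X (\<lambda>_. 0) p = 0" for p
    unfolding lie_deriv_def by simp
  then show "D X (\<lambda>p. 0) = (\<lambda>p. 0)"
    using affine_connectionD(5)[OF assms(1), of "\<lambda>_. 0" X X] assms(2) by simp
qed

lemma affine_connection_sum:
  assumes "affine_connection D" "finite A" "\<And>i. i \<in> A \<Longrightarrow> smooth (X i)" "smooth Y"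
  shows "D (\<lambda>p. \<Sum>i\<in>A. X i p) Y = (\<lambda>p. \<Sum>i\<in>A. D (X i) Y p)"
    and "D Y (\<lambda>p. \<Sum>i\<in>A. X i p) = (\<lambda>p. \<Sum>i\<in>A. D Y (X i) p)"
  using assms(2,3)
  by (induction A rule: finite_induct)
     (simp_all add: affine_connection_zero[OF assms(1,4)] affine_connectionD(2,4)[OF assms(1)] smooth_sum assms(4))

lemma vfield_frame: "X = (\<lambda>p. \<Sum>b\<in>Basis. (fr X p \<bullet> b) *\<^sub>R L p b)"
proof
  fix p
  have "linear (\<lambda>v. L p v)" by (simp add: linearI)
  from linear_eq_sum_Basis[OF this, of "fr X p"] show "X p = (\<Sum>b\<in>Basis. (fr X p \<bullet> b) *\<^sub>R L p b)"
    by simp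
qed

lemma affine_connection_frame_bilinear:
  assumes "affine_connection D"
  shows "bilinear (\<lambda>u v. D (lfield mul u) (lfield mul v) p)"
proof -
  have lf: "lfield mul (u + v) = (\<lambda>p. lfield mul u p + lfield mul v p)"
    "lfield mul (r *\<^sub>R u) = (\<lambda>p. r *\<^sub>R lfield mul u p)" for u v r
    by (simp_all add: fun_eq_iff)
  have z: "lie_deriv X (\<lambda>_. r) q = 0" for X :: "(real ^ 'n) vfield" and r :: real and q
    by (simp add: lie_deriv_def)
  show ?thesis
    unfolding bilinear_def lf
    by (auto intro!: linearI simp: lf affine_connectionD(2,4)[OF assms]
        affine_connectionD(3,5)[OF assms, of "\<lambda>_. _"] z)
qed

text \<open>
  By the Leibniz rule, a connection is determined by its values on the left-invariant fields, and it
  differs from the flat connection of the frame by these values.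
\<close>

lemma affine_connection_in_frame:
  assumes D: "affine_connection D" and X: "smooth X" and Y: "smooth Y"
  shows "D X Y p = L p (dderiv (fr Y) p (X p)) + D (lfield mul (fr X p)) (lfield mul (fr Y p)) p"
proof -
  let ?f = "\<lambda>b. lfield mul b"
  note bil = affine_connection_frame_bilinear[OF D, of p]
  have sX: "smooth (\<lambda>p. fr X p \<bullet> b)" and sY: "smooth (\<lambda>p. fr Y p \<bullet> b)" for b
    using X Y by (intro smooth_inner smooth_fr smooth_const; simp)+
  have linL: "linear (\<lambda>v. L p v)" by (simp add: linearI)
  have "D X Y = D (\<lambda>p. \<Sum>b\<in>Basis. (fr X p \<bullet> b) *\<^sub>R ?f b p) Y"
    using vfield_frame[of X] by simp
  also have "\<dots> = (\<lambda>p. \<Sum>b\<in>Basis. (fr X p \<bullet> b) *\<^sub>R D (?f b) Y p)"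
    by (simp add: affine_connection_sum(1)[OF D] affine_connectionD(3)[OF D] smooth_scaleR sX Y)
  finally have 1: "D X Y p = (\<Sum>b\<in>Basis. (fr X p \<bullet> b) *\<^sub>R D (?f b) Y p)" by simp
  have 2: "D (?f b) Y p = L p (dderiv (fr Y) p (L p b)) + D (?f b) (?f (fr Y p)) p" for b
  proof -
    have "D (?f b) Y = D (?f b) (\<lambda>p. \<Sum>c\<in>Basis. (fr Y p \<bullet> c) *\<^sub>R ?f c p)"
      using vfield_frame[of Y] by simp
    also have "\<dots> = (\<lambda>p. \<Sum>c\<in>Basis. lie_deriv (?f b) (\<lambda>p. fr Y p \<bullet> c) p *\<^sub>R ?f c p + (fr Y p \<bullet> c) *\<^sub>R D (?f b) (?f c) p)"
      by (simp add: affine_connection_sum(2)[OF D] affine_connectionD(5)[OF D] smooth_scaleR sY)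
    finally have "D (?f b) Y p = (\<Sum>c\<in>Basis. lie_deriv (?f b) (\<lambda>p. fr Y p \<bullet> c) p *\<^sub>R ?f c p) +
        (\<Sum>c\<in>Basis. (fr Y p \<bullet> c) *\<^sub>R D (?f b) (?f c) p)"
      by (simp add: sum.distrib)
    moreover have "lie_deriv (?f b) (\<lambda>p. fr Y p \<bullet> c) p = dderiv (fr Y) p (L p b) \<bullet> c" for c
      unfolding lie_deriv_def
      by (rule frechet_derivative_linear_compose[where A = "\<lambda>y. y \<bullet> c"])
         (simp_all add: linearI inner_add_left smooth_fr Y)
    moreover have "linear (\<lambda>v. D (?f b) (?f v) p)"
      using bil by (simp add: bilinear_def)
    from linear_eq_sum_Basis[OF this, of "fr Y p"]
    have "(\<Sum>c\<in>Basis. (fr Y p \<bullet> c) *\<^sub>R D (?f b) (?f c) p) = D (?f b) (?f (fr Y p)) p"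
      by simp
    ultimately show ?thesis
      using linear_eq_sum_Basis[OF linL, of "dderiv (fr Y) p (L p b)"] by simp
  qed
  have "linear (\<lambda>v. L p (dderiv (fr Y) p (L p v)) + D (?f v) (?f (fr Y p)) p)"
  proof (rule linear_compose_add)
    show "linear (\<lambda>v. L p (dderiv (fr Y) p (L p v)))"
      using linear_compose[OF linear_compose[OF linL smooth_linear_derivative[OF smooth_fr[OF Y]]] linL]
      by (simp add: o_def)
    show "linear (\<lambda>v. D (?f v) (?f (fr Y p)) p)"
      using bil by (simp add: bilinear_def)
  qed
  from linear_eq_sum_Basis[OF this, of "fr X p"] show ?thesis
    unfolding 1 2 by simp
qed

subsection \<open>Torsion, cubic form and curvature\<close>

lemma torsion_conn:
  assumes "smooth X" "smooth Y"
  shows "fr (conn \<Gamma> X Y) p - fr (conn \<Gamma> Y X) p - fr (lie_bracket X Y) p =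
    \<Gamma> (fr X p) (fr Y p) - \<Gamma> (fr Y p) (fr X p) - br (fr X p) (fr Y p)"
  by (simp add: fr_conn fr_lie_bracket assms)

lemma torsion_free_conn_iff: "torsion_free (conn \<Gamma>) \<longleftrightarrow> (\<forall>u v. \<Gamma> u v - \<Gamma> v u = br u v)"
proof
  assume tf: "torsion_free (conn \<Gamma>)"
  show "\<forall>u v. \<Gamma> u v - \<Gamma> v u = br u v"
  proof (intro allI)
    fix u v
    have "conn \<Gamma> (lfield mul u) (lfield mul v) 0 - conn \<Gamma> (lfield mul v) (lfield mul u) 0 =
        lie_bracket (lfield mul u) (lfield mul v) 0"
      using tf unfolding torsion_free_def by simp
    then show "\<Gamma> u v - \<Gamma> v u = br u v"
      using torsion_conn[of "lfield mul u" "lfield mul v" \<Gamma> 0] by (simp add: fr_def)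
  qed
next
  assume *: "\<forall>u v. \<Gamma> u v - \<Gamma> v u = br u v"
  show "torsion_free (conn \<Gamma>)"
    unfolding torsion_free_def
  proof (intro allI impI)
    fix X Y :: "(real ^ 'n) vfield" and p assume s: "smooth X" "smooth Y"
    have "fr (conn \<Gamma> X Y) p - fr (conn \<Gamma> Y X) p = fr (lie_bracket X Y) p"
      using torsion_conn[OF s, of \<Gamma> p] * by simp
    then have "th p (conn \<Gamma> X Y p - conn \<Gamma> Y X p) = th p (lie_bracket X Y p)"
      by (simp add: fr_def)
    then show "conn \<Gamma> X Y p - conn \<Gamma> Y X p = lie_bracket X Y p"
      by (metis L_th)
  qed
qed

text \<open>The left-invariant metric with value \<open>b\<close> at the unit element.\<close>

definition lmetric :: "(real ^ 'n \<Rightarrow> real ^ 'n \<Rightarrow> real) \<Rightarrow> (real ^ 'n) tensor2" where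
  "lmetric b p u v = b (th p u) (th p v)"

lemma lmetric_0 [simp]: "lmetric b 0 = b"
  by (simp add: lmetric_def fun_eq_iff)

lemma lie_deriv_lmetric:
  assumes "bilinear b" "smooth X" "smooth Y" "smooth Z"
  shows "lie_deriv X (\<lambda>q. lmetric b q (Y q) (Z q)) p =
    b (fr Y p) (dderiv (fr Z) p (X p)) + b (dderiv (fr Y) p (X p)) (fr Z p)"
  using frechet_derivative_bilinear[OF assms(1) smooth_fr[OF assms(3)] smooth_fr[OF assms(4)]]
  by (simp add: lie_deriv_def lmetric_def fr_def)

lemma lmetric_conn: "smooth X \<Longrightarrow> smooth Y \<Longrightarrow>
    lmetric b p (conn \<Gamma> X Y p) u = b (dderiv (fr Y) p (X p) + \<Gamma> (fr X p) (fr Y p)) (th p u)"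
  "smooth X \<Longrightarrow> smooth Y \<Longrightarrow>
    lmetric b p u (conn \<Gamma> X Y p) = b (th p u) (dderiv (fr Y) p (X p) + \<Gamma> (fr X p) (fr Y p))"
  by (simp_all add: lmetric_def conn_smooth_args flip: L_linear(1))

lemma cubic_conn:
  assumes "bilinear b" "smooth X" "smooth Y" "smooth Z"
  shows "cubic (conn \<Gamma>) (lmetric b) X Y Z p =
    - b (\<Gamma> (fr X p) (fr Y p)) (fr Z p) - b (fr Y p) (\<Gamma> (fr X p) (fr Z p))"
  unfolding cubic_def lie_deriv_lmetric[OF assms] lmetric_conn[OF assms(2,3)] lmetric_conn[OF assms(2,4)]
  using assms(1) by (simp add: fr_def bilinear_ladd bilinear_radd)

text \<open>The curvature of \<open>conn \<Gamma>\<close> in the frame: the derivatives of the constant coefficients are 0.\<close>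

definition curv :: "(real ^ 'n \<Rightarrow> real ^ 'n \<Rightarrow> real ^ 'n) \<Rightarrow>
    real ^ 'n \<Rightarrow> real ^ 'n \<Rightarrow> real ^ 'n \<Rightarrow> real ^ 'n" where
  "curv \<Gamma> x y z = \<Gamma> x (\<Gamma> y z) - \<Gamma> y (\<Gamma> x z) - \<Gamma> (br x y) z"

text \<open>
  The Leibniz rule for \<open>D\<^sub>Y f\<close>, a pairing of the derivative of \<open>f\<close> with \<open>Y\<close>; expanding \<open>Y\<close> in a basis makes
  it a finite sum of products.
\<close>

lemma dderiv_along:
  fixes f :: "real ^ 'n \<Rightarrow> real ^ 'n"
  assumes "smooth f" "smooth Y"
  shows "dderiv (\<lambda>q. dderiv f q (Y q)) p h =
    dderiv (\<lambda>q. dderiv f q (Y p)) p h + dderiv f p (dderiv Y p h)"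
proof -
  have e: "dderiv f q w = (\<Sum>b\<in>Basis. (w \<bullet> b) *\<^sub>R dderiv f q b)" for q w
    by (rule linear_eq_sum_Basis[OF smooth_linear_derivative[OF assms(1)]])
  have d: "((\<lambda>q. dderiv f q b) has_derivative dderiv (\<lambda>q. dderiv f q b) p) (at p)" for b
    by (intro smooth_has_derivative smooth_frechet_derivative assms)
  have dY: "((\<lambda>q. Y q \<bullet> b) has_derivative (\<lambda>h. dderiv Y p h \<bullet> b)) (at p)" for b
    by (intro has_derivative_inner_left smooth_has_derivative assms)
  have "((\<lambda>q. \<Sum>b\<in>Basis. (Y q \<bullet> b) *\<^sub>R dderiv f q b) has_derivative
     (\<lambda>h. \<Sum>b\<in>Basis. (Y p \<bullet> b) *\<^sub>R dderiv (\<lambda>q. dderiv f q b) p h + (dderiv Y p h \<bullet> b) *\<^sub>R dderiv f p b)) (at p)"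
    by (intro has_derivative_sum has_derivative_scaleR d dY)
  from frechet_derivative_at[OF this, THEN fun_cong, of h]
  have 1: "dderiv (\<lambda>q. dderiv f q (Y q)) p h =
     (\<Sum>b\<in>Basis. (Y p \<bullet> b) *\<^sub>R dderiv (\<lambda>q. dderiv f q b) p h) + (\<Sum>b\<in>Basis. (dderiv Y p h \<bullet> b) *\<^sub>R dderiv f p b)"
    by (simp only: e[symmetric] sum.distrib)
  have "((\<lambda>q. \<Sum>b\<in>Basis. (Y p \<bullet> b) *\<^sub>R dderiv f q b) has_derivative
     (\<lambda>h. \<Sum>b\<in>Basis. (Y p \<bullet> b) *\<^sub>R dderiv (\<lambda>q. dderiv f q b) p h)) (at p)"
    by (intro has_derivative_sum has_derivative_scaleR_right d)
  from frechet_derivative_at[OF this, THEN fun_cong, of h]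
  have 2: "dderiv (\<lambda>q. dderiv f q (Y p)) p h = (\<Sum>b\<in>Basis. (Y p \<bullet> b) *\<^sub>R dderiv (\<lambda>q. dderiv f q b) p h)"
    by (simp only: e[symmetric])
  show ?thesis
    unfolding 1 2 by (simp only: e[symmetric])
qed

text \<open>
  All derivatives of the fields cancel: the first order terms because the frame components of a
  bracket are those of \<open>dy(X) - dx(Y) + [x, y]\<close>, the second order ones by symmetry.
\<close>

lemma fr_curvature_conn:
  assumes \<Gamma>: "bilinear \<Gamma>" and X: "smooth X" and Y: "smooth Y" and Z: "smooth Z"
  shows "fr (curvature (conn \<Gamma>) X Y Z) p = curv \<Gamma> (fr X p) (fr Y p) (fr Z p)"
proof -
  note bil = bilinear_ladd[OF \<Gamma>] bilinear_radd[OF \<Gamma>] bilinear_lsub[OF \<Gamma>] bilinear_rsub[OF \<Gamma>]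
  let ?x = "fr X p" and ?y = "fr Y p" and ?z = "fr Z p"
  have step: "fr (conn \<Gamma> X (conn \<Gamma> Y Z)) p =
      dderiv (\<lambda>q. dderiv (fr Z) q (Y p)) p (X p) + dderiv (fr Z) p (dderiv Y p (X p)) +
      \<Gamma> (fr Y p) (dderiv (fr Z) p (X p)) + \<Gamma> (dderiv (fr Y) p (X p)) (fr Z p) +
      \<Gamma> (fr X p) (dderiv (fr Z) p (Y p)) + \<Gamma> (fr X p) (\<Gamma> (fr Y p) (fr Z p))"
    if X: "smooth X" and Y: "smooth Y" for X Y
  proof -
    have "fr (conn \<Gamma> Y Z) = (\<lambda>q. dderiv (fr Z) q (Y q) + \<Gamma> (fr Y q) (fr Z q))"
      using fr_conn[OF Y Z] by blast
    then have "dderiv (fr (conn \<Gamma> Y Z)) p (X p) = dderiv (\<lambda>q. dderiv (fr Z) q (Y q)) p (X p) +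
        dderiv (\<lambda>q. \<Gamma> (fr Y q) (fr Z q)) p (X p)"
      by (simp add: frechet_derivative_add_smooth smooth_derivative_along smooth_bilinear[OF \<Gamma>] smooth_fr Y Z)
    moreover note dderiv_along[OF smooth_fr[OF Z] Y, of p "X p"]
    moreover note frechet_derivative_bilinear[OF \<Gamma> smooth_fr[OF Y] smooth_fr[OF Z], of p "X p"]
    ultimately show ?thesis
      using fr_conn[OF X smooth_conn[OF \<Gamma> Y Z], of \<Gamma> p] by (simp add: fr_conn Y Z bil)
  qed
  have brk: "smooth (lie_bracket X Y)"
    unfolding lie_bracket_def[abs_def] by (intro smooth_diff smooth_derivative_along X Y)
  have "fr (conn \<Gamma> (lie_bracket X Y) Z) p =
      dderiv (fr Z) p (dderiv Y p (X p)) - dderiv (fr Z) p (dderiv X p (Y p)) +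
      \<Gamma> (dderiv (fr Y) p (X p)) ?z - \<Gamma> (dderiv (fr X) p (Y p)) ?z + \<Gamma> (br ?x ?y) ?z"
    using fr_conn[OF brk Z, of \<Gamma> p] fr_lie_bracket[OF X Y, of p]
      linear_diff[OF smooth_linear_derivative[OF smooth_fr[OF Z]]]
    by (simp add: lie_bracket_def bil)
  moreover have "dderiv (\<lambda>q. dderiv (fr Z) q (Y p)) p (X p) = dderiv (\<lambda>q. dderiv (fr Z) q (X p)) p (Y p)"
    by (rule symmetric_second_derivative[OF smooth_fr[OF Z]])
  moreover have "fr (curvature (conn \<Gamma>) X Y Z) p = fr (conn \<Gamma> X (conn \<Gamma> Y Z)) p -
      fr (conn \<Gamma> Y (conn \<Gamma> X Z)) p - fr (conn \<Gamma> (lie_bracket X Y) Z) p"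
    by (simp add: fr_def curvature_def)
  ultimately show ?thesis
    using step[OF X Y] step[OF Y X] by (simp add: curv_def)
qed

lemma curvature_conn:
  "bilinear \<Gamma> \<Longrightarrow> smooth X \<Longrightarrow> smooth Y \<Longrightarrow> smooth Z \<Longrightarrow>
    curvature (conn \<Gamma>) X Y Z p = L p (curv \<Gamma> (fr X p) (fr Y p) (fr Z p))"
  by (metis L_fr fr_curvature_conn)

lemma curvature_at_conn:
  "bilinear \<Gamma> \<Longrightarrow> curvature_at (conn \<Gamma>) p u v w = L p (curv \<Gamma> (th p u) (th p v) (th p w))"
  by (simp add: curvature_at_def curvature_conn fr_def)

text \<open>Equality of curvature tensors can be tested on left-invariant fields at the unit element.\<close>

lemma curvature_conn_eq_iff:
  assumes "bilinear \<Gamma>" "bilinear \<Gamma>'"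
  shows "(\<forall>X Y Z. smooth X \<longrightarrow> smooth Y \<longrightarrow> smooth Z \<longrightarrow>
      curvature (conn \<Gamma>) X Y Z = curvature (conn \<Gamma>') X Y Z) \<longleftrightarrow> curv \<Gamma> = curv \<Gamma>'"
proof
  assume *: "\<forall>X Y Z. smooth X \<longrightarrow> smooth Y \<longrightarrow> smooth Z \<longrightarrow>
      curvature (conn \<Gamma>) X Y Z = curvature (conn \<Gamma>') X Y Z"
  show "curv \<Gamma> = curv \<Gamma>'"
  proof (intro ext)
    fix u v w
    have "curvature_at (conn \<Gamma>) 0 u v w = curvature_at (conn \<Gamma>') 0 u v w"
      using * by (simp add: curvature_at_def)
    then show "curv \<Gamma> u v w = curv \<Gamma>' u v w"
      by (simp add: curvature_at_conn assms)
  qed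
qed (simp add: fun_eq_iff curvature_conn assms)

lemma dually_flat_conn_iff:
  assumes "bilinear \<Gamma>"
  shows "dually_flat (conn \<Gamma>) \<longleftrightarrow> (\<forall>x y z. curv \<Gamma> x y z = 0)"
proof
  assume *: "dually_flat (conn \<Gamma>)"
  show "\<forall>x y z. curv \<Gamma> x y z = 0"
  proof (intro allI)
    fix u v w
    have "curvature_at (conn \<Gamma>) 0 u v w = 0"
      using * by (simp add: curvature_at_def dually_flat_def)
    then show "curv \<Gamma> u v w = 0"
      by (simp add: curvature_at_conn assms)
  qed
qed (simp add: dually_flat_def fun_eq_iff curvature_conn assms)

end

section \<open>Statistical connections\<close>

subsection \<open>Inner products and symmetric cubic forms\<close>

lemma inner_productD:
  assumes "inner_product b"
  shows "bilinear b" "b u v = b v u" "u \<noteq> 0 \<Longrightarrow> b u u > 0"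
  using assms unfolding inner_product_def by blast+

lemma inner_product_linear:
  assumes "inner_product b"
  shows "b (u + v) w = b u w + b v w" "b u (v + w) = b u v + b u w"
    "b (u - v) w = b u w - b v w" "b u (v - w) = b u v - b u w"
    "b (r *\<^sub>R u) w = r * b u w" "b u (r *\<^sub>R w) = r * b u w"
    "b (- u) w = - b u w" "b u (- w) = - b u w" "b 0 w = 0" "b u 0 = 0"
  using inner_productD(1)[OF assms]
  by (simp_all add: bilinear_ladd bilinear_radd bilinear_lmul bilinear_rmul bilinear_lsub
      bilinear_rsub bilinear_lneg bilinear_rneg bilinear_lzero bilinear_rzero)

lemma inner_product_eqI:
  assumes "inner_product b" "\<And>w. b u w = b v w"
  shows "u = v"
proof (rule ccontr)
  assume "u \<noteq> v"
  then have "b (u - v) (u - v) > 0"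
    using inner_productD(3)[OF assms(1)] by simp
  then show False
    using assms by (simp add: inner_product_linear[OF assms(1)])
qed

text \<open>The vector representing a linear form, unique by definiteness.\<close>

definition riesz :: "('a::euclidean_space \<Rightarrow> 'a \<Rightarrow> real) \<Rightarrow> ('a \<Rightarrow> real) \<Rightarrow> 'a" where
  "riesz b f = (SOME w. \<forall>v. b w v = f v)"

lemma riesz:
  fixes b :: "'a::euclidean_space \<Rightarrow> 'a \<Rightarrow> real"
  assumes b: "inner_product b" and f: "linear f"
  shows "b (riesz b f) v = f v"
proof -
  define T where "T = (\<lambda>w. \<Sum>c\<in>Basis. b w c *\<^sub>R c)"
  have linb: "linear (b w)" for w
    by (rule linearI) (simp_all add: inner_product_linear[OF b])
  have T: "T w \<bullet> c = b w c" if "c \<in> Basis" for w c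
    using that by (simp add: T_def inner_sum_left inner_Basis if_distrib cong: if_cong)
  have "linear T"
    unfolding T_def
    by (rule linearI) (simp_all add: inner_product_linear[OF b] scaleR_add_left sum.distrib scaleR_sum_right)
  moreover have "inj T"
  proof (rule injI)
    fix u w assume eq: "T u = T w"
    have "b u v = b w v" for v
    proof -
      have "b u v = (\<Sum>c\<in>Basis. (v \<bullet> c) *\<^sub>R b u c)" by (rule linear_eq_sum_Basis[OF linb])
      also have "\<dots> = (\<Sum>c\<in>Basis. (v \<bullet> c) *\<^sub>R b w c)"
        using T eq by (intro sum.cong) (auto simp flip: T)
      also have "\<dots> = b w v" by (rule linear_eq_sum_Basis[OF linb, symmetric])
      finally show ?thesis .
    qed
    then show "u = w" by (rule inner_product_eqI[OF b])
  qed
  ultimately have "surj T"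
    by (rule linear_inj_imp_surj)
  then obtain w where w: "T w = (\<Sum>c\<in>Basis. f c *\<^sub>R c)"
    by (metis surjD)
  have "\<forall>v. b w v = f v"
  proof
    fix v
    have "b w v = (\<Sum>c\<in>Basis. (v \<bullet> c) *\<^sub>R b w c)" by (rule linear_eq_sum_Basis[OF linb])
    also have "\<dots> = (\<Sum>c\<in>Basis. (v \<bullet> c) *\<^sub>R f c)"
      by (intro sum.cong refl, subst T[symmetric])
         (simp_all add: w inner_sum_left inner_Basis if_distrib cong: if_cong)
    also have "\<dots> = f v" by (rule linear_eq_sum_Basis[OF f, symmetric])
    finally show "b w v = f v" .
  qed
  then show ?thesis
    unfolding riesz_def by (rule someI[of _ w, THEN spec])
qed

lemma S3_sym:
  assumes "c \<in> S3"
  shows "c u v w = c v u w" "c u v w = c u w v" "c u v w = c w v u" "c u v w = c v w u" "c u v w = c w u v"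
proof -
  have s: "c u v w = c v u w" "c u v w = c u w v" for u v w
    using assms unfolding S3_def by blast+
  show "c u v w = c v u w" "c u v w = c u w v" by (rule s)+
  show "c u v w = c v w u" using s by metis
  show "c u v w = c w u v" using s by metis
  show "c u v w = c w v u" using s by metis
qed

lemma S3_linear:
  assumes "c \<in> S3"
  shows "linear (\<lambda>u. c u v w)" "linear (\<lambda>v. c u v w)" "linear (\<lambda>w. c u v w)"
proof -
  show 1: "linear (\<lambda>u. c u v w)" for v w
    using assms unfolding S3_def by blast
  show "linear (\<lambda>v. c u v w)"
    using 1[of u w] by (subst S3_sym(1)[OF assms])
  show "linear (\<lambda>w. c u v w)"
    using 1[of v u] by (subst S3_sym(3)[OF assms])
qed

lemma S3_simps:
  assumes "c \<in> S3"
  shows "c (u + u') v w = c u v w + c u' v w" "c u (v + v') w = c u v w + c u v' w"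
    "c u v (w + w') = c u v w + c u v w'"
    "c (u - u') v w = c u v w - c u' v w" "c u (v - v') w = c u v w - c u v' w"
    "c u v (w - w') = c u v w - c u v w'"
    "c (r *\<^sub>R u) v w = r * c u v w" "c u (r *\<^sub>R v) w = r * c u v w" "c u v (r *\<^sub>R w) = r * c u v w"
    "c (- u) v w = - c u v w" "c u (- v) w = - c u v w" "c u v (- w) = - c u v w"
    "c 0 v w = 0" "c u 0 w = 0" "c u v 0 = 0"
  using S3_linear[OF assms, THEN linear_add] S3_linear[OF assms, THEN linear_diff]
    S3_linear[OF assms, THEN linear_scale] S3_linear[OF assms, THEN linear_neg]
    S3_linear[OF assms, THEN linear_0]
  by simp_all

lemma S3_I:
  assumes "\<And>u u' v w. c (u + u') v w = c u v w + c u' v w"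
    and "\<And>r u v w. c (r *\<^sub>R u) v w = r * c u v w"
    and "\<And>u v w. c u v w = c v u w" "\<And>u v w. c u v w = c u w v"
  shows "c \<in> S3"
  unfolding S3_def using assms by (auto intro!: linearI)

lemma S3_uminus: "c \<in> S3 \<Longrightarrow> (\<lambda>u v w. - c u v w) \<in> S3"
  by (rule S3_I) (simp_all add: S3_simps S3_sym(1)[of c] S3_sym(2)[of c]; metis S3_sym)+

lemma S3_zero: "(\<lambda>u v w. 0) \<in> S3"
  by (rule S3_I) simp_all

text \<open>The product rule for a cubic form, obtained by raising an index: \<open>c(u, v, w) = \<langle>cs(u, v), w\<rangle>\<close>.\<close>

lemma dderiv_trilinear:
  assumes c: "c \<in> S3" and s: "smooth x" "smooth y" "smooth z"
  shows "dderiv (\<lambda>q. c (x q) (y q) (z q)) p h =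
    c (dderiv x p h) (y p) (z p) + c (x p) (dderiv y p h) (z p) + c (x p) (y p) (dderiv z p h)"
proof -
  define cs where "cs = (\<lambda>u v. \<Sum>b\<in>Basis. c u v b *\<^sub>R b)"
  have cs: "c u v w = cs u v \<bullet> w" for u v w
    using linear_eq_sum_Basis[OF S3_linear(3)[OF c], of u v w]
    by (simp add: cs_def inner_sum_left inner_commute[of w] mult.commute)
  have bil: "bilinear cs"
    unfolding bilinear_def cs_def
    by (auto intro!: linearI simp: S3_simps[OF c] sum.distrib scaleR_add_left scaleR_sum_right)
  have inn: "bilinear (\<lambda>(u::'a) v. u \<bullet> v)"
    by (simp add: bilinear_conv_bounded_bilinear bounded_bilinear_inner)
  show ?thesis
    unfolding cs
    using frechet_derivative_bilinear[OF inn smooth_bilinear[OF bil s(1,2)] s(3), of p h]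
      frechet_derivative_bilinear[OF bil s(1,2), of p h]
    by (simp add: inner_add_left)
qed

subsection \<open>Uniqueness\<close>

text \<open>
  The difference \<open>S\<close> of two solutions is symmetric in the first two arguments by torsion-freeness, and
  \<open>g(S(X, Y), Z)\<close> is antisymmetric in the last two; such a form vanishes.
\<close>

lemma statistical_connection_unique:
  assumes g: "\<And>p. inner_product (g p)"
    and D: "affine_connection D" "torsion_free D" "cubic_eq D g C"
    and D': "affine_connection D'" "torsion_free D'" "cubic_eq D' g C"
  shows "D = D'"
proof (intro ext)
  fix X Y p
  show "D X Y p = D' X Y p"
  proof (cases "smooth X \<and> smooth Y")
    case False
    then show ?thesis
      using D(1) D'(1) unfolding affine_connection_def by auto
  next
    case True
    define S where "S = (\<lambda>X Y. D X Y p - D' X Y p)"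
    have sym: "S X Y = S Y X" if "smooth X" "smooth Y" for X Y
    proof -
      have "D X Y p - D Y X p = D' X Y p - D' Y X p"
        using that D(2) D'(2) unfolding torsion_free_def by simp
      then show ?thesis by (simp add: S_def algebra_simps)
    qed
    have anti: "g p (S X Y) (Z p) = - g p (S X Z) (Y p)" if "smooth X" "smooth Y" "smooth Z" for X Y Z
    proof -
      have "cubic D g X Y Z p = cubic D' g X Y Z p"
        using that D(3) D'(3) unfolding cubic_eq_def by simp
      then show ?thesis
        using inner_productD(2)[OF g, of p "Y p"]
        by (simp add: cubic_def S_def inner_product_linear[OF g])
    qed
    have "g p (S X Y) v = 0" for v
    proof -
      \<comment> \<open>any field through \<open>v\<close> at \<open>p\<close> will do; the identities for \<open>S\<close> are about fields\<close>
      define Z where "Z = (\<lambda>q::'a. v)"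
      have Z: "smooth Z" "Z p = v" by (simp_all add: Z_def)
      have "g p (S X Y) (Z p) = 0"
        using anti[of X Y Z] anti[of Z X Y] anti[of Y Z X] sym[of X Y] sym[of Y Z] sym[of X Z] True Z(1)
        by simp
      then show ?thesis by (simp add: Z)
    qed
    then have "S X Y = 0"
      by (intro inner_product_eqI[OF g]) (simp add: inner_product_linear[OF g])
    then show ?thesis by (simp add: S_def)
  qed
qed

text \<open>
  The equation for a constant field \<open>Y\<close> gives the inner product of \<open>D' X Z\<close> with an arbitrary vector.
\<close>

lemma dual_connection_unique:
  assumes g: "\<And>p. inner_product (g p)"
    and D1: "affine_connection D1" "\<And>X Y Z p. smooth X \<Longrightarrow> smooth Y \<Longrightarrow> smooth Z \<Longrightarrow>
      lie_deriv X (\<lambda>q. g q (Y q) (Z q)) p = g p (D X Y p) (Z p) + g p (Y p) (D1 X Z p)"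
    and D2: "affine_connection D2" "\<And>X Y Z p. smooth X \<Longrightarrow> smooth Y \<Longrightarrow> smooth Z \<Longrightarrow>
      lie_deriv X (\<lambda>q. g q (Y q) (Z q)) p = g p (D X Y p) (Z p) + g p (Y p) (D2 X Z p)"
  shows "D1 = D2"
proof (intro ext)
  fix X Z p
  show "D1 X Z p = D2 X Z p"
  proof (cases "smooth X \<and> smooth Z")
    case False
    then show ?thesis
      using D1(1) D2(1) unfolding affine_connection_def by auto
  next
    case True
    have "g p (D1 X Z p) v = g p (D2 X Z p) v" for v
      using D1(2)[of X "\<lambda>_. v" Z p] D2(2)[of X "\<lambda>_. v" Z p] True
        inner_productD(2)[OF g, of p _ v] by simp
    then show ?thesis
      by (rule inner_product_eqI[OF g])
  qed
qed

context heisenberg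
begin

subsection \<open>The left-invariant statistical connection\<close>

text \<open>
  \<open>kos b c u v\<close> is the right-hand side of the Koszul formula for left-invariant fields, with the cubic
  form added.
\<close>

definition kos where
  "kos b c u v w = (b (br u v) w - b (br v w) u + b (br w u) v) / 2 - c u v w / (2::real)"

definition gam where
  "gam b c u v = riesz b (kos b c u v)"

lemma linear_kos: "inner_product b \<Longrightarrow> c \<in> S3 \<Longrightarrow> linear (kos b c u v)"
  unfolding kos_def
  by (rule linearI) (simp_all add: inner_product_linear S3_simps algebra_simps add_divide_distrib diff_divide_distrib)

lemma gam: "inner_product b \<Longrightarrow> c \<in> S3 \<Longrightarrow> b (gam b c u v) w = kos b c u v w"
  unfolding gam_def by (intro riesz linear_kos)

lemma gam_eqI:
  assumes "inner_product b" "c \<in> S3" "\<And>u v w. b (\<Gamma> u v) w = kos b c u v w"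
  shows "\<Gamma> = gam b c"
  by (intro ext inner_product_eqI[OF assms(1)]) (simp add: assms gam)

lemma bilinear_gam: "inner_product b \<Longrightarrow> c \<in> S3 \<Longrightarrow> bilinear (gam b c)"
  unfolding bilinear_def
  by (intro conjI allI linearI; rule inner_product_eqI[of b])
     (simp_all add: inner_product_linear gam, simp_all add: kos_def inner_product_linear S3_simps
        algebra_simps add_divide_distrib diff_divide_distrib)

lemma gam_torsion:
  assumes "inner_product b" "c \<in> S3"
  shows "gam b c u v - gam b c v u = br u v"
proof (rule inner_product_eqI[OF assms(1)])
  fix w
  have "b (br u w) v = - b (br w u) v" "b (br v w) u = - b (br w v) u" "b (br u v) w = - b (br v u) w"
    by (subst br_anti, simp add: inner_product_linear[OF assms(1)])+
  then show "b (gam b c u v - gam b c v u) w = b (br u v) w"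
    using S3_sym(1)[OF assms(2), of u v w]
    by (simp add: inner_product_linear[OF assms(1)] gam assms kos_def field_simps)
qed

text \<open>\<open>gam b (- c)\<close> is dual to \<open>gam b c\<close>, and their common mean is the Levi-Civita connection.\<close>

lemma gam_dual:
  assumes "inner_product b" "c \<in> S3"
  shows "b (gam b c u v) w + b v (gam b (\<lambda>u v w. - c u v w) u w) = 0"
proof -
  have "b (br u w) v = - b (br w u) v" "b (br v w) u = - b (br w v) u" "b (br u v) w = - b (br v u) w"
    by (subst br_anti, simp add: inner_product_linear[OF assms(1)])+
  then show ?thesis
    using S3_sym(2)[OF assms(2), of u v w]
    by (simp add: inner_productD(2)[OF assms(1), of v] gam assms S3_uminus kos_def field_simps)
qed

lemma gam_cubic:
  assumes "inner_product b" "c \<in> S3"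
  shows "- b (gam b c u v) w - b v (gam b c u w) = c u v w"
proof -
  have "b (br u w) v = - b (br w u) v" "b (br v w) u = - b (br w v) u" "b (br u v) w = - b (br v u) w"
    by (subst br_anti, simp add: inner_product_linear[OF assms(1)])+
  then show ?thesis
    using S3_sym(2)[OF assms(2), of u v w]
    by (simp add: inner_productD(2)[OF assms(1), of v] gam assms kos_def field_simps)
qed

text \<open>
  The usual derivation of the Koszul formula: torsion-freeness and the cubic form, each at the three
  cyclic permutations of the arguments, determine \<open>b (\<Gamma> u v) w\<close>.
\<close>

lemma gam_characterization:
  assumes b: "inner_product b" and c: "c \<in> S3"
    and t: "\<And>u v. \<Gamma> u v - \<Gamma> v u = br u v"
    and m: "\<And>u v w. - b (\<Gamma> u v) w - b v (\<Gamma> u w) = c u v w"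
  shows "\<Gamma> = gam b c"
proof (rule gam_eqI[OF b c])
  fix u v w
  have t': "b (\<Gamma> u v) w - b (\<Gamma> v u) w = b (br u v) w" for u v w
    using t[of u v] by (simp flip: inner_product_linear[OF b])
  have m': "b (\<Gamma> u v) w + b (\<Gamma> u w) v = - c u v w" for u v w
    using m[of u v w] inner_productD(2)[OF b, of v "\<Gamma> u w"] by simp
  have "b (br u w) v = - b (br w u) v"
    by (subst br_anti) (simp add: inner_product_linear[OF b])
  then show "b (\<Gamma> u v) w = kos b c u v w"
    using t'[of u v w] t'[of u w v] t'[of v w u] m'[of u v w] m'[of v w u] m'[of w u v]
      S3_sym(4)[OF c, of u v w] S3_sym(5)[OF c, of u v w]
    unfolding kos_def by argo
qed

lemma inner_product_lmetric:
  assumes "inner_product b"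
  shows "inner_product (lmetric b p)"
proof -
  have "th p u \<noteq> 0" if "u \<noteq> 0" for u
    using that L_th[of p u] by (metis L_linear(5))
  then show ?thesis
    using inner_productD(3)[OF assms] inner_productD(2)[OF assms]
    unfolding inner_product_def bilinear_def lmetric_def
    by (auto intro!: linearI simp: inner_product_linear[OF assms])
qed

lemma mul_inverse: "mul (- a) (mul a x) = x" "mul a (mul (- a) x) = x"
  by (simp_all add: mul_eq)

lemma inv_mul: "inv (mul a) = mul (- a)"
  by (rule inv_unique_comp) (simp_all add: fun_eq_iff mul_inverse)

lemma smooth_mul: "smooth (mul a)"
  unfolding mul_eq[abs_def] by (intro smooth_add smooth_scaleR smooth_br smooth_ident smooth_const)

lemma diffeo_mul: "diffeo (mul a)"
  unfolding diffeo_def inv_mul using smooth_mul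
  by (auto intro: bij_betw_byWitness[where f' = "mul (- a)"] simp: mul_inverse)

lemma dderiv_mul: "dderiv (mul a) p v = L a v"
proof -
  have lin: "linear (\<lambda>x. x + (1/2) *\<^sub>R br a x)"
    by (rule linearI) (simp_all add: algebra_simps)
  have "mul a = (\<lambda>x. a + (x + (1/2) *\<^sub>R br a x))"
    by (simp add: mul_eq fun_eq_iff)
  then have "dderiv (mul a) p v = dderiv (\<lambda>x. a) p v + dderiv (\<lambda>x. x + (1/2) *\<^sub>R br a x) p v"
    by (simp only:) (intro frechet_derivative_add_smooth smooth_const smooth_linear lin)
  then show ?thesis
    by (simp add: frechet_derivative_linear[OF lin] L_eq)
qed

lemma left_form3_eq: "left_form3 mul c p u v w = c (th p u) (th p v) (th p w)"
  by (simp add: left_form3_def inv_mul dderiv_mul L_eq th_def Let_def)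

lemma cubic_eq_gam:
  assumes "inner_product b" "c \<in> S3"
  shows "cubic_eq (conn (gam b c)) (lmetric b) (left_form3 mul c)"
  unfolding cubic_eq_def
  by (simp add: cubic_conn inner_productD(1) assms gam_cubic left_form3_eq fr_def)

lemma statistical_connection_lmetric:
  assumes "inner_product b" "c \<in> S3"
  shows "statistical_connection (lmetric b) (left_form3 mul c) = conn (gam b c)"
  unfolding statistical_connection_def
proof (rule the_equality)
  show *: "affine_connection (conn (gam b c)) \<and> torsion_free (conn (gam b c)) \<and>
      cubic_eq (conn (gam b c)) (lmetric b) (left_form3 mul c)"
    using assms by (simp add: affine_connection_conn bilinear_gam torsion_free_conn_iff gam_torsion cubic_eq_gam)
  show "D = conn (gam b c)" if "affine_connection D \<and> torsion_free D \<and>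
      cubic_eq D (lmetric b) (left_form3 mul c)" for D
    using statistical_connection_unique[where g = "lmetric b", OF inner_product_lmetric[OF assms(1)]] that * by blast
qed

lemma levi_civita_lmetric:
  assumes "inner_product b"
  shows "levi_civita (lmetric b) = conn (gam b (\<lambda>u v w. 0))"
proof -
  have "left_form3 mul (\<lambda>u v w. 0) = (\<lambda>p u v w. 0)"
    by (simp add: fun_eq_iff left_form3_eq)
  then show ?thesis
    using statistical_connection_lmetric[OF assms S3_zero]
    by (simp add: statistical_connection_def levi_civita_def)
qed

lemma dual_connection_lmetric:
  assumes b: "inner_product b" and c: "c \<in> S3"
  shows "dual_connection (lmetric b) (conn (gam b c)) = conn (gam b (\<lambda>u v w. - c u v w))"
proof -
  let ?D = "conn (gam b c)" and ?D' = "conn (gam b (\<lambda>u v w. - c u v w))"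
  have a: "affine_connection ?D'"
    by (intro affine_connection_conn bilinear_gam S3_uminus b c)
  have d: "lie_deriv X (\<lambda>q. lmetric b q (Y q) (Z q)) p =
      lmetric b p (?D X Y p) (Z p) + lmetric b p (Y p) (?D' X Z p)"
    if "smooth X" "smooth Y" "smooth Z" for X Y Z p
    using gam_dual[OF b c, of "fr X p" "fr Y p" "fr Z p"] that
    by (simp add: lie_deriv_lmetric inner_productD(1)[OF b] lmetric_conn inner_product_linear[OF b] fr_def)
  show ?thesis
    unfolding dual_connection_def
  proof (rule the_equality)
    fix D' assume "affine_connection D' \<and> (\<forall>X Y Z. smooth X \<longrightarrow> smooth Y \<longrightarrow> smooth Z \<longrightarrow>
        (\<forall>p. lie_deriv X (\<lambda>q. lmetric b q (Y q) (Z q)) p =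
          lmetric b p (?D X Y p) (Z p) + lmetric b p (Y p) (D' X Z p)))"
    then show "D' = ?D'"
      by (intro dual_connection_unique[where g = "lmetric b" and D = ?D, OF inner_product_lmetric[OF b]]) (simp_all add: a d)
  qed (simp add: a d)
qed

lemma conjugate_symmetric_lmetric:
  assumes "inner_product b" "c \<in> S3"
  shows "conjugate_symmetric (lmetric b) (conn (gam b c)) \<longleftrightarrow>
    curv (gam b c) = curv (gam b (\<lambda>u v w. - c u v w))"
  unfolding conjugate_symmetric_def dual_connection_lmetric[OF assms]
  by (rule curvature_conn_eq_iff) (intro bilinear_gam assms S3_uminus)+

text \<open>
  A left-invariant form is parallel if the connection coefficients annihilate it as derivations: the
  derivatives of the components of the fields cancel by the product rule.
\<close>

lemma parallel3_conn:
  assumes c: "c \<in> S3"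
    and inv: "\<And>w x y z. c (\<Gamma> w x) y z + c x (\<Gamma> w y) z + c x y (\<Gamma> w z) = 0"
  shows "parallel3 (conn \<Gamma>) (left_form3 mul c)"
  unfolding parallel3_def
proof (intro allI impI ext)
  fix W X Y Z :: "(real ^ 'n) vfield" and p
  assume s: "smooth W" "smooth X" "smooth Y" "smooth Z"
  have "(\<lambda>q. left_form3 mul c q (X q) (Y q) (Z q)) = (\<lambda>q. c (fr X q) (fr Y q) (fr Z q))"
    by (simp add: left_form3_eq fr_def)
  then have "lie_deriv W (\<lambda>q. left_form3 mul c q (X q) (Y q) (Z q)) p =
      c (dderiv (fr X) p (W p)) (fr Y p) (fr Z p) + c (fr X p) (dderiv (fr Y) p (W p)) (fr Z p)
      + c (fr X p) (fr Y p) (dderiv (fr Z) p (W p))"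
    using dderiv_trilinear[OF c s(2-4)[THEN smooth_fr]] by (simp add: lie_deriv_def)
  moreover have "th p (conn \<Gamma> W V p) = dderiv (fr V) p (W p) + \<Gamma> (fr W p) (fr V p)" if "smooth V" for V
    using fr_conn[OF s(1) that] by (simp add: fr_def)
  moreover have "th p (V p) = fr V p" for V by (simp add: fr_def)
  ultimately show "cov_deriv3 (conn \<Gamma>) (left_form3 mul c) W X Y Z p = 0"
    using inv[of "fr W p" "fr X p" "fr Y p" "fr Z p"] s
    by (simp add: cov_deriv3_def left_form3_eq S3_simps[OF c])
qed

subsection \<open>Left-invariant statistical structures\<close>

text \<open>
  \<open>lstruct\<close> is the statistical structure of an inner product and a cubic form on the Lie algebra, and
  \<open>ldata\<close> is the identification by which the space of these structures gets its topology.
\<close>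

definition lstruct where
  "lstruct = (\<lambda>(b, c). (lmetric b, conn (gam b c)))"

definition ldata :: "(real ^ 'n) tensor2 \<times> (real ^ 'n) connection \<Rightarrow> _" where
  "ldata = (\<lambda>(g, D). (g 0, cubic_at D g 0))"

lemma ldata_lstruct: "inner_product b \<Longrightarrow> c \<in> S3 \<Longrightarrow> ldata (lstruct (b, c)) = (b, c)"
  by (simp add: ldata_def lstruct_def fun_eq_iff cubic_at_def cubic_conn inner_productD(1) gam_cubic fr_def)

text \<open>
  Diffeomorphisms acting in the frame by a constant linear map include left translations, with \<open>N\<close>
  the identity, and automorphisms.
\<close>

lemma pullback_conn:
  assumes \<psi>: "diffeo \<psi>" and N: "linear N" "bij N"
    and eq: "\<And>p v. dderiv \<psi> p (L p v) = L (\<psi> p) (N v)"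
  shows "pullback_connection \<psi> (conn \<Gamma>) = conn (\<lambda>u v. inv N (\<Gamma> (N u) (N v)))"
proof (intro ext)
  fix X Y :: "(real ^ 'n) vfield" and p
  define \<eta> where "\<eta> = inv \<psi>"
  have s: "smooth \<psi>" "smooth \<eta>" and bij: "bij \<psi>"
    using \<psi> by (auto simp: diffeo_def \<eta>_def)
  have inv: "\<eta> (\<psi> p) = p" "\<psi> (\<eta> p) = p" for p
    using bij by (auto simp: \<eta>_def bij_is_inj bij_is_surj surj_f_inv_f)
  have inv\<eta>: "inv \<eta> = \<psi>"
    using bij by (simp add: \<eta>_def inv_inv_eq)
  have d: "dderiv \<eta> (\<psi> p) (dderiv \<psi> p h) = h" for p h
    using frechet_derivative_compose_smooth[OF s(2) s(1), of p h]
    by (simp add: inv frechet_derivative_id_smooth)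
  have d': "dderiv \<psi> p (dderiv \<eta> (\<psi> p) h) = h" for p h
    using frechet_derivative_compose_smooth[OF s(1) s(2), of "\<psi> p" h]
    by (simp add: inv frechet_derivative_id_smooth)
  have invN: "inv N (N v) = v" "N (inv N v) = v" for v
    using N(2) by (auto simp: bij_is_inj bij_is_surj surj_f_inv_f)
  have eq': "dderiv \<eta> (\<psi> p) (L (\<psi> p) w) = L p (inv N w)" for p w
    using d[of p "L p (inv N w)"] by (simp add: eq invN)
  have push: "pushforward \<psi> X q = dderiv \<psi> (\<eta> q) (X (\<eta> q))"
    "pushforward \<eta> X p = dderiv \<eta> (\<psi> p) (X (\<psi> p))" for X q p
    by (simp_all add: pushforward_def inv\<eta> \<eta>_def[symmetric])
  have sm: "smooth (pushforward \<psi> X)" if "smooth X" for X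
  proof -
    have "smooth (\<lambda>q. (\<lambda>y. dderiv \<psi> y (X y)) (\<eta> q))"
      by (rule smooth_compose[OF smooth_derivative_along s(2)]) (use s(1) that in auto)
    then show ?thesis by (simp add: push[abs_def])
  qed
  have sm': "smooth (pushforward \<eta> X)" if "smooth X" for X
  proof -
    have "smooth (\<lambda>q. (\<lambda>y. dderiv \<eta> y (X y)) (\<psi> q))"
      by (rule smooth_compose[OF smooth_derivative_along s(1)]) (use s(2) that in auto)
    then show ?thesis by (simp add: push[abs_def])
  qed
  have pp: "pushforward \<eta> (pushforward \<psi> X) = X" for X
    by (simp add: fun_eq_iff push inv d)
  have smi: "smooth (pushforward \<psi> X) \<longleftrightarrow> smooth X" for X
    using sm[of X] sm'[of "pushforward \<psi> X"] pp by auto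
  show "pullback_connection \<psi> (conn \<Gamma>) X Y p = conn (\<lambda>u v. inv N (\<Gamma> (N u) (N v))) X Y p"
  proof (cases "smooth X \<and> smooth Y")
    case False
    have "dderiv \<eta> (\<psi> p) 0 = 0" by (rule linear_0[OF smooth_linear_derivative[OF s(2)]])
    with False show ?thesis
      by (auto simp: pullback_connection_def conn_def smi push simp flip: \<eta>_def)
  next
    case True
    then have X: "smooth X" and Y: "smooth Y" by auto
    \<comment> \<open>In the frame, pushing a field forward is composing with \<open>\<psi>\<^sup>-\<^sup>1\<close> and applying \<open>N\<close>.\<close>
    have frp: "fr (pushforward \<psi> X) q = N (fr X (\<eta> q))" for X q
    proof -
      have "dderiv \<psi> (\<eta> q) (X (\<eta> q)) = L q (N (fr X (\<eta> q)))"
        using eq[of "\<eta> q" "fr X (\<eta> q)"] by (simp add: inv)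
      then show ?thesis by (simp add: fr_def push)
    qed
    have "dderiv (fr (pushforward \<psi> Y)) (\<psi> p) (pushforward \<psi> X (\<psi> p)) =
        dderiv (\<lambda>q. N (fr Y (\<eta> q))) (\<psi> p) (dderiv \<psi> p (X p))"
      by (simp add: frp[abs_def] push inv)
    also have "\<dots> = N (dderiv (\<lambda>q. fr Y (\<eta> q)) (\<psi> p) (dderiv \<psi> p (X p)))"
      by (rule frechet_derivative_linear_compose[OF N(1) smooth_compose[OF smooth_fr[OF Y] s(2)]])
    also have "\<dots> = N (dderiv (fr Y) p (X p))"
      by (simp add: frechet_derivative_compose_smooth[OF smooth_fr[OF Y] s(2)] inv d)
    finally have "conn \<Gamma> (pushforward \<psi> X) (pushforward \<psi> Y) (\<psi> p) =
        L (\<psi> p) (N (dderiv (fr Y) p (X p)) + \<Gamma> (N (fr X p)) (N (fr Y p)))"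
      by (simp add: conn_smooth_args sm X Y frp inv)
    moreover have "linear (inv N)"
      using N by (simp add: inj_linear_imp_inv_linear bij_is_inj)
    ultimately show ?thesis
      using X Y
      by (simp add: pullback_connection_def \<eta>_def[symmetric] push eq' conn_smooth_args linear_add invN
        del: L_linear)
  qed
qed

lemma pullback_lmetric:
  assumes "\<And>p v. dderiv \<psi> p (L p v) = L (\<psi> p) (N v)"
  shows "pullback_metric \<psi> (lmetric b) = lmetric (\<lambda>u v. b (N u) (N v))"
proof -
  have "th (\<psi> p) (dderiv \<psi> p u) = N (th p u)" for p u
    using assms[of p "th p u"] by simp
  then show ?thesis
    by (simp add: pullback_metric_def lmetric_def fun_eq_iff)
qed

lemma dderiv_mul_L: "dderiv (mul a) p (L p v) = L (mul a p) (id v)"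
  by (simp add: dderiv_mul L_eq mul_eq algebra_simps)

lemma lstruct_LStat:
  assumes b: "inner_product b" and c: "c \<in> S3"
  shows "lstruct (b, c) \<in> LStat mul"
proof -
  have "smooth (\<lambda>p. lmetric b p u v)" for u v
    unfolding lmetric_def th_def
    by (intro smooth_bilinear[OF inner_productD(1)[OF b]] smooth_diff smooth_scaleR smooth_br
        smooth_ident smooth_const)
  then have r: "riemannian_metric (lmetric b)"
    by (simp add: riemannian_metric_def inner_product_lmetric[OF b])
  have a: "affine_connection (conn (gam b c))"
    by (intro affine_connection_conn bilinear_gam b c)
  have cub: "cubic (conn (gam b c)) (lmetric b) X Y Z = (\<lambda>p. c (fr X p) (fr Y p) (fr Z p))"
    if "smooth X" "smooth Y" "smooth Z" for X Y Z
    by (simp add: fun_eq_iff cubic_conn inner_productD(1)[OF b] that gam_cubic[OF b c])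
  have "statistical_structure (lmetric b) (conn (gam b c))"
    unfolding statistical_structure_def
    using r a S3_sym(1,2)[OF c] by (auto simp: torsion_free_conn_iff gam_torsion[OF b c] cub)
  moreover have "left_invariant_metric mul (lmetric b)"
    using r pullback_lmetric[of "mul _" id, OF dderiv_mul_L] by (simp add: left_invariant_metric_def)
  moreover have "left_invariant_connection mul (conn (gam b c))"
    using a pullback_conn[OF diffeo_mul linear_id bij_id dderiv_mul_L]
    by (simp add: left_invariant_connection_def)
  ultimately show ?thesis by (simp add: LStat_def lstruct_def)
qed

lemma left_invariant_metric_eq_lmetric:
  assumes "left_invariant_metric mul g"
  shows "g = lmetric (g 0)" "inner_product (g 0)"
proof (intro ext)
  fix p u v
  have "pullback_metric (mul p) g 0 (th p u) (th p v) = g 0 (th p u) (th p v)"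
    using assms by (simp add: left_invariant_metric_def)
  then show "g p u v = lmetric (g 0) p u v"
    by (simp add: pullback_metric_def dderiv_mul lmetric_def mul_eq)
  show "inner_product (g 0)"
    using assms by (simp add: left_invariant_metric_def riemannian_metric_def)
qed

text \<open>
  Left-invariant fields are fixed by pushforward along left translations, hence so are their covariant
  derivatives, which are therefore left-invariant fields again.
\<close>

lemma left_invariant_connection_eq_conn:
  assumes "left_invariant_connection mul D"
  shows "D = conn (\<lambda>u v. D (lfield mul u) (lfield mul v) 0)"
proof (intro ext)
  fix X Y p
  have D: "affine_connection D" and inv: "\<And>a. pullback_connection (mul a) D = D"
    using assms by (auto simp: left_invariant_connection_def)
  have push: "pushforward (mul a) (lfield mul u) = lfield mul u" for a u
  proof
    fix q
    show "pushforward (mul a) (lfield mul u) q = lfield mul u q"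
      using dderiv_mul_L[of a "mul (- a) q" u] by (simp add: pushforward_def inv_mul mul_inverse)
  qed
  have const: "D (lfield mul u) (lfield mul v) q = L q (D (lfield mul u) (lfield mul v) 0)" for u v q
  proof -
    let ?Z = "D (lfield mul u) (lfield mul v)"
    have "pushforward (inv (mul (- q))) ?Z = ?Z"
      using inv[of "- q"] push[of "- q"] by (metis pullback_connection_def)
    then have "?Z q = pushforward (mul q) ?Z q"
      by (simp add: inv_mul)
    also have "\<dots> = L q (?Z 0)"
      by (simp add: pushforward_def inv_mul dderiv_mul mul_eq)
    finally show ?thesis .
  qed
  show "D X Y p = conn (\<lambda>u v. D (lfield mul u) (lfield mul v) 0) X Y p"
  proof (cases "smooth X \<and> smooth Y")
    case True
    then show ?thesis
      using affine_connection_in_frame[OF D, of X Y p] const[of "fr X p" "fr Y p" p]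
      by (simp add: conn_smooth_args)
  qed (auto simp: affine_connectionD(6)[OF D] conn_def)
qed

lemma LStat_cases:
  assumes "x \<in> LStat mul"
  obtains b c where "inner_product b" "c \<in> S3" "x = lstruct (b, c)"
proof -
  obtain g D where x: "x = (g, D)" by (cases x)
  have st: "statistical_structure g D" and g: "left_invariant_metric mul g"
    and D: "left_invariant_connection mul D"
    using assms by (auto simp: x LStat_def)
  define b where "b = g 0"
  have gb: "g = lmetric b" and b: "inner_product b"
    using left_invariant_metric_eq_lmetric[OF g] by (auto simp: b_def)
  define \<Gamma> where "\<Gamma> = (\<lambda>u v. D (lfield mul u) (lfield mul v) 0)"
  have D\<Gamma>: "D = conn \<Gamma>"
    using left_invariant_connection_eq_conn[OF D] by (simp add: \<Gamma>_def)
  have bil: "bilinear \<Gamma>"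
    using D affine_connection_frame_bilinear by (simp add: left_invariant_connection_def \<Gamma>_def)
  define c where "c = cubic_at D g 0"
  have c: "c u v w = - b (\<Gamma> u v) w - b v (\<Gamma> u w)" for u v w
    unfolding c_def cubic_at_def D\<Gamma> gb
    by (subst cubic_conn) (simp_all add: inner_productD(1)[OF b] fr_def)
  have "c \<in> S3"
  proof (rule S3_I)
    show "c u v w = c v u w" "c u v w = c u w v" for u v w
      using st by (simp_all add: statistical_structure_def c_def cubic_at_def)
  qed (simp_all add: c bilinear_ladd[OF bil] bilinear_lmul[OF bil] inner_product_linear[OF b] algebra_simps)
  moreover have "\<Gamma> = gam b c"
    using st by (intro gam_characterization b \<open>c \<in> S3\<close>)
      (simp_all add: c statistical_structure_def D\<Gamma> torsion_free_conn_iff)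
  ultimately show thesis
    using that[OF b] by (simp add: x lstruct_def gb D\<Gamma>)
qed

subsection \<open>The group acting on them\<close>

definition lie_automorphism where
  "lie_automorphism M \<longleftrightarrow> linear M \<and> bij M \<and> (\<forall>u v. M (br u v) = br (M u) (M v))"

text \<open>
  In exponential coordinates \<open>mul x x = 2x\<close>, so a homomorphism \<open>\<phi>\<close> satisfies \<open>\<phi> x = 2\<^sup>k \<phi> (x / 2\<^sup>k)\<close>, and
  this tends to the derivative at 0: smooth homomorphisms are linear.
\<close>

lemma hom_eq_derivative:
  assumes s: "smooth \<phi>" and hom: "\<And>x y. \<phi> (mul x y) = mul (\<phi> x) (\<phi> y)"
  shows "\<phi> = dderiv \<phi> 0"
proof
  fix x
  have "\<phi> 0 = \<phi> 0 + \<phi> 0"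
    using hom[of 0 0] by (simp add: mul_eq)
  then have \<phi>0: "\<phi> 0 = 0" by simp
  have "\<phi> (2 *\<^sub>R y) = 2 *\<^sub>R \<phi> y" for y
    using hom[of y y] by (simp add: mul_eq scaleR_2)
  then have pow: "\<phi> x = 2 ^ k *\<^sub>R \<phi> ((1 / 2 ^ k) *\<^sub>R x)" for k
  proof (induction k)
    case (Suc k)
    have "\<phi> ((1 / 2 ^ k) *\<^sub>R x) = 2 *\<^sub>R \<phi> ((1 / 2 ^ Suc k) *\<^sub>R x)"
      using Suc.prems[of "(1 / 2 ^ Suc k) *\<^sub>R x"] by simp
    with Suc show ?case by simp
  qed simp
  have "((\<lambda>t. t *\<^sub>R x) has_derivative (\<lambda>t. t *\<^sub>R x)) (at (0::real))"
    by (auto intro!: derivative_eq_intros)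
  from has_derivative_compose[OF this, of \<phi> "dderiv \<phi> 0"] smooth_has_derivative[OF s, of 0]
  have "((\<lambda>t. \<phi> (t *\<^sub>R x)) has_derivative (\<lambda>t. dderiv \<phi> 0 (t *\<^sub>R x))) (at 0)" by simp
  then have "((\<lambda>t. \<phi> (t *\<^sub>R x)) has_vector_derivative dderiv \<phi> 0 x) (at 0)"
    by (simp add: has_vector_derivative_def linear_scale[OF smooth_linear_derivative[OF s]])
  then have "((\<lambda>t. norm (\<phi> (t *\<^sub>R x) - t *\<^sub>R dderiv \<phi> 0 x) / \<bar>t\<bar>) \<longlongrightarrow> 0) (at 0)"
    unfolding has_vector_derivative_def has_derivative_at by (simp add: \<phi>0)
  moreover have "norm (\<phi> (t *\<^sub>R x) - t *\<^sub>R dderiv \<phi> 0 x) / \<bar>t\<bar> = norm (\<phi> (t *\<^sub>R x) /\<^sub>R t - dderiv \<phi> 0 x)"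
    if "t \<noteq> 0" for t
  proof -
    have "\<phi> (t *\<^sub>R x) /\<^sub>R t - dderiv \<phi> 0 x = (\<phi> (t *\<^sub>R x) - t *\<^sub>R dderiv \<phi> 0 x) /\<^sub>R t"
      using that by (simp add: scaleR_diff_right)
    then show ?thesis
      using that by (simp add: divide_inverse mult.commute)
  qed
  ultimately have "((\<lambda>t. norm (\<phi> (t *\<^sub>R x) /\<^sub>R t - dderiv \<phi> 0 x)) \<longlongrightarrow> 0) (at 0)"
    by (subst (asm) LIM_equal) auto
  then have "((\<lambda>t. \<phi> (t *\<^sub>R x) /\<^sub>R t) \<longlongrightarrow> dderiv \<phi> 0 x) (at 0)"
    by (simp add: LIM_zero_cancel tendsto_norm_zero_iff)
  moreover have "filterlim (\<lambda>k::nat. 1 / 2 ^ k :: real) (at 0) sequentially"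
    unfolding filterlim_at by (auto simp: LIMSEQ_divide_realpow_zero)
  ultimately have "(\<lambda>k. \<phi> ((1 / 2 ^ k) *\<^sub>R x) /\<^sub>R (1 / 2 ^ k)) \<longlonglongrightarrow> dderiv \<phi> 0 x"
    by (rule filterlim_compose)
  then have "(\<lambda>k. \<phi> x) \<longlonglongrightarrow> dderiv \<phi> 0 x"
    using pow by simp
  then show "\<phi> x = dderiv \<phi> 0 x"
    by (simp add: LIMSEQ_const_iff)
qed

lemma lie_Aut_eq: "lie_Aut mul = {M. lie_automorphism M}"
proof (intro set_eqI iffI)
  fix \<phi> assume \<phi>: "\<phi> \<in> lie_Aut mul"
  then have s: "smooth \<phi>" and bij: "bij \<phi>" and hom: "\<And>x y. \<phi> (mul x y) = mul (\<phi> x) (\<phi> y)"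
    by (auto simp: lie_Aut_def diffeo_def)
  have lin: "linear \<phi>"
    using hom_eq_derivative[OF s hom] smooth_linear_derivative[OF s] by metis
  have "\<phi> (br u v) = br (\<phi> u) (\<phi> v)" for u v
    using hom[of u v] by (simp add: mul_eq linear_add[OF lin] linear_scale[OF lin])
  then show "\<phi> \<in> {M. lie_automorphism M}"
    using lin bij by (simp add: lie_automorphism_def)
next
  fix M assume "M \<in> {M. lie_automorphism M}"
  then have M: "linear M" "bij M" "\<And>u v. M (br u v) = br (M u) (M v)"
    by (auto simp: lie_automorphism_def)
  moreover have "linear (inv M)"
    using M by (simp add: inj_linear_imp_inv_linear bij_is_inj)
  ultimately show "M \<in> lie_Aut mul"
    by (simp add: lie_Aut_def diffeo_def smooth_linear mul_eq linear_add linear_scale)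
qed

lemma lie_automorphism_inv:
  assumes "lie_automorphism M"
  shows "lie_automorphism (inv M)"
proof -
  have M: "linear M" "bij M" "\<And>u v. M (br u v) = br (M u) (M v)"
    using assms by (auto simp: lie_automorphism_def)
  have i: "inv M (M v) = v" "M (inv M v) = v" for v
    using M(2) by (auto simp: bij_is_inj bij_is_surj surj_f_inv_f)
  have "inv M (br u v) = br (inv M u) (inv M v)" for u v
    using i(1)[of "br (inv M u) (inv M v)"] by (simp add: M(3) i)
  then show ?thesis
    using M by (simp add: lie_automorphism_def inj_linear_imp_inv_linear bij_is_inj bij_imp_bij_inv)
qed

lemma lie_automorphism_dderiv:
  assumes "lie_automorphism M"
  shows "dderiv M p (L p v) = L (M p) (M v)"
  using assms by (simp add: lie_automorphism_def frechet_derivative_linear L_eq linear_add linear_scale)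

text \<open>
  The action on pairs of forms, by pullback. A group element \<open>\<phi>\<close> acts on structures by pullback along
  \<open>\<phi>\<^sup>-\<^sup>1\<close>, so \<open>N\<close> is the inverse of the automorphism.
\<close>

definition lact :: "real \<Rightarrow> (real ^ 'n \<Rightarrow> real ^ 'n) \<Rightarrow> _" where
  "lact r N = (\<lambda>(b, c). (\<lambda>u v. r * b (N u) (N v) :: real, \<lambda>u v w. r * c (N u) (N v) (N w) :: real))"

lemma inner_product_lact:
  assumes "inner_product b" "linear N" "inj N" "r > 0"
  shows "inner_product (\<lambda>u v. r * b (N u) (N v))"
proof -
  have "N u \<noteq> 0" if "u \<noteq> 0" for u
    using that assms(2,3) by (metis injD linear_0)
  then show ?thesis
    using assms inner_productD(3)[OF assms(1)] inner_productD(2)[OF assms(1)]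
    unfolding inner_product_def bilinear_def
    by (auto intro!: linearI simp: inner_product_linear[OF assms(1)] linear_add linear_scale algebra_simps)
qed

lemma S3_lact:
  assumes "c \<in> S3" "linear N"
  shows "(\<lambda>u v w. r * c (N u) (N v) (N w)) \<in> S3"
  using assms S3_sym(1,2)[OF assms(1)]
  by (intro S3_I) (simp_all add: S3_simps[OF assms(1)] linear_add linear_scale algebra_simps)

lemma gam_lact:
  assumes b: "inner_product b" and c: "c \<in> S3" and M: "lie_automorphism M" and r: "r > 0"
  shows "gam (\<lambda>u v. r * b (inv M u) (inv M v)) (\<lambda>u v w. r * c (inv M u) (inv M v) (inv M w)) =
    (\<lambda>u v. M (gam b c (inv M u) (inv M v)))"
proof -
  have M': "linear M" "bij M" and N: "linear (inv M)" "bij (inv M)" "\<And>u v. inv M (br u v) = br (inv M u) (inv M v)"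
    using M lie_automorphism_inv[OF M] by (auto simp: lie_automorphism_def)
  have i: "inv M (M v) = v" for v
    using M'(2) by (auto simp: bij_is_inj)
  show ?thesis
    by (rule gam_eqI[symmetric])
       (use assms N in \<open>auto simp: i gam kos_def algebra_simps bij_is_inj add_divide_distrib diff_divide_distrib
          intro!: inner_product_lact S3_lact\<close>)
qed

lemma stat_act_lstruct:
  assumes b: "inner_product b" and c: "c \<in> S3" and M: "lie_automorphism M" and r: "r > 0"
  shows "stat_act (r, M) (lstruct (b, c)) = lstruct (lact r (inv M) (b, c))"
proof -
  note N = lie_automorphism_inv[OF M]
  have bij: "bij M" "bij (inv M)" and lin: "linear (inv M)"
    using M N by (auto simp: lie_automorphism_def)
  have "inv M \<in> lie_Aut mul" using N by (simp add: lie_Aut_eq)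
  then have "diffeo (inv M)" by (simp add: lie_Aut_def)
  from pullback_conn[OF this lin bij(2) lie_automorphism_dderiv[OF N]]
    pullback_lmetric[OF lie_automorphism_dderiv[OF N]]
  show ?thesis
    by (simp add: stat_act_def lstruct_def lact_def gam_lact[OF assms] inv_inv_eq[OF bij(1)])
       (simp add: lmetric_def fun_eq_iff)
qed

end

section \<open>Conjugate symmetric structures for the standard metric\<close>

lemma inner_product_inner: "inner_product (\<bullet>)"
  unfolding inner_product_def
  by (auto simp: inner_commute bilinear_conv_bounded_bilinear bounded_bilinear_inner)

lemma sym_prod_3:
  "sym_prod [x, y, z] [u, v, w] =
    (x u * y v * z w + x u * z v * y w + y u * x v * z w + y u * z v * x w + z u * x v * y w + z u * y v * x w) / 6"
proof -
  have f012: "finite {1::nat, 2}" "0 \<notin> {1::nat, 2}" by auto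
  have f12: "finite {2::nat}" "1 \<notin> {2::nat}" by auto
  have e: "{..<length [x, y, z]} = {0, 1, 2}" by auto
  show ?thesis
    unfolding sym_prod_def e
    unfolding sum_over_permutations_insert[OF f012]
    unfolding sum_over_permutations_insert[OF f12]
    unfolding permutes_sing
    by (simp add: transpose_def fact_numeral algebra_simps)
qed

context heisenberg
begin

lemma coord_eq_inner: "coord \<iota> i u = u \<bullet> E i"
  by (simp add: coord_def basis_vec_def inner_axis)

lemma vec_eq_sum_E: "u = (\<Sum>i\<in>{1..n}. coord \<iota> i u *\<^sub>R E i)"
proof -
  have "u = (\<Sum>k\<in>UNIV. (u $ k) *\<^sub>R axis k 1)"
    using basis_expansion[of u] by (simp add: scalar_mult_eq_scaleR)
  also have "\<dots> = (\<Sum>i\<in>{1..n}. coord \<iota> i u *\<^sub>R E i)"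
    unfolding coord_def basis_vec_def
    by (rule sum.reindex_bij_betw[OF bij, symmetric])
  finally show ?thesis .
qed

lemma coord_eqI: "(\<And>i. i \<in> {1..n} \<Longrightarrow> coord \<iota> i u = coord \<iota> i v) \<Longrightarrow> u = v"
  by (subst (1 2) vec_eq_sum_E) simp

abbreviation P where "P \<equiv> ab_proj \<iota> n"

lemma coord_P: "i \<in> {1..n} \<Longrightarrow> coord \<iota> i (P u) = (if i \<ge> 4 then coord \<iota> i u else 0)"
proof -
  assume i: "i \<in> {1..n}"
  have "coord \<iota> i (P u) = (\<Sum>j\<in>{4..n}. coord \<iota> j u * coord \<iota> i (E j))"
    by (simp add: ab_proj_def coord_eq_inner inner_sum_left)
  also have "\<dots> = (\<Sum>j\<in>{4..n}. if i = j then coord \<iota> j u else 0)"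
    using i by (intro sum.cong) (auto simp: coord_E)
  finally show ?thesis using i by simp
qed

lemma coord_P3 [simp]: "coord \<iota> 1 (P u) = 0" "coord \<iota> 2 (P u) = 0" "coord \<iota> 3 (P u) = 0"
  "coord \<iota> (Suc 0) (P u) = 0"
  using n3 by (simp_all add: coord_P)

lemma linear_P: "linear P"
  unfolding ab_proj_def by (rule linearI) (simp_all add: scaleR_add_left sum.distrib scaleR_sum_right)

lemma P_P [simp]: "P (P u) = P u"
  by (rule coord_eqI) (simp add: coord_P)

lemma decompose: "u = coord \<iota> 1 u *\<^sub>R E 1 + coord \<iota> 2 u *\<^sub>R E 2 + coord \<iota> 3 u *\<^sub>R E 3 + P u"
proof (rule coord_eqI)
  fix i assume i: "i \<in> {1..n}"
  show "coord \<iota> i u = coord \<iota> i (coord \<iota> 1 u *\<^sub>R E 1 + coord \<iota> 2 u *\<^sub>R E 2 + coord \<iota> 3 u *\<^sub>R E 3 + P u)"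
    using i n3 by (cases "i \<ge> 4") (auto simp: coord_P coord_E numeral_eq_Suc le_Suc_eq not_le less_Suc_eq)
qed

subsection \<open>The Levi-Civita connection\<close>

text \<open>
  The coefficients of the Levi-Civita connection. For \<open>x\<close> one of \<open>E 1, E 2, E 3\<close>, \<open>lc x\<close> is half a
  generator of the rotations of their span.
\<close>

definition lc :: "real ^ 'n \<Rightarrow> real ^ 'n \<Rightarrow> real ^ 'n" where
  "lc u v = ((coord \<iota> 3 u * coord \<iota> 2 v + coord \<iota> 2 u * coord \<iota> 3 v) / 2) *\<^sub>R E 1
    - ((coord \<iota> 3 u * coord \<iota> 1 v + coord \<iota> 1 u * coord \<iota> 3 v) / 2) *\<^sub>R E 2
    + ((coord \<iota> 1 u * coord \<iota> 2 v - coord \<iota> 2 u * coord \<iota> 1 v) / 2) *\<^sub>R E 3"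

lemma coord_E123 [simp]:
  "coord \<iota> (Suc 0) (E (Suc 0)) = 1" "coord \<iota> (Suc 0) (E 2) = 0" "coord \<iota> (Suc 0) (E 3) = 0"
  "coord \<iota> 2 (E (Suc 0)) = 0" "coord \<iota> 2 (E 2) = 1" "coord \<iota> 2 (E 3) = 0"
  "coord \<iota> 3 (E (Suc 0)) = 0" "coord \<iota> 3 (E 2) = 0" "coord \<iota> 3 (E 3) = 1"
  using n3 by (simp_all add: coord_E)

lemma P_E123 [simp]: "P (E (Suc 0)) = 0" "P (E 2) = 0" "P (E 3) = 0"
  using n3 by (auto intro!: coord_eqI simp: coord_P coord_E)

lemma P_lc [simp]: "P (lc u v) = 0"
  by (simp add: lc_def linear_add[OF linear_P] linear_diff[OF linear_P] linear_scale[OF linear_P])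

lemma coord_lc [simp]:
  "coord \<iota> (Suc 0) (lc u v) = (coord \<iota> 3 u * coord \<iota> 2 v + coord \<iota> 2 u * coord \<iota> 3 v) / 2"
  "coord \<iota> 2 (lc u v) = - ((coord \<iota> 3 u * coord \<iota> 1 v + coord \<iota> 1 u * coord \<iota> 3 v) / 2)"
  "coord \<iota> 3 (lc u v) = (coord \<iota> 1 u * coord \<iota> 2 v - coord \<iota> 2 u * coord \<iota> 1 v) / 2"
  by (simp_all add: lc_def)

text \<open>The difference tensor of the two dual connections, by raising an index of the cubic form.\<close>

definition sharp :: "(real ^ 'n \<Rightarrow> real ^ 'n \<Rightarrow> real ^ 'n \<Rightarrow> real) \<Rightarrow> real ^ 'n \<Rightarrow> real ^ 'n \<Rightarrow> real ^ 'n" where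
  "sharp c u v = riesz (\<bullet>) (c u v)"

lemma sharp: "c \<in> S3 \<Longrightarrow> sharp c u v \<bullet> w = c u v w"
  unfolding sharp_def by (intro riesz inner_product_inner S3_linear(3))

lemma br_inner: "br u v \<bullet> w = (coord \<iota> 1 u * coord \<iota> 2 v - coord \<iota> 2 u * coord \<iota> 1 v) * coord \<iota> 3 w"
  by (simp add: br_def coord_eq_inner inner_commute)

lemma lc_inner: "lc u v \<bullet> w =
    (coord \<iota> 3 u * coord \<iota> 2 v + coord \<iota> 2 u * coord \<iota> 3 v) / 2 * coord \<iota> 1 w
    - (coord \<iota> 3 u * coord \<iota> 1 v + coord \<iota> 1 u * coord \<iota> 3 v) / 2 * coord \<iota> 2 w
    + (coord \<iota> 1 u * coord \<iota> 2 v - coord \<iota> 2 u * coord \<iota> 1 v) / 2 * coord \<iota> 3 w"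
  by (simp add: lc_def coord_eq_inner inner_commute[of w] inner_add_left inner_diff_left)

lemma gam_inner:
  assumes "c \<in> S3"
  shows "gam (\<bullet>) c = (\<lambda>u v. lc u v - (1/2) *\<^sub>R sharp c u v)"
  by (rule gam_eqI[symmetric])
     (simp_all add: assms inner_product_inner sharp kos_def br_inner lc_inner inner_diff_left field_simps)

lemma lc_skew: "lc x y \<bullet> z = - (y \<bullet> lc x z)"
  by (simp add: inner_commute[of y] lc_inner field_simps)

lemma lc_torsion: "lc x y - lc y x = br x y"
proof -
  have "(lc x y - lc y x) \<bullet> w = br x y \<bullet> w" for w
    by (simp add: inner_diff_left lc_inner br_inner field_simps)
  then show ?thesis by (rule inner_product_eqI[OF inner_product_inner])
qed

lemma bilinear_lc: "bilinear lc"
  unfolding bilinear_def lc_def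
  by (intro conjI allI linearI)
     (simp_all add: algebra_simps add_divide_distrib diff_divide_distrib)

text \<open>Up to sign, the covariant derivative \<open>(\<nabla>\<^sup>g\<^sub>x c)(y, z, w)\<close>.\<close>

definition cov :: "(real ^ 'n \<Rightarrow> real ^ 'n \<Rightarrow> real ^ 'n \<Rightarrow> real) \<Rightarrow> real ^ 'n \<Rightarrow> real ^ 'n \<Rightarrow> real ^ 'n \<Rightarrow> real ^ 'n \<Rightarrow> real" where
  "cov c x y z w = c (lc x y) z w + c y (lc x z) w + c y z (lc x w)"

text \<open>
  Writing the two dual connections as \<open>\<nabla>\<^sup>g \<plusminus> K\<close>, the terms quadratic in \<open>K\<close> cancel in the difference of
  the curvatures, and the linear ones form the exterior covariant derivative of \<open>K\<close>.
\<close>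

lemma curv_difference:
  assumes c: "c \<in> S3"
  shows "(curv (gam (\<bullet>) c) x y z - curv (gam (\<bullet>) (\<lambda>u v w. - c u v w)) x y z) \<bullet> w =
    cov c x y z w - cov c y x z w"
proof -
  have g: "gam (\<bullet>) c = (\<lambda>u v. lc u v - (1/2) *\<^sub>R sharp c u v)"
    by (rule gam_inner[OF c])
  have s: "sharp (\<lambda>u v w. - c u v w) u v = - sharp c u v" for u v
    by (rule inner_product_eqI[OF inner_product_inner]) (simp add: sharp S3_uminus c)
  have g': "gam (\<bullet>) (\<lambda>u v w. - c u v w) = (\<lambda>u v. lc u v + (1/2) *\<^sub>R sharp c u v)"
    using gam_inner[OF S3_uminus[OF c]] by (simp add: s)
  have sl: "sharp c u (v + w) = sharp c u v + sharp c u w" "sharp c u (v - w) = sharp c u v - sharp c u w"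
    "sharp c u (r *\<^sub>R w) = r *\<^sub>R sharp c u w" for u v w r
    by (rule inner_product_eqI[OF inner_product_inner];
        simp add: sharp c S3_simps[OF c] inner_add_left inner_diff_left)+
  have comb: "sharp c u (lc v z) \<bullet> w = c u (lc v z) w" "lc u (sharp c v z) \<bullet> w = - c v z (lc u w)" for u v z w
    by (simp_all add: sharp c lc_skew)
  have "c (br x y) z w = c (lc x y) z w - c (lc y x) z w"
    by (simp add: S3_simps[OF c] flip: lc_torsion)
  moreover have "curv (gam (\<bullet>) c) x y z - curv (gam (\<bullet>) (\<lambda>u v w. - c u v w)) x y z =
      sharp c (br x y) z - lc x (sharp c y z) - sharp c x (lc y z) + lc y (sharp c x z) + sharp c y (lc x z)"
  proof -
    have 2: "(1/2) *\<^sub>R a = (a /\<^sub>R 2 :: real ^ 'n)" for a by simp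
    have "a = a /\<^sub>R 2 + a /\<^sub>R 2" for a :: "real ^ 'n"
      by (simp flip: scaleR_add_left)
    then show ?thesis
      unfolding curv_def g g'
      by (simp add: sl bilinear_radd[OF bilinear_lc] bilinear_rsub[OF bilinear_lc] bilinear_rmul[OF bilinear_lc]
          algebra_simps)
  qed
  ultimately show ?thesis
    by (simp add: inner_add_left inner_diff_left comb sharp[OF c] cov_def)
qed

lemma curv_dual_eq_iff:
  assumes "c \<in> S3"
  shows "curv (gam (\<bullet>) c) = curv (gam (\<bullet>) (\<lambda>u v w. - c u v w)) \<longleftrightarrow>
    (\<forall>x y z w. cov c x y z w = cov c y x z w)" (is "?L = ?R")
proof
  assume L: ?L
  have "cov c x y z w - cov c y x z w = 0" for x y z w
    by (subst curv_difference[OF assms, symmetric]) (simp flip: L)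
  then show ?R by simp
next
  assume R: ?R
  show ?L
  proof (intro ext)
    fix x y z
    have "(curv (gam (\<bullet>) c) x y z - curv (gam (\<bullet>) (\<lambda>u v w. - c u v w)) x y z) \<bullet> w = 0 \<bullet> w" for w
      using curv_difference[OF assms] R by simp
    from inner_product_eqI[OF inner_product_inner this]
    show "curv (gam (\<bullet>) c) x y z = curv (gam (\<bullet>) (\<lambda>u v w. - c u v w)) x y z" by simp
  qed
qed

subsection \<open>Solving the symmetry equations\<close>

definition cs_form :: "(real ^ 'n \<Rightarrow> real) \<Rightarrow> (real ^ 'n \<Rightarrow> real ^ 'n \<Rightarrow> real ^ 'n \<Rightarrow> real) \<Rightarrow>
    real ^ 'n \<Rightarrow> real ^ 'n \<Rightarrow> real ^ 'n \<Rightarrow> real" where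
  "cs_form q1 q3 u v w = w0_prod \<iota> q1 u v w + q3 u v w"

definition CS :: "(real ^ 'n \<Rightarrow> real ^ 'n \<Rightarrow> real ^ 'n \<Rightarrow> real) set" where
  "CS = {cs_form q1 q3 | q1 q3. q1 \<in> S1_ab \<iota> n \<and> q3 \<in> S3_ab \<iota> n}"

text \<open>The inner product of the Heisenberg components, that is, the bilinear form \<open>w\<^sub>0\<close>.\<close>

definition dot3 :: "real ^ 'n \<Rightarrow> real ^ 'n \<Rightarrow> real" where
  "dot3 u v = coord \<iota> 1 u * coord \<iota> 1 v + coord \<iota> 2 u * coord \<iota> 2 v + coord \<iota> 3 u * coord \<iota> 3 v"

lemma w0_prod_eq: "w0_prod \<iota> p u v w = (dot3 u v * p w + dot3 u w * p v + dot3 v w * p u) / 3"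
proof -
  have "{1..3::nat} = {1, 2, 3}" by auto
  then show ?thesis
    by (simp add: w0_prod_def sym_prod_3 dot3_def algebra_simps add_divide_distrib)
qed

text \<open>Membership as invariance under the projection, which composes better than being an image.\<close>

lemma S1_ab_iff: "p \<in> S1_ab \<iota> n \<longleftrightarrow> linear p \<and> (\<forall>u. p (P u) = p u)"
proof
  assume "p \<in> S1_ab \<iota> n"
  then show "linear p \<and> (\<forall>u. p (P u) = p u)"
    unfolding S1_ab_def S1_def using linear_compose[OF linear_P] by (auto simp: o_def)
next
  assume "linear p \<and> (\<forall>u. p (P u) = p u)"
  then show "p \<in> S1_ab \<iota> n"
    unfolding S1_ab_def S1_def by (intro image_eqI[of _ _ p]) auto
qed

lemma S3_ab_iff: "p \<in> S3_ab \<iota> n \<longleftrightarrow> p \<in> S3 \<and> (\<forall>u v w. p (P u) (P v) (P w) = p u v w)"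
proof
  assume "p \<in> S3_ab \<iota> n"
  then show "p \<in> S3 \<and> (\<forall>u v w. p (P u) (P v) (P w) = p u v w)"
    unfolding S3_ab_def using S3_lact[OF _ linear_P, where r = 1] by auto
next
  assume "p \<in> S3 \<and> (\<forall>u v w. p (P u) (P v) (P w) = p u v w)"
  then show "p \<in> S3_ab \<iota> n"
    unfolding S3_ab_def by (intro image_eqI[of _ _ p]) auto
qed

lemma S3_ab_zero:
  assumes "p \<in> S3_ab \<iota> n" "P u = 0"
  shows "p u v w = 0" "p v u w = 0" "p v w u = 0"
proof -
  have p: "p \<in> S3" "\<And>u v w. p u v w = p (P u) (P v) (P w)"
    using assms(1) by (auto simp: S3_ab_iff)
  show "p u v w = 0" "p v u w = 0" "p v w u = 0"
    by (subst p(2), simp add: assms S3_simps[OF p(1)])+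
qed

lemma S1_ab_zero: "p \<in> S1_ab \<iota> n \<Longrightarrow> P u = 0 \<Longrightarrow> p u = 0"
  using S1_ab_iff linear_0 by metis

lemma dot3_linear: "dot3 (u + v) w = dot3 u w + dot3 v w" "dot3 (r *\<^sub>R u) w = r * dot3 u w"
  "dot3 u v = dot3 v u"
  by (simp_all add: dot3_def algebra_simps)

lemma cs_form_S3:
  assumes "q1 \<in> S1_ab \<iota> n" "q3 \<in> S3_ab \<iota> n"
  shows "cs_form q1 q3 \<in> S3"
proof -
  have q: "linear q1" "q3 \<in> S3"
    using assms by (auto simp: S1_ab_iff S3_ab_iff)
  show ?thesis
    unfolding cs_form_def w0_prod_eq
  proof (rule S3_I)
    show "(dot3 u v * q1 w + dot3 u w * q1 v + dot3 v w * q1 u) / 3 + q3 u v w =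
      (dot3 v u * q1 w + dot3 v w * q1 u + dot3 u w * q1 v) / 3 + q3 v u w" for u v w
      using S3_sym(1)[OF q(2), of u v w] by (simp add: dot3_linear(3)[of u v])
    show "(dot3 u v * q1 w + dot3 u w * q1 v + dot3 v w * q1 u) / 3 + q3 u v w =
      (dot3 u w * q1 v + dot3 u v * q1 w + dot3 w v * q1 u) / 3 + q3 u w v" for u v w
      using S3_sym(2)[OF q(2), of u v w] by (simp add: dot3_linear(3)[of v w])
  qed (simp_all add: dot3_linear(1,2) linear_add[OF q(1)] linear_scale[OF q(1)] S3_simps[OF q(2)]
      algebra_simps add_divide_distrib)
qed

lemma dot3_lc: "dot3 (lc x u) v + dot3 u (lc x v) = 0"
  by (simp add: dot3_def field_simps)

text \<open>
  \<open>lc x\<close> is an infinitesimal rotation of the span of \<open>E 1, E 2, E 3\<close> and kills the abelian factor, so it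
  annihilates \<open>w\<^sub>0\<close> and all forms on the abelian factor.
\<close>

lemma cov_cs_form:
  assumes "q1 \<in> S1_ab \<iota> n" "q3 \<in> S3_ab \<iota> n"
  shows "cov (cs_form q1 q3) x y z w = 0"
proof -
  have "q1 (lc x u) = 0" for u
    by (rule S1_ab_zero[OF assms(1) P_lc])
  moreover have "q3 (lc x u) v w = 0" "q3 v (lc x u) w = 0" "q3 v w (lc x u) = 0" for u v w
    by (rule S3_ab_zero[OF assms(2) P_lc])+
  moreover have "dot3 (lc x u) v = - dot3 u (lc x v)" for u v
    using dot3_lc[of x u v] by simp
  ultimately show ?thesis
    by (simp add: cov_def cs_form_def w0_prod_eq add_divide_distrib diff_divide_distrib)
qed

lemma lc_P [simp]: "lc u (P v) = 0" "lc (P u) v = 0"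
  by (simp_all add: lc_def)

lemma lc_E [simp]:
  "lc (E (Suc 0)) (E (Suc 0)) = 0" "lc (E (Suc 0)) (E 2) = (1/2) *\<^sub>R E 3" "lc (E (Suc 0)) (E 3) = (-1/2) *\<^sub>R E 2"
  "lc (E 2) (E (Suc 0)) = (-1/2) *\<^sub>R E 3" "lc (E 2) (E 2) = 0" "lc (E 2) (E 3) = (1/2) *\<^sub>R E (Suc 0)"
  "lc (E 3) (E (Suc 0)) = (-1/2) *\<^sub>R E 2" "lc (E 3) (E 2) = (1/2) *\<^sub>R E (Suc 0)" "lc (E 3) (E 3) = 0"
  by (simp_all add: lc_def)

text \<open>
  On the Heisenberg factor the equations are a linear system of full rank for the 10 coefficients.
\<close>

lemma symmetric_cov_heisenberg_part:
  assumes c: "c \<in> S3" and sym: "\<And>x y z w. cov c x y z w = cov c y x z w"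
    and ijk: "i \<in> {1, 2, 3}" "j \<in> {1, 2, 3}" "k \<in> {1, 2, 3}"
  shows "c (E i) (E j) (E k) = 0"
proof -
  let ?e1 = "E (Suc 0)" and ?e2 = "E 2" and ?e3 = "E 3"
  have s: "c ?e2 ?e1 v = c ?e1 ?e2 v" "c ?e3 ?e1 v = c ?e1 ?e3 v" "c ?e3 ?e2 v = c ?e2 ?e3 v"
    "c u ?e2 ?e1 = c u ?e1 ?e2" "c u ?e3 ?e1 = c u ?e1 ?e3" "c u ?e3 ?e2 = c u ?e2 ?e3" for u v
    by (rule S3_sym[OF c])+
  note simps = cov_def S3_simps[OF c] s
  have a: "c ?e1 ?e1 ?e3 = 0" "c ?e1 ?e2 ?e3 = 0" "c ?e2 ?e2 ?e3 = 0"
    using sym[of ?e1 ?e2 ?e1 ?e1] sym[of ?e1 ?e2 ?e1 ?e2] sym[of ?e1 ?e2 ?e2 ?e2]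
    by (simp_all add: simps)
  have b: "c ?e1 ?e1 ?e2 = 0" "c ?e2 ?e3 ?e3 = 0" "c ?e1 ?e2 ?e2 = 0" "c ?e1 ?e3 ?e3 = 0"
    using sym[of ?e1 ?e3 ?e1 ?e1] sym[of ?e1 ?e3 ?e3 ?e3] sym[of ?e2 ?e3 ?e2 ?e2] sym[of ?e2 ?e3 ?e3 ?e3]
    by (simp_all add: simps)
  have d: "c ?e1 ?e1 ?e1 = 0" "c ?e2 ?e2 ?e2 = 0" "c ?e3 ?e3 ?e3 = 0"
    using sym[of ?e1 ?e3 ?e1 ?e2] sym[of ?e2 ?e3 ?e1 ?e2] sym[of ?e1 ?e2 ?e3 ?e3] a b
    by (simp_all add: simps)
  show ?thesis
    using ijk a b d s by auto
qed

text \<open>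
  With \<open>P y\<close> as one argument the equations say that the remaining bilinear form is invariant under the
  infinitesimal rotations \<open>lc (E i)\<close>, hence a multiple of the inner product on the Heisenberg factor.
\<close>

lemma symmetric_cov_mixed_part:
  assumes c: "c \<in> S3" and sym: "\<And>x y z w. cov c x y z w = cov c y x z w"
  shows "c (P y) (E 1) (E 2) = 0" "c (P y) (E 1) (E 3) = 0" "c (P y) (E 2) (E 3) = 0"
    "c (P y) (E 2) (E 2) = c (P y) (E 1) (E 1)" "c (P y) (E 3) (E 3) = c (P y) (E 1) (E 1)"
    "c (P y) (E 1) (P z) = 0" "c (P y) (E 2) (P z) = 0" "c (P y) (E 3) (P z) = 0"
proof -
  have inv: "c (P y) (lc x u) v + c (P y) u (lc x v) = 0" for x u v
    using sym[of x "P y" u v] by (simp add: cov_def S3_simps[OF c])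
  let ?e1 = "E (Suc 0)" and ?e2 = "E 2" and ?e3 = "E 3"
  have s: "c u ?e2 ?e1 = c u ?e1 ?e2" "c u ?e3 ?e1 = c u ?e1 ?e3" "c u ?e3 ?e2 = c u ?e2 ?e3" for u
    by (rule S3_sym[OF c])+
  note simps = S3_simps[OF c] s
  show "c (P y) (E 1) (E 2) = 0" "c (P y) (E 1) (E 3) = 0" "c (P y) (E 2) (E 3) = 0"
    using inv[of ?e1 ?e3 ?e1] inv[of ?e1 ?e2 ?e1] inv[of ?e1 ?e2 ?e2] by (simp_all add: simps)
  show "c (P y) (E 2) (E 2) = c (P y) (E 1) (E 1)" "c (P y) (E 3) (E 3) = c (P y) (E 1) (E 1)"
    using inv[of ?e1 ?e2 ?e3] inv[of ?e2 ?e1 ?e3] by (simp_all add: simps)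
  show "c (P y) (E 1) (P z) = 0" "c (P y) (E 2) (P z) = 0" "c (P y) (E 3) (P z) = 0"
    using inv[of ?e2 ?e3 "P z"] inv[of ?e1 ?e3 "P z"] inv[of ?e1 ?e2 "P z"] by (simp_all add: simps)
qed

lemma symmetric_cov_imp_CS:
  assumes c: "c \<in> S3" and sym: "\<And>x y z w. cov c x y z w = cov c y x z w"
  shows "c \<in> CS"
proof -
  define q1 where "q1 = (\<lambda>w. 3 * c (E 1) (E 1) (P w))"
  define q3 where "q3 = (\<lambda>u v w. c (P u) (P v) (P w))"
  have q1: "q1 \<in> S1_ab \<iota> n"
    unfolding S1_ab_iff q1_def
    by (auto intro!: linearI simp: linear_add[OF linear_P] linear_scale[OF linear_P] S3_simps[OF c])
  have q3: "q3 \<in> S3_ab \<iota> n"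
    using S3_lact[OF c linear_P, of 1] by (simp add: S3_ab_iff q3_def)
  let ?e1 = "E (Suc 0)" and ?e2 = "E 2" and ?e3 = "E 3"
  have h: "c (E i) (E j) (E k) = 0" if "i \<in> {1, 2, 3}" "j \<in> {1, 2, 3}" "k \<in> {1, 2, 3}" for i j k
    by (rule symmetric_cov_heisenberg_part[OF c sym that])
  have h': "c ?e1 ?e1 ?e1 = 0" "c ?e1 ?e1 ?e2 = 0" "c ?e1 ?e1 ?e3 = 0"
    "c ?e1 ?e2 ?e1 = 0" "c ?e1 ?e2 ?e2 = 0" "c ?e1 ?e2 ?e3 = 0"
    "c ?e1 ?e3 ?e1 = 0" "c ?e1 ?e3 ?e2 = 0" "c ?e1 ?e3 ?e3 = 0"
    "c ?e2 ?e1 ?e1 = 0" "c ?e2 ?e1 ?e2 = 0" "c ?e2 ?e1 ?e3 = 0"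
    "c ?e2 ?e2 ?e1 = 0" "c ?e2 ?e2 ?e2 = 0" "c ?e2 ?e2 ?e3 = 0"
    "c ?e2 ?e3 ?e1 = 0" "c ?e2 ?e3 ?e2 = 0" "c ?e2 ?e3 ?e3 = 0"
    "c ?e3 ?e1 ?e1 = 0" "c ?e3 ?e1 ?e2 = 0" "c ?e3 ?e1 ?e3 = 0"
    "c ?e3 ?e2 ?e1 = 0" "c ?e3 ?e2 ?e2 = 0" "c ?e3 ?e2 ?e3 = 0"
    "c ?e3 ?e3 ?e1 = 0" "c ?e3 ?e3 ?e2 = 0" "c ?e3 ?e3 ?e3 = 0"
    using h by auto
  note m = symmetric_cov_mixed_part[OF c sym, unfolded One_nat_def]
  have m': "c ?e1 ?e2 (P y) = 0" "c ?e1 ?e3 (P y) = 0" "c ?e2 ?e3 (P y) = 0"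
    "c ?e2 ?e1 (P y) = 0" "c ?e3 ?e1 (P y) = 0" "c ?e3 ?e2 (P y) = 0"
    "c ?e1 (P y) ?e2 = 0" "c ?e1 (P y) ?e3 = 0" "c ?e2 (P y) ?e3 = 0"
    "c ?e2 (P y) ?e1 = 0" "c ?e3 (P y) ?e1 = 0" "c ?e3 (P y) ?e2 = 0"
    "c (P y) ?e2 ?e1 = 0" "c (P y) ?e3 ?e1 = 0" "c (P y) ?e3 ?e2 = 0"
    "c ?e2 ?e2 (P y) = c ?e1 ?e1 (P y)" "c ?e3 ?e3 (P y) = c ?e1 ?e1 (P y)"
    "c ?e1 (P y) ?e1 = c ?e1 ?e1 (P y)" "c ?e2 (P y) ?e2 = c ?e1 ?e1 (P y)" "c ?e3 (P y) ?e3 = c ?e1 ?e1 (P y)"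
    "c (P y) ?e1 ?e1 = c ?e1 ?e1 (P y)" "c (P y) ?e2 ?e2 = c ?e1 ?e1 (P y)" "c (P y) ?e3 ?e3 = c ?e1 ?e1 (P y)"
    "c ?e1 (P y) (P z) = 0" "c ?e2 (P y) (P z) = 0" "c ?e3 (P y) (P z) = 0"
    "c (P y) (P z) ?e1 = 0" "c (P y) (P z) ?e2 = 0" "c (P y) (P z) ?e3 = 0" for y z
    using m(1-5)[of y] m(6-8)[of y z] m(6-8)[of z y] S3_sym[OF c] by metis+
  have "c u v w = cs_form q1 q3 u v w" for u v w
  proof -
    have "c u v w = c (coord \<iota> 1 u *\<^sub>R E 1 + coord \<iota> 2 u *\<^sub>R E 2 + coord \<iota> 3 u *\<^sub>R E 3 + P u)
      (coord \<iota> 1 v *\<^sub>R E 1 + coord \<iota> 2 v *\<^sub>R E 2 + coord \<iota> 3 v *\<^sub>R E 3 + P v)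
      (coord \<iota> 1 w *\<^sub>R E 1 + coord \<iota> 2 w *\<^sub>R E 2 + coord \<iota> 3 w *\<^sub>R E 3 + P w)"
      by (simp only: decompose[symmetric])
    also have "\<dots> = cs_form q1 q3 u v w"
      unfolding cs_form_def w0_prod_eq q1_def q3_def dot3_def
      by (simp add: S3_simps[OF c] h' m m' algebra_simps)
    finally show ?thesis .
  qed
  then have "c = cs_form q1 q3" by (simp add: fun_eq_iff)
  then show ?thesis
    unfolding CS_def using q1 q3 by blast
qed

theorem conjugate_symmetric_inner_iff:
  assumes "c \<in> S3"
  shows "conjugate_symmetric (lmetric (\<bullet>)) (conn (gam (\<bullet>) c)) \<longleftrightarrow> c \<in> CS"
  unfolding conjugate_symmetric_lmetric[OF inner_product_inner assms] curv_dual_eq_iff[OF assms]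
  using symmetric_cov_imp_CS[OF assms] by (auto simp: CS_def cov_cs_form)

lemma CS_subset_S3: "CS \<subseteq> S3"
  by (auto simp: CS_def cs_form_S3)

subsection \<open>Parallelity and sectional curvature\<close>

lemma gam_zero: "gam (\<bullet>) (\<lambda>u v w. 0) = lc"
proof -
  have "sharp (\<lambda>u v w. 0) u v = 0" for u v
    by (rule inner_product_eqI[OF inner_product_inner]) (simp add: sharp S3_zero)
  then show ?thesis by (simp add: gam_inner[OF S3_zero])
qed

lemma parallel3_CS:
  assumes "c \<in> CS"
  shows "parallel3 (levi_civita (lmetric (\<bullet>))) (left_form3 mul c)"
proof -
  obtain q1 q3 where c: "c = cs_form q1 q3" "q1 \<in> S1_ab \<iota> n" "q3 \<in> S3_ab \<iota> n"
    using assms by (auto simp: CS_def)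
  show ?thesis
    unfolding levi_civita_lmetric[OF inner_product_inner] gam_zero
    using cov_cs_form[OF c(2,3)] cs_form_S3[OF c(2,3)]
    by (intro parallel3_conn) (simp_all add: c(1) cov_def)
qed

text \<open>Duality makes every \<open>gam b c u\<close> minus the adjoint of \<open>gam b (- c) u\<close>; adjoints reverse commutators.\<close>

lemma curv_dual:
  assumes b: "inner_product b" and c: "c \<in> S3"
  shows "b (curv (gam b c) x y z) w = - b z (curv (gam b (\<lambda>u v w. - c u v w)) x y w)"
proof -
  have d: "b (gam b c u v) w = - b v (gam b (\<lambda>u v w. - c u v w) u w)" for u v w
    using gam_dual[OF b c, of u v w] by simp
  show ?thesis
    by (simp add: curv_def inner_product_linear[OF b] d)
qed

lemma flat_imp_dual_flat:
  assumes b: "inner_product b" and c: "c \<in> S3" and flat: "\<And>x y z. curv (gam b c) x y z = 0"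
  shows "curv (gam b (\<lambda>u v w. - c u v w)) x y z = 0"
proof (rule inner_product_eqI[OF b])
  fix w
  have "b w (curv (gam b (\<lambda>u v w. - c u v w)) x y z) = 0"
    using curv_dual[OF b c, of x y w z] by (simp add: flat inner_product_linear[OF b])
  then show "b (curv (gam b (\<lambda>u v w. - c u v w)) x y z) w = b 0 w"
    using inner_productD(2)[OF b] by (simp add: inner_product_linear[OF b])
qed

text \<open>
  The part \<open>w\<^sub>0 p\<^sub>1\<close> of the cubic form adds \<open>|p\<^sub>1|\<^sup>2 / 36\<close> to the curvature 1/4 of the Heisenberg group,
  and \<open>p\<^sub>3\<close> adds nothing.
\<close>

lemma curv_CS_13:
  assumes "c \<in> CS"
  shows "curv (gam (\<bullet>) c) (E 1) (E 3) (E 3) \<bullet> E 1 \<ge> 1 / 4"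
proof -
  obtain q1 q3 where c: "c = cs_form q1 q3" "q1 \<in> S1_ab \<iota> n" "q3 \<in> S3_ab \<iota> n"
    using assms by (auto simp: CS_def)
  have S3: "c \<in> S3" using assms CS_subset_S3 by blast
  let ?e1 = "E (Suc 0)" and ?e2 = "E 2" and ?e3 = "E 3"
  have z: "q1 ?e1 = 0" "q1 ?e2 = 0" "q1 ?e3 = 0" "q3 ?e1 v w = 0" "q3 ?e3 v w = 0" for v w
    using S1_ab_zero[OF c(2)] S3_ab_zero[OF c(3)] by simp_all
  \<comment> \<open>\<open>c(e\<^sub>1, e\<^sub>1, \<cdot>)\<close> and \<open>c(e\<^sub>3, e\<^sub>3, \<cdot>)\<close> agree, so the contribution of \<open>c\<close> is a square\<close>
  have ce: "c ?e1 ?e1 v = q1 v / 3" "c ?e3 ?e3 v = q1 v / 3" "c ?e1 ?e3 v = 0" "c ?e3 ?e2 v = 0" for v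
    by (simp_all add: c(1) cs_form_def w0_prod_eq z dot3_def)
  have sh: "sharp c ?e1 ?e3 = 0" "sharp c ?e3 ?e2 = 0"
    by (rule inner_product_eqI[OF inner_product_inner]; simp add: sharp S3 ce)+
  have shl: "sharp c u (r *\<^sub>R w) = r *\<^sub>R sharp c u w" "sharp c u (- w) = - sharp c u w" "sharp c 0 w = 0" for u r w
    by (rule inner_product_eqI[OF inner_product_inner]; simp add: sharp S3 S3_simps[OF S3])+
  let ?s = "sharp c ?e3 ?e3"
  have br: "br ?e1 ?e3 = 0" by (simp add: br_def)
  have lcs: "lc x ?s \<bullet> ?e1 = - (?s \<bullet> lc x ?e1)" for x by (rule lc_skew)
  have "curv (gam (\<bullet>) c) ?e1 ?e3 ?e3 \<bullet> ?e1 = 1 / 4 + (1 / 4) * (sharp c ?e1 ?s \<bullet> ?e1)"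
    unfolding curv_def gam_inner[OF S3]
    by (simp add: sh br shl lcs bilinear_rsub[OF bilinear_lc] bilinear_rmul[OF bilinear_lc]
        bilinear_rneg[OF bilinear_lc] bilinear_lzero[OF bilinear_lc] inner_diff_left inner_add_left
        lc_inner sharp[OF S3] S3_simps[OF S3] coord_eq_inner[symmetric] ce(3,4) z)
  also have "sharp c ?e1 ?s \<bullet> ?e1 = c ?e1 ?e1 ?s"
    using S3_sym(2)[OF S3, of ?e1 ?s ?e1] by (simp add: sharp S3)
  also have "\<dots> = ?s \<bullet> ?s"
    by (simp add: sharp S3 ce)
  finally show ?thesis by simp
qed

lemma sect_CS:
  assumes "c \<in> CS"
  shows "sect (lmetric (\<bullet>)) (conn (gam (\<bullet>) c)) p (L p (E 1)) (L p (E 3)) \<ge> 1 / 4"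
proof -
  have c: "c \<in> S3" using assms CS_subset_S3 by blast
  have "sect (lmetric (\<bullet>)) (conn (gam (\<bullet>) c)) p (L p (E 1)) (L p (E 3)) =
      curv (gam (\<bullet>) c) (E 1) (E 3) (E 3) \<bullet> E 1"
    using curvature_at_conn[OF bilinear_gam[OF inner_product_inner c]]
    by (simp add: sect_def lmetric_def coord_eq_inner[symmetric] power2_eq_square)
  then show ?thesis using curv_CS_13[OF assms] by simp
qed

text \<open>A flat structure is conjugate symmetric, as its dual is flat too, and then it has positive curvature.\<close>

lemma not_flat_inner:
  assumes "c \<in> S3"
  shows "\<exists>x y z. curv (gam (\<bullet>) c) x y z \<noteq> 0"
proof (rule ccontr)
  assume "\<not> ?thesis"
  then have flat: "curv (gam (\<bullet>) c) x y z = 0" for x y z by blast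
  then have "curv (gam (\<bullet>) c) = curv (gam (\<bullet>) (\<lambda>u v w. - c u v w))"
    by (simp add: fun_eq_iff flat_imp_dual_flat[OF inner_product_inner assms])
  then have "c \<in> CS"
    using conjugate_symmetric_inner_iff[OF assms] conjugate_symmetric_lmetric[OF inner_product_inner assms]
    by simp
  from curv_CS_13[OF this] show False by (simp add: flat)
qed

lemma inner_eq_if_orthonormal_frame:
  assumes "bilinear b" "\<And>i j. i \<in> {1..n} \<Longrightarrow> j \<in> {1..n} \<Longrightarrow> b (E i) (E j) = (if i = j then 1 else 0)"
  shows "b = (\<bullet>)"
proof -
  have inn: "bilinear (\<lambda>(u::real ^ 'n) v. u \<bullet> v)"
    by (simp add: bilinear_conv_bounded_bilinear bounded_bilinear_inner)
  have "b u v = u \<bullet> v" if uv: "u \<in> Basis" "v \<in> Basis" for u v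
  proof -
    obtain k l where kl: "u = axis k 1" "v = axis l 1"
      using uv by (auto simp: Basis_vec_def)
    obtain i j where ij: "i \<in> {1..n}" "j \<in> {1..n}" "k = \<iota> i" "l = \<iota> j"
      using bij unfolding bij_betw_def by (metis UNIV_I imageE)
    have "b (E i) (E j) = E i \<bullet> E j"
      using assms(2)[OF ij(1,2)] coord_E[OF ij(2,1)] by (simp add: coord_eq_inner)
    then show ?thesis by (simp add: kl ij basis_vec_def)
  qed
  then show ?thesis
    using bilinear_eq_stdbasis[OF assms(1) inn] by (simp add: fun_eq_iff)
qed

end

section \<open>Normal form of the metric\<close>

subsection \<open>Continuity of evaluations\<close>

lemma continuous_on_eval2:
  fixes F :: "'x::topological_space \<Rightarrow> 'i \<Rightarrow> 'j \<Rightarrow> 'c::topological_space"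
  assumes "continuous_on S F"
  shows "continuous_on S (\<lambda>x. F x u v)"
  by (rule continuous_on_product_then_coordinatewise[OF continuous_on_product_then_coordinatewise[OF assms]])

lemma continuous_on_eval3:
  fixes F :: "'x::topological_space \<Rightarrow> 'i \<Rightarrow> 'j \<Rightarrow> 'k \<Rightarrow> 'c::topological_space"
  assumes "continuous_on S F"
  shows "continuous_on S (\<lambda>x. F x u v w)"
  by (rule continuous_on_product_then_coordinatewise[OF continuous_on_eval2[OF assms]])

lemma continuous_on_bilinear_form:
  fixes B :: "'x::topological_space \<Rightarrow> 'a::euclidean_space \<Rightarrow> 'a \<Rightarrow> real"
  assumes "\<And>x. x \<in> S \<Longrightarrow> bilinear (B x)" "continuous_on S B" "continuous_on S F" "continuous_on S H"
  shows "continuous_on S (\<lambda>x. B x (F x) (H x))"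
proof -
  have "B x (F x) (H x) = (\<Sum>i\<in>Basis. \<Sum>j\<in>Basis. (F x \<bullet> i) * (H x \<bullet> j) * B x i j)" if "x \<in> S" for x
  proof -
    have "B x (F x) (H x) = (\<Sum>i\<in>Basis. (F x \<bullet> i) *\<^sub>R B x i (H x))"
      using assms(1)[OF that] by (intro linear_eq_sum_Basis) (simp add: bilinear_def)
    also have "\<dots> = (\<Sum>i\<in>Basis. (F x \<bullet> i) *\<^sub>R (\<Sum>j\<in>Basis. (H x \<bullet> j) *\<^sub>R B x i j))"
      using assms(1)[OF that]
      by (intro sum.cong refl arg_cong[where f = "(*\<^sub>R) _"] linear_eq_sum_Basis) (simp add: bilinear_def)
    finally show ?thesis by (simp add: sum_distrib_left mult.assoc)
  qed
  moreover have "continuous_on S (\<lambda>x. \<Sum>i\<in>Basis. \<Sum>j\<in>Basis. (F x \<bullet> i) * (H x \<bullet> j) * B x i j)"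
    by (intro continuous_on_sum continuous_on_mult continuous_on_inner continuous_on_const
        assms(3,4) continuous_on_eval2[OF assms(2)])
  ultimately show ?thesis
    by (subst continuous_on_cong[OF refl])
qed

lemma continuous_on_trilinear_form:
  fixes C :: "'x::topological_space \<Rightarrow> 'a::euclidean_space \<Rightarrow> 'a \<Rightarrow> 'a \<Rightarrow> real"
  assumes "\<And>x. x \<in> S \<Longrightarrow> C x \<in> S3" "continuous_on S C"
    "continuous_on S F" "continuous_on S H" "continuous_on S K"
  shows "continuous_on S (\<lambda>x. C x (F x) (H x) (K x))"
proof -
  have "C x (F x) (H x) (K x) = (\<Sum>i\<in>Basis. (F x \<bullet> i) * C x i (H x) (K x))" if "x \<in> S" for x
    using linear_eq_sum_Basis[OF S3_linear(1)[OF assms(1)[OF that], where v = "H x" and w = "K x"], of "F x"] by simp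
  moreover have "continuous_on S (\<lambda>x. C x i (H x) (K x))" for i
  proof (rule continuous_on_bilinear_form[where B = "\<lambda>x. C x i"])
    show "bilinear (C x i)" if "x \<in> S" for x
      using S3_linear[OF assms(1)[OF that]] by (simp add: bilinear_def)
    show "continuous_on S (\<lambda>x. C x i)"
      by (rule continuous_on_product_then_coordinatewise[OF assms(2)])
  qed (use assms in auto)
  then have "continuous_on S (\<lambda>x. \<Sum>i\<in>Basis. (F x \<bullet> i) * C x i (H x) (K x))"
    by (intro continuous_on_sum continuous_on_mult continuous_on_inner continuous_on_const assms(3)) auto
  ultimately show ?thesis
    by (subst continuous_on_cong[OF refl])
qed

subsection \<open>Gram-Schmidt orthonormalization\<close>

function gram_schmidt :: "('a::euclidean_space \<Rightarrow> 'a \<Rightarrow> real) \<Rightarrow> (nat \<Rightarrow> 'a) \<Rightarrow> nat \<Rightarrow> 'a" where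
  "gram_schmidt b v k =
    (let w = v k - (\<Sum>j<k. b (v k) (gram_schmidt b v j) *\<^sub>R gram_schmidt b v j)
     in (1 / sqrt (b w w)) *\<^sub>R w)"
  by pat_completeness auto
termination by (relation "Wellfounded.measure (\<lambda>(b, v, k). k)") auto

declare gram_schmidt.simps [simp del]

definition gs_residue where
  "gs_residue b v k = v k - (\<Sum>j<k. b (v k) (gram_schmidt b v j) *\<^sub>R gram_schmidt b v j)"

lemma gram_schmidt_eq:
  "gram_schmidt b v k = (1 / sqrt (b (gs_residue b v k) (gs_residue b v k))) *\<^sub>R gs_residue b v k"
  by (subst gram_schmidt.simps) (simp add: gs_residue_def Let_def)

lemma inner_product_sum:
  assumes "inner_product b"
  shows "b (\<Sum>i\<in>A. f i) v = (\<Sum>i\<in>A. b (f i) v)" "b v (\<Sum>i\<in>A. f i) = (\<Sum>i\<in>A. b v (f i))"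
  by (induction A rule: infinite_finite_induct) (simp_all add: inner_product_linear[OF assms])

context
  fixes b :: "'a::euclidean_space \<Rightarrow> 'a \<Rightarrow> real" and v :: "nat \<Rightarrow> 'a" and N :: nat
  assumes b: "inner_product b"
    and v: "\<And>i j. i < N \<Longrightarrow> j < N \<Longrightarrow> v i \<bullet> v j = (if i = j then 1 else 0)"
begin

text \<open>
  The result is triangular with positive diagonal, so no residue vanishes and the divisions in the
  recursion are by positive numbers.
\<close>

lemma gram_schmidt_triangular:
  "k < N \<Longrightarrow> gs_residue b v k \<bullet> v k = 1 \<and> b (gs_residue b v k) (gs_residue b v k) > 0 \<and>
     gram_schmidt b v k \<bullet> v k > 0 \<and> (\<forall>m<N. k < m \<longrightarrow> gram_schmidt b v k \<bullet> v m = 0)"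
proof (induction k rule: less_induct)
  case (less k)
  have z: "gs_residue b v k \<bullet> v m = v k \<bullet> v m" if "m < N" "k \<le> m" for m
    using less that by (simp add: gs_residue_def inner_diff_left inner_sum_left)
  then have 1: "gs_residue b v k \<bullet> v k = 1"
    using less.prems v by simp
  then have "gs_residue b v k \<noteq> 0" by auto
  then have 2: "b (gs_residue b v k) (gs_residue b v k) > 0"
    by (rule inner_productD(3)[OF b])
  show ?case
    using 1 2 z less.prems v by (auto simp: gram_schmidt_eq)
qed

lemma gram_schmidt_orthonormal:
  assumes "k < N"
  shows "b (gram_schmidt b v k) (gram_schmidt b v k) = 1 \<and> (\<forall>j<k. b (gram_schmidt b v k) (gram_schmidt b v j) = 0)"
  using assms
proof (induction k rule: less_induct)
  case (less k)
  let ?w = "gs_residue b v k" and ?g = "gram_schmidt b v"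
  have pos: "b ?w ?w > 0" using gram_schmidt_triangular less.prems by blast
  have "b ?w (?g j) = 0" if "j < k" for j
  proof -
    have "b (?g i) (?g j) = (if i = j then 1 else 0)" if "i < k" for i
      using less.IH[of i] less.IH[of j] that \<open>j < k\<close> less.prems inner_productD(2)[OF b, of "?g i" "?g j"]
      by (cases i j rule: linorder_cases) auto
    then have "(\<Sum>i<k. b (v k) (?g i) * b (?g i) (?g j)) = (\<Sum>i<k. if i = j then b (v k) (?g i) else 0)"
      by (intro sum.cong) auto
    then show ?thesis
      using that by (simp add: gs_residue_def inner_product_linear[OF b] inner_product_sum[OF b])
  qed
  moreover have "b (?g k) (?g k) = 1"
    using pos by (simp add: gram_schmidt_eq[of b v k] inner_product_linear[OF b] flip: power2_eq_square)
  ultimately show ?case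
    by (simp add: gram_schmidt_eq[of b v k] inner_product_linear[OF b])
qed

end

lemma continuous_on_gram_schmidt:
  fixes v :: "nat \<Rightarrow> 'a::euclidean_space"
  assumes v: "\<And>i j. i < N \<Longrightarrow> j < N \<Longrightarrow> v i \<bullet> v j = (if i = j then 1 else 0)" and "k < N"
  shows "continuous_on (Collect inner_product) (\<lambda>b. gram_schmidt b v k)"
  using assms(2)
proof (induction k rule: less_induct)
  case (less k)
  let ?I = "Collect inner_product :: ('a \<Rightarrow> 'a \<Rightarrow> real) set"
  have bil: "bilinear b" if "b \<in> ?I" for b :: "'a \<Rightarrow> 'a \<Rightarrow> real"
    using that inner_productD(1) by blast
  have id: "continuous_on ?I (\<lambda>b. b)" by (rule continuous_on_id)
  have w: "continuous_on ?I (\<lambda>b. gs_residue b v k)"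
    unfolding gs_residue_def
    using less by (intro continuous_on_diff continuous_on_sum continuous_on_scaleR continuous_on_const
        continuous_on_bilinear_form[where B = "\<lambda>b. b"] bil id) auto
  have "b (gs_residue b v k) (gs_residue b v k) \<noteq> 0" if "b \<in> ?I" for b
    using gram_schmidt_triangular[of b N v k] that v less.prems by force
  then show ?case
    unfolding gram_schmidt_eq
    by (intro continuous_on_divide continuous_on_real_sqrt continuous_on_scaleR continuous_on_const
        continuous_on_bilinear_form[where B = "\<lambda>b. b"] bil id w) auto
qed

context heisenberg
begin

text \<open>
  The basis is orthonormalized in the order \<open>E 3, E 4, \<dots>, E n, E 2, E 1\<close>. Every new vector is then a
  positive multiple of the old one modulo its predecessors, so the new third vector spans the derived
  algebra, the new vectors after the third are central, and the change of basis is a Lie algebra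
  automorphism up to rescaling.
\<close>

definition gs_pos :: "nat \<Rightarrow> nat" where
  "gs_pos i = (if i \<le> 2 then n - i else i - 3)"

definition gs_vec :: "nat \<Rightarrow> real ^ 'n" where
  "gs_vec k = E (if k < n - 2 then k + 3 else n - k)"

definition gs_frame :: "(real ^ 'n \<Rightarrow> real ^ 'n \<Rightarrow> real) \<Rightarrow> nat \<Rightarrow> real ^ 'n" where
  "gs_frame b i = gram_schmidt b gs_vec (gs_pos i)"

lemma gs_pos_less: "i \<in> {1..n} \<Longrightarrow> gs_pos i < n"
  using n3 by (auto simp: gs_pos_def)

lemma gs_vec_pos: "i \<in> {1..n} \<Longrightarrow> gs_vec (gs_pos i) = E i"
  using n3 by (auto simp: gs_vec_def gs_pos_def intro!: arg_cong[where f = E])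

lemma E_inner: "i \<in> {1..n} \<Longrightarrow> j \<in> {1..n} \<Longrightarrow> E i \<bullet> E j = (if i = j then 1 else 0)"
  using coord_E[of j i] by (auto simp: coord_eq_inner)

lemma gs_vec_orthonormal:
  assumes "i < n" "j < n"
  shows "gs_vec i \<bullet> gs_vec j = (if i = j then 1 else 0)"
proof -
  have *: "(if k < n - 2 then k + 3 else n - k) \<in> {1..n}" if "k < n" for k
    using that n3 by auto
  have "(if i < n - 2 then i + 3 else n - i) = (if j < n - 2 then j + 3 else n - j) \<longleftrightarrow> i = j"
    using assms n3 by (auto split: if_splits)
  then show ?thesis
    unfolding gs_vec_def using E_inner[OF *[OF assms(1)] *[OF assms(2)]] by simp
qed

lemma gs_frame_orthonormal:
  assumes b: "inner_product b" and ij: "i \<in> {1..n}" "j \<in> {1..n}"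
  shows "b (gs_frame b i) (gs_frame b j) = (if i = j then 1 else 0)"
proof -
  have "gs_pos i = gs_pos j \<longleftrightarrow> i = j"
    using ij n3 by (auto simp: gs_pos_def split: if_splits)
  then show ?thesis
    using gram_schmidt_orthonormal[OF b gs_vec_orthonormal gs_pos_less[OF ij(1)]]
      gram_schmidt_orthonormal[OF b gs_vec_orthonormal gs_pos_less[OF ij(2)]]
      inner_productD(2)[OF b, of "gs_frame b i" "gs_frame b j"]
    unfolding gs_frame_def by (cases "gs_pos i" "gs_pos j" rule: linorder_cases) auto
qed

lemma gs_frame_triangular:
  assumes b: "inner_product b" and ij: "i \<in> {1..n}" "j \<in> {1..n}"
  shows "coord \<iota> i (gs_frame b i) > 0" "gs_pos i < gs_pos j \<Longrightarrow> coord \<iota> j (gs_frame b i) = 0"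
  using gram_schmidt_triangular[OF b gs_vec_orthonormal gs_pos_less[OF ij(1)]] gs_pos_less[OF ij(2)]
    gs_vec_pos[OF ij(1)] gs_vec_pos[OF ij(2)]
  by (auto simp: gs_frame_def coord_eq_inner)

lemma gs_frame_coords:
  assumes b: "inner_product b"
  shows "coord \<iota> (Suc 0) (gs_frame b (Suc 0)) > 0" "coord \<iota> 2 (gs_frame b 2) > 0" "coord \<iota> 3 (gs_frame b 3) > 0"
    "coord \<iota> (Suc 0) (gs_frame b 2) = 0"
    "i \<in> {3..n} \<Longrightarrow> coord \<iota> (Suc 0) (gs_frame b i) = 0" "i \<in> {3..n} \<Longrightarrow> coord \<iota> 2 (gs_frame b i) = 0"
proof -
  show "coord \<iota> (Suc 0) (gs_frame b (Suc 0)) > 0" "coord \<iota> 2 (gs_frame b 2) > 0" "coord \<iota> 3 (gs_frame b 3) > 0"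
    using gs_frame_triangular(1)[OF b, of 1 1] gs_frame_triangular(1)[OF b, of 2 2]
      gs_frame_triangular(1)[OF b, of 3 3] n3 by auto
  show "coord \<iota> (Suc 0) (gs_frame b 2) = 0"
    using gs_frame_triangular(2)[OF b, of 2 "Suc 0"] n3 by (auto simp: gs_pos_def)
  show "coord \<iota> (Suc 0) (gs_frame b i) = 0" "coord \<iota> 2 (gs_frame b i) = 0" if "i \<in> {3..n}"
    using gs_frame_triangular(2)[OF b, of i "Suc 0"] gs_frame_triangular(2)[OF b, of i 2] that
    by (auto simp: gs_pos_def)
qed

lemma gs_frame_3: "inner_product b \<Longrightarrow> gs_frame b 3 = coord \<iota> 3 (gs_frame b 3) *\<^sub>R E 3"
proof -
  assume b: "inner_product b"
  have "gs_frame b 3 = (1 / sqrt (b (E 3) (E 3))) *\<^sub>R E 3"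
    using gs_vec_pos[of 3] n3 gram_schmidt_eq[of b gs_vec 0] by (simp add: gs_frame_def gs_residue_def gs_pos_def)
  then show ?thesis by simp
qed

definition nf_ratio :: "(real ^ 'n \<Rightarrow> real ^ 'n \<Rightarrow> real) \<Rightarrow> real" where
  "nf_ratio b = coord \<iota> (Suc 0) (gs_frame b (Suc 0)) * coord \<iota> 2 (gs_frame b 2) / coord \<iota> 3 (gs_frame b 3)"

text \<open>
  \<open>[f\<^sub>1, f\<^sub>2] = \<lambda> f\<^sub>3\<close> for the orthonormal frame \<open>f\<close> with \<open>\<lambda> = nf_ratio b\<close>, so the basis \<open>\<lambda>\<^sup>-\<^sup>1 f\<close> has the
  structure constants of \<open>E\<close>.
\<close>

definition nf_map :: "(real ^ 'n \<Rightarrow> real ^ 'n \<Rightarrow> real) \<Rightarrow> real ^ 'n \<Rightarrow> real ^ 'n" where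
  "nf_map b u = (\<Sum>i\<in>{1..n}. (coord \<iota> i u / nf_ratio b) *\<^sub>R gs_frame b i)"

lemma nf_ratio_pos: "inner_product b \<Longrightarrow> nf_ratio b > 0"
  using gs_frame_coords(1-3) by (simp add: nf_ratio_def)

lemma linear_nf_map: "linear (nf_map b)"
  unfolding nf_map_def
  by (rule linearI) (simp_all add: add_divide_distrib scaleR_add_left sum.distrib scaleR_sum_right)

lemma inner_eq_sum: "u \<bullet> v = (\<Sum>i\<in>{1..n}. coord \<iota> i u * coord \<iota> i v)"
proof -
  have "u \<bullet> v = (\<Sum>k\<in>UNIV. u $ k * v $ k)" by (simp add: inner_vec_def)
  also have "\<dots> = (\<Sum>i\<in>{1..n}. coord \<iota> i u * coord \<iota> i v)"
    unfolding coord_def by (rule sum.reindex_bij_betw[OF bij, symmetric])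
  finally show ?thesis .
qed

lemma nf_map_isometry:
  assumes b: "inner_product b"
  shows "(nf_ratio b)\<^sup>2 * b (nf_map b u) (nf_map b v) = u \<bullet> v"
proof -
  let ?r = "nf_ratio b"
  have "b (nf_map b u) (nf_map b v) =
      (\<Sum>i\<in>{1..n}. \<Sum>j\<in>{1..n}. (coord \<iota> i u / ?r) * (coord \<iota> j v / ?r) * b (gs_frame b i) (gs_frame b j))"
  proof -
    have l: "b (nf_map b u) x = (\<Sum>i\<in>{1..n}. (coord \<iota> i u / ?r) * b (gs_frame b i) x)" for x
      by (simp add: nf_map_def inner_product_sum[OF b] inner_product_linear[OF b])
    have r: "b x (nf_map b v) = (\<Sum>j\<in>{1..n}. (coord \<iota> j v / ?r) * b x (gs_frame b j))" for x
      by (simp add: nf_map_def inner_product_sum[OF b] inner_product_linear[OF b])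
    show ?thesis
      unfolding l[of "nf_map b v"] unfolding r by (simp only: sum_distrib_left mult.assoc)
  qed
  also have "\<dots> = (\<Sum>i\<in>{1..n}. \<Sum>j\<in>{1..n}. if i = j then (coord \<iota> i u / ?r) * (coord \<iota> j v / ?r) else 0)"
    by (intro sum.cong refl) (auto simp: gs_frame_orthonormal[OF b])
  also have "\<dots> = (\<Sum>i\<in>{1..n}. coord \<iota> i u * coord \<iota> i v) / ?r\<^sup>2"
    by (simp add: sum_divide_distrib power2_eq_square)
  finally show ?thesis
    using nf_ratio_pos[OF b] by (simp add: inner_eq_sum)
qed

lemma lie_automorphism_nf_map:
  assumes b: "inner_product b"
  shows "lie_automorphism (nf_map b)"
proof -
  let ?r = "nf_ratio b" and ?f = "gs_frame b"
  have "inj (nf_map b)"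
  proof (rule injI)
    fix u v assume "nf_map b u = nf_map b v"
    then have "u \<bullet> w = v \<bullet> w" for w
      using nf_map_isometry[OF b, of u w] nf_map_isometry[OF b, of v w] by simp
    then show "u = v" by (rule inner_product_eqI[OF inner_product_inner])
  qed
  then have bij: "bij (nf_map b)"
    using linear_inj_imp_surj[OF linear_nf_map] by (simp add: bij_def)
  have split: "(\<Sum>i\<in>{1..n}. h i) = h (Suc 0) + h 2 + (\<Sum>i\<in>{3..n}. h i)" for h :: "nat \<Rightarrow> real"
  proof -
    have "{1..n} = insert (Suc 0) (insert 2 {3..n})" using n3 by auto
    then show ?thesis by (simp add: add.assoc)
  qed
  have cs: "coord \<iota> j (nf_map b u) = (\<Sum>i\<in>{1..n}. coord \<iota> i u / ?r * coord \<iota> j (?f i))" for j u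
    by (simp add: nf_map_def coord_def)
  have c1: "coord \<iota> (Suc 0) (nf_map b u) = coord \<iota> (Suc 0) u / ?r * coord \<iota> (Suc 0) (?f (Suc 0))" for u
    unfolding cs split using gs_frame_coords[OF b] by simp
  have c2: "coord \<iota> 2 (nf_map b u) =
      coord \<iota> (Suc 0) u / ?r * coord \<iota> 2 (?f (Suc 0)) + coord \<iota> 2 u / ?r * coord \<iota> 2 (?f 2)" for u
    unfolding cs split using gs_frame_coords[OF b] by simp
  have e3: "nf_map b (E 3) = (coord \<iota> 3 (?f 3) / ?r) *\<^sub>R E 3"
  proof -
    have "nf_map b (E 3) = (\<Sum>i\<in>{1..n}. if i = 3 then (1 / ?r) *\<^sub>R ?f i else 0)"
      unfolding nf_map_def using n3 by (intro sum.cong) (auto simp: coord_E)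
    also have "\<dots> = (1 / ?r) *\<^sub>R ?f 3"
      using n3 by simp
    also have "\<dots> = (1 / ?r) *\<^sub>R (coord \<iota> 3 (?f 3) *\<^sub>R E 3)"
      by (rule arg_cong[OF gs_frame_3[OF b]])
    finally show ?thesis by simp
  qed
  have "nf_map b (br u v) = br (nf_map b u) (nf_map b v)" for u v
  proof -
    let ?d = "coord \<iota> (Suc 0) u * coord \<iota> 2 v - coord \<iota> 2 u * coord \<iota> (Suc 0) v"
    have "nf_map b (br u v) = (?d * (coord \<iota> 3 (?f 3) / ?r)) *\<^sub>R E 3"
      by (simp add: br_def linear_scale[OF linear_nf_map] e3)
    moreover have "br (nf_map b u) (nf_map b v) =
        (?d * (coord \<iota> (Suc 0) (?f (Suc 0)) * coord \<iota> 2 (?f 2) / ?r / ?r)) *\<^sub>R E 3"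
      unfolding br_def One_nat_def c1 c2
      by (rule arg_cong[where f = "\<lambda>t. t *\<^sub>R E 3"]) (use nf_ratio_pos[OF b] in \<open>simp add: field_simps\<close>)
    moreover have "coord \<iota> (Suc 0) (?f (Suc 0)) * coord \<iota> 2 (?f 2) / ?r = coord \<iota> 3 (?f 3)"
      using gs_frame_coords(1-3)[OF b] by (simp add: nf_ratio_def)
    ultimately show ?thesis by simp
  qed
  then show ?thesis
    using bij linear_nf_map by (simp add: lie_automorphism_def)
qed

lemma continuous_on_coord: "continuous_on S f \<Longrightarrow> continuous_on S (\<lambda>x. coord \<iota> i (f x))"
  unfolding coord_def by (rule continuous_on_component)

lemma continuous_on_gs_frame: "i \<in> {1..n} \<Longrightarrow> continuous_on (Collect inner_product) (\<lambda>b. gs_frame b i)"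
  unfolding gs_frame_def by (rule continuous_on_gram_schmidt[OF gs_vec_orthonormal gs_pos_less])

lemma continuous_on_nf_ratio: "continuous_on (Collect inner_product) nf_ratio"
proof -
  have "coord \<iota> 3 (gs_frame b 3) \<noteq> 0" if "b \<in> Collect inner_product" for b
    using gs_frame_coords(3)[of b] that by auto
  then show ?thesis
    unfolding nf_ratio_def[abs_def] using n3
    by (intro continuous_on_divide continuous_on_mult continuous_on_coord continuous_on_gs_frame) auto
qed

lemma continuous_on_nf_map: "continuous_on (Collect inner_product) (\<lambda>b. nf_map b u)"
proof -
  have "nf_ratio b \<noteq> 0" if "b \<in> Collect inner_product" for b
    using nf_ratio_pos[of b] that by auto
  then show ?thesis
    unfolding nf_map_def
    by (intro continuous_on_sum continuous_on_scaleR continuous_on_divide continuous_on_const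
        continuous_on_gs_frame continuous_on_nf_ratio) auto
qed

text \<open>The cubic form over the standard inner product to which \<open>(b, c)\<close> is carried.\<close>

definition nf_form where
  "nf_form = (\<lambda>(b, c). \<lambda>u v w. (nf_ratio b)\<^sup>2 * c (nf_map b u) (nf_map b v) (nf_map b w))"

lemma lact_normal_form:
  assumes "inner_product b"
  shows "lact ((nf_ratio b)\<^sup>2) (nf_map b) (b, c) = ((\<bullet>), nf_form (b, c))"
  by (simp add: lact_def nf_form_def fun_eq_iff nf_map_isometry[OF assms])

lemma nf_form_S3: "c \<in> S3 \<Longrightarrow> nf_form (b, c) \<in> S3"
  unfolding nf_form_def by (simp add: S3_lact linear_nf_map)

lemma continuous_on_nf_form: "continuous_on (Collect inner_product \<times> S3) nf_form"
proof -
  let ?S = "Collect inner_product \<times> S3 :: ((real ^ 'n \<Rightarrow> real ^ 'n \<Rightarrow> real) \<times> _) set"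
  have f: "continuous_on ?S (\<lambda>x. h (fst x))" if "continuous_on (Collect inner_product) h" for h :: "_ \<Rightarrow> 'z::topological_space"
    by (rule continuous_on_compose2[OF that continuous_on_fst[OF continuous_on_id]]) auto
  have "continuous_on ?S (\<lambda>x. (nf_ratio (fst x))\<^sup>2 *
      snd x (nf_map (fst x) u) (nf_map (fst x) v) (nf_map (fst x) w))" for u v w
    by (intro continuous_on_mult continuous_on_power continuous_on_trilinear_form[where C = snd] f
        continuous_on_nf_ratio continuous_on_nf_map continuous_on_snd continuous_on_id) auto
  then show ?thesis
    unfolding nf_form_def case_prod_beta' by (intro continuous_on_coordinatewise_then_product)
qed

end

section \<open>Isometric automorphisms and orbits\<close>

lemma isometry_bij:
  fixes N :: "'a::euclidean_space \<Rightarrow> 'a"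
  assumes lin: "linear N" and iso: "\<And>u v. N u \<bullet> N v = u \<bullet> v"
  shows "bij N"
proof -
  have "inj N"
  proof (rule injI)
    fix u v assume "N u = N v"
    then have "u \<bullet> w = v \<bullet> w" for w using iso by metis
    then show "u = v" by (rule inner_product_eqI[OF inner_product_inner])
  qed
  then show ?thesis
    using linear_inj_imp_surj[OF lin] by (simp add: bij_def)
qed

context heisenberg
begin

lemma lie_automorphismD:
  assumes "lie_automorphism M"
  shows "linear M" "bij M" "M (br u v) = br (M u) (M v)"
    "inv M (M u) = u" "M (inv M u) = u" "inv (inv M) = M"
  using assms by (auto simp: lie_automorphism_def bij_is_inj bij_is_surj surj_f_inv_f inv_inv_eq)

lemma lie_automorphism_id: "lie_automorphism id"
  by (simp add: lie_automorphism_def linear_id)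

lemma lie_automorphism_comp:
  "lie_automorphism M \<Longrightarrow> lie_automorphism N \<Longrightarrow> lie_automorphism (M \<circ> N)"
  unfolding lie_automorphism_def by (simp add: linear_compose bij_comp)

definition isometric_aut where
  "isometric_aut N \<longleftrightarrow> lie_automorphism N \<and> (\<forall>u v. N u \<bullet> N v = u \<bullet> v)"

lemma isometric_aut_id: "isometric_aut id"
  by (simp add: isometric_aut_def lie_automorphism_id)

lemma isometric_aut_comp: "isometric_aut M \<Longrightarrow> isometric_aut N \<Longrightarrow> isometric_aut (M \<circ> N)"
  by (simp add: isometric_aut_def lie_automorphism_comp)

lemma isometric_aut_inv:
  assumes "isometric_aut N"
  shows "isometric_aut (inv N)"
proof -
  have N: "lie_automorphism N" "\<And>u v. N u \<bullet> N v = u \<bullet> v"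
    using assms by (auto simp: isometric_aut_def)
  then show ?thesis
    using N(2)[of "inv N _" "inv N _"]
    by (simp add: isometric_aut_def lie_automorphism_inv lie_automorphismD(5))
qed

lemma br_coords: "br u (E 2) = coord \<iota> 1 u *\<^sub>R E 3" "br u (E 1) = - (coord \<iota> 2 u *\<^sub>R E 3)"
  by (simp_all add: br_def)

lemma E3_neq_0 [simp]: "E 3 \<noteq> 0"
  using coord_E123(9) by (metis coord_linear(5) zero_neq_one)

lemma lie_automorphism_center:
  assumes N: "lie_automorphism N" and x: "coord \<iota> 1 x = 0" "coord \<iota> 2 x = 0"
  shows "coord \<iota> 1 (N x) = 0" "coord \<iota> 2 (N x) = 0"
proof -
  have "br (N x) w = 0" for w
  proof -
    have "br x (inv N w) = 0" using x by (simp add: br_def)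
    then show ?thesis
      using lie_automorphismD(3)[OF N, of x "inv N w"]
      by (simp add: lie_automorphismD[OF N] linear_0[OF lie_automorphismD(1)[OF N]])
  qed
  from this[of "E 1"] this[of "E 2"] show "coord \<iota> 1 (N x) = 0" "coord \<iota> 2 (N x) = 0"
    by (simp_all only: br_coords) auto
qed

lemma lie_automorphism_E3:
  assumes N: "lie_automorphism N"
  shows "N (E 3) = (coord \<iota> 1 (N (E 1)) * coord \<iota> 2 (N (E 2)) - coord \<iota> 2 (N (E 1)) * coord \<iota> 1 (N (E 2))) *\<^sub>R E 3"
proof -
  have "br (E 1) (E 2) = E 3" by (simp add: br_def)
  then show ?thesis
    using lie_automorphismD(3)[OF N, of "E 1" "E 2"] by (simp add: br_def)
qed

text \<open>
  The adjoint of a similarity is a multiple of its inverse, which is again an automorphism and so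
  preserves the center; hence the similarity preserves the orthogonal complement of the center.
\<close>

lemma similar_aut_E12:
  assumes N: "lie_automorphism N" and r: "r > 0" "\<And>u v. r * (N u \<bullet> N v) = u \<bullet> v"
    and j: "j \<in> {1, 2}" and i: "i \<in> {3..n}"
  shows "coord \<iota> i (N (E j)) = 0"
proof -
  have "r * coord \<iota> i (N (E j)) = r * (N (E j) \<bullet> N (inv N (E i)))"
    by (simp add: coord_eq_inner lie_automorphismD[OF N])
  also have "\<dots> = coord \<iota> j (inv N (E i))"
    by (simp add: r coord_eq_inner inner_commute)
  also have "\<dots> = 0"
    using lie_automorphism_center[OF lie_automorphism_inv[OF N], of "E i"] i j
    by (auto simp: coord_E)
  finally show ?thesis using r(1) by simp
qed

lemma split_sum_n: "(\<Sum>i\<in>{1..n}. h i) = h 1 + h 2 + (\<Sum>i\<in>{3..n}. h i)" for h :: "nat \<Rightarrow> real"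
proof -
  have "{1..n} = insert 1 (insert 2 {3..n})" using n3 by auto
  then show ?thesis by (simp add: add.assoc)
qed

text \<open>
  A similarity with ratio \<open>r\<^sup>-\<^sup>1\<^sup>/\<^sup>2\<close> scales the plane spanned by \<open>E 1, E 2\<close> by this ratio, so its determinant
  there is \<open>\<plusminus>1/r\<close>; but this determinant is the factor on \<open>E 3 = [E 1, E 2]\<close>, which has modulus \<open>r\<^sup>-\<^sup>1\<^sup>/\<^sup>2\<close>.
\<close>

lemma similar_aut_isometric:
  assumes N: "lie_automorphism N" and r: "r > 0" "\<And>u v. r * (N u \<bullet> N v) = u \<bullet> v"
  shows "r = 1"
proof -
  define a b c d where "a = coord \<iota> 1 (N (E 1))" "b = coord \<iota> 2 (N (E 1))"
    "c = coord \<iota> 1 (N (E 2))" "d = coord \<iota> 2 (N (E 2))"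
  note abcd = a_b_c_d_def
  have g: "N (E i) \<bullet> N (E j) = coord \<iota> 1 (N (E i)) * coord \<iota> 1 (N (E j)) + coord \<iota> 2 (N (E i)) * coord \<iota> 2 (N (E j))"
    if "i \<in> {1, 2}" "j \<in> {1, 2}" for i j
    unfolding inner_eq_sum split_sum_n
    using similar_aut_E12[OF N r that(1)] by simp
  have e: "E i \<bullet> E j = (if i = j then 1 else 0)" if "i \<in> {1, 2, 3}" "j \<in> {1, 2, 3}" for i j
    using that n3 by (intro E_inner) auto
  have 1: "r * (a * a + b * b) = 1" "r * (c * c + d * d) = 1" "a * c + b * d = 0"
    using r(2)[of "E 1" "E 1"] r(2)[of "E 2" "E 2"] r(2)[of "E 1" "E 2"] r(1)
      g[of 1 1] g[of 2 2] g[of 1 2] e[of 1 1] e[of 2 2] e[of 1 2]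
    by (simp_all add: abcd)
  have "N (E 3) \<bullet> N (E 3) = (a * d - b * c)\<^sup>2"
    unfolding lie_automorphism_E3[OF N] abcd using e[of 3 3] by (simp add: power2_eq_square)
  then have 2: "r * (a * d - b * c)\<^sup>2 = 1"
    using r(2)[of "E 3" "E 3"] e[of 3 3] by simp
  have "(a * d - b * c)\<^sup>2 = (a * a + b * b) * (c * c + d * d) - (a * c + b * d)\<^sup>2"
    by (simp add: power2_eq_square algebra_simps)
  then have "r * (r * (a * d - b * c)\<^sup>2) = (r * (a * a + b * b)) * (r * (c * c + d * d))"
    using 1(3) by (simp add: algebra_simps)
  then show "r = 1" using 1 2 by simp
qed

subsection \<open>Isometric automorphisms as block matrices\<close>

lemma matrix_coord: "h $ \<iota> i $ \<iota> j = coord \<iota> i (h *v E j)"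
  by (simp add: coord_def basis_vec_def matrix_vector_mult_basis column_def)

lemma det_upper_block: "det (upper_block \<iota> h) =
    coord \<iota> 1 (h *v E 1) * coord \<iota> 2 (h *v E 2) - coord \<iota> 2 (h *v E 1) * coord \<iota> 1 (h *v E 2)"
  by (simp add: upper_block_def det_2 vector_2 matrix_coord)

lemma isometry_iff_orthogonal_matrix:
  fixes N :: "real ^ 'n \<Rightarrow> real ^ 'n"
  shows "linear N \<Longrightarrow> (\<forall>u v. N u \<bullet> N v = u \<bullet> v) \<longleftrightarrow> orthogonal_matrix (matrix N)"
  using orthogonal_transformation_matrix[of N] by (auto simp: orthogonal_transformation_def)

text \<open>
  An isometric automorphism preserves the derived algebra, the center and their orthogonal
  complements; these are the blocks.
\<close>

lemma isometric_aut_orth_blocks: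
  fixes h :: "real ^ 'n ^ 'n"
  assumes N: "isometric_aut ((*v) h)"
  shows "h \<in> orth_blocks \<iota> n"
proof -
  let ?N = "(*v) h"
  have a: "lie_automorphism ?N" and iso: "\<And>u v. 1 * (?N u \<bullet> ?N v) = u \<bullet> v"
    using N by (auto simp: isometric_aut_def)
  have "orthogonal_matrix h"
    using isometry_iff_orthogonal_matrix[of ?N] iso by (simp add: matrix_of_matrix_vector_mul)
  moreover have "{i, j} \<subseteq> {1, 2} \<or> {i, j} \<subseteq> {3} \<or> {i, j} \<subseteq> {4..n}"
    if ij: "i \<in> {1..n}" "j \<in> {1..n}" and nz: "h $ \<iota> i $ \<iota> j \<noteq> 0" for i j
  proof (rule ccontr)
    assume not: "\<not> ?thesis"
    have "coord \<iota> i (?N (E j)) = 0"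
    proof (cases "j \<in> {1, 2}")
      case True
      with not ij have "i \<in> {3..n}" by auto
      then show ?thesis by (intro similar_aut_E12[OF a _ iso True]) auto
    next
      case False
      then have j: "j \<in> {3..n}" using ij by auto
      then have "coord \<iota> 1 (?N (E j)) = 0" "coord \<iota> 2 (?N (E j)) = 0"
        using lie_automorphism_center[OF a, of "E j"] by (auto simp: coord_E)
      moreover have "coord \<iota> i (?N (E j)) = 0" if "i \<noteq> 1" "i \<noteq> 2"
      proof (cases "j = 3")
        case True
        then have "i \<in> {4..n}" using not that ij by auto
        then show ?thesis
          using True n3 by (subst True, subst lie_automorphism_E3[OF a]) (simp add: coord_E)
      next
        case j3: False
        then have i3: "i = 3" using not that ij j by auto
        define \<delta> where "\<delta> = coord \<iota> 1 (?N (E 1)) * coord \<iota> 2 (?N (E 2)) - coord \<iota> 2 (?N (E 1)) * coord \<iota> 1 (?N (E 2))"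
        have N3: "?N (E 3) = \<delta> *\<^sub>R E 3"
          unfolding \<delta>_def by (rule lie_automorphism_E3[OF a])
        have "\<delta> \<noteq> 0"
          using iso[of "E 3" "E 3"] E_inner[of 3 3] n3 by (auto simp: N3)
        moreover have "?N (E j) \<bullet> ?N (E 3) = 0"
          using iso[of "E j" "E 3"] E_inner[of j 3] j j3 by auto
        ultimately show ?thesis by (simp add: N3 i3 coord_eq_inner)
      qed
      ultimately show ?thesis by blast
    qed
    then show False using nz by (simp add: matrix_coord)
  qed
  ultimately show ?thesis unfolding orth_blocks_def by blast
qed

lemma SO21_O_iff: "h \<in> SO21_O \<iota> n \<longleftrightarrow> isometric_aut ((*v) h)"
proof
  assume N: "isometric_aut ((*v) h)"
  then have "lie_automorphism ((*v) h)" by (simp add: isometric_aut_def)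
  from lie_automorphism_E3[OF this] have "coord \<iota> 3 (h *v E 3) = det (upper_block \<iota> h)"
    by (simp add: det_upper_block)
  then show "h \<in> SO21_O \<iota> n"
    using isometric_aut_orth_blocks[OF N] by (simp add: SO21_O_def matrix_coord)
next
  assume h: "h \<in> SO21_O \<iota> n"
  then have orth: "orthogonal_matrix h" and h33: "coord \<iota> 3 (h *v E 3) = det (upper_block \<iota> h)"
    and block: "\<And>i j. i \<in> {1..n} \<Longrightarrow> j \<in> {1..n} \<Longrightarrow>
      \<not> ({i, j} \<subseteq> {1, 2} \<or> {i, j} \<subseteq> {3} \<or> {i, j} \<subseteq> {4..n}) \<Longrightarrow> coord \<iota> i (h *v E j) = 0"
    unfolding SO21_O_def orth_blocks_def matrix_coord by blast+
  have lin: "linear ((*v) h)" by (rule matrix_vector_mul_linear)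
  have iso: "\<forall>u v. (h *v u) \<bullet> (h *v v) = u \<bullet> v"
    using isometry_iff_orthogonal_matrix[OF lin] orth by (simp add: matrix_of_matrix_vector_mul)
  have bij: "bij ((*v) h)"
    by (rule isometry_bij[OF lin]) (use iso in blast)
  have cs: "coord \<iota> i (h *v u) = coord \<iota> 1 u * coord \<iota> i (h *v E 1) + coord \<iota> 2 u * coord \<iota> i (h *v E 2)"
    if i: "i \<in> {1, 2}" for i u
  proof -
    have "coord \<iota> i (h *v u) = coord \<iota> i (h *v (\<Sum>j\<in>{1..n}. coord \<iota> j u *\<^sub>R E j))"
      by (rule arg_cong[where f = "\<lambda>u. coord \<iota> i (h *v u)", OF vec_eq_sum_E])
    also have "\<dots> = (\<Sum>j\<in>{1..n}. coord \<iota> j u * coord \<iota> i (h *v E j))"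
      by (simp add: linear_sum[OF lin] linear_scale[OF lin] coord_eq_inner inner_sum_left)
    also have "\<dots> = coord \<iota> 1 u * coord \<iota> i (h *v E 1) + coord \<iota> 2 u * coord \<iota> i (h *v E 2)"
      unfolding split_sum_n using block[of i] i n3 by (auto intro!: sum.neutral)
    finally show ?thesis .
  qed
  have e3: "h *v E 3 = det (upper_block \<iota> h) *\<^sub>R E 3"
  proof (rule coord_eqI)
    fix i assume i: "i \<in> {1..n}"
    show "coord \<iota> i (h *v E 3) = coord \<iota> i (det (upper_block \<iota> h) *\<^sub>R E 3)"
    proof (cases "i = 3")
      case True
      then show ?thesis by (simp add: h33)
    next
      case False
      then show ?thesis using block[of i 3] i n3 by (simp add: coord_E)
    qed
  qed
  have "h *v br u v = br (h *v u) (h *v v)" for u v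
  proof -
    have "h *v br u v = ((coord \<iota> 1 u * coord \<iota> 2 v - coord \<iota> 2 u * coord \<iota> 1 v) * det (upper_block \<iota> h)) *\<^sub>R E 3"
      unfolding br_def by (simp add: linear_scale[OF lin] e3)
    also have "\<dots> = br (h *v u) (h *v v)"
      unfolding br_def det_upper_block using cs[of 1 u] cs[of 1 v] cs[of 2 u] cs[of 2 v]
      by (intro arg_cong[where f = "\<lambda>t. t *\<^sub>R E 3"]) (simp add: algebra_simps)
    finally show ?thesis .
  qed
  then show "isometric_aut ((*v) h)"
    using iso bij lin by (simp add: isometric_aut_def lie_automorphism_def)
qed

lemma SO21_O_matrix_inv:
  assumes "h \<in> SO21_O \<iota> n"
  shows "(*v) (matrix_inv h) = inv ((*v) h)"
proof -
  have a: "lie_automorphism ((*v) h)"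
    using assms by (simp add: SO21_O_iff isometric_aut_def)
  have "orthogonal_matrix h" using assms by (simp add: SO21_O_def orth_blocks_def)
  then have "\<exists>h'. h ** h' = mat 1 \<and> h' ** h = mat 1"
    unfolding orthogonal_matrix_def by blast
  then have m: "matrix_inv h ** h = mat 1"
    unfolding matrix_inv_def by (rule someI_ex[THEN conjunct2])
  show ?thesis
  proof
    fix x
    have "matrix_inv h *v (h *v y) = y" for y
      using m by (simp add: matrix_vector_mul_assoc)
    from this[of "inv ((*v) h) x"] show "matrix_inv h *v x = inv ((*v) h) x"
      by (simp add: lie_automorphismD(5)[OF a])
  qed
qed

lemma isometric_aut_matrix:
  assumes "isometric_aut N"
  shows "matrix N \<in> SO21_O \<iota> n" "(*v) (matrix N) = N"
proof -
  have "linear N" using assms by (simp add: isometric_aut_def lie_automorphism_def)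
  then show "(*v) (matrix N) = N" by (simp add: fun_eq_iff matrix_works)
  then show "matrix N \<in> SO21_O \<iota> n" using assms by (simp add: SO21_O_iff)
qed

lemma orbit_poly_act_eq: "orbit poly_act (SO21_O \<iota> n) f = {f \<circ> N | N. isometric_aut N}"
proof (intro set_eqI iffI)
  fix f' assume "f' \<in> orbit poly_act (SO21_O \<iota> n) f"
  then obtain h where h: "h \<in> SO21_O \<iota> n" "f' = poly_act h f"
    by (auto simp: orbit_def)
  have "isometric_aut (inv ((*v) h))"
    using h by (intro isometric_aut_inv) (simp add: SO21_O_iff)
  moreover have "f' = f \<circ> inv ((*v) h)"
    by (simp add: h(2) fun_eq_iff poly_act_def flip: SO21_O_matrix_inv[OF h(1)])
  ultimately show "f' \<in> {f \<circ> N | N. isometric_aut N}" by blast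
next
  fix f' assume "f' \<in> {f \<circ> N | N. isometric_aut N}"
  then obtain N where N: "isometric_aut N" "f' = f \<circ> N" by blast
  have lN: "lie_automorphism N" using N by (simp add: isometric_aut_def)
  note M = isometric_aut_matrix[OF isometric_aut_inv[OF N(1)]]
  have "f' = poly_act (matrix (inv N)) f"
    by (simp add: N(2) fun_eq_iff poly_act_def SO21_O_matrix_inv[OF M(1)] M(2) lie_automorphismD(6)[OF lN])
  then show "f' \<in> orbit poly_act (SO21_O \<iota> n) f"
    using M(1) by (auto simp: orbit_def)
qed

lemma orbit_poly_act_invariant:
  assumes "isometric_aut N"
  shows "orbit poly_act (SO21_O \<iota> n) (f \<circ> N) = orbit poly_act (SO21_O \<iota> n) f"
  unfolding orbit_poly_act_eq
proof (intro set_eqI iffI)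
  fix f' assume "f' \<in> {f \<circ> N \<circ> M | M. isometric_aut M}"
  then show "f' \<in> {f \<circ> M | M. isometric_aut M}"
    using isometric_aut_comp[OF assms] by (auto simp: comp_assoc)
next
  fix f' assume "f' \<in> {f \<circ> M | M. isometric_aut M}"
  then obtain M where M: "isometric_aut M" "f' = f \<circ> M" by blast
  have "lie_automorphism N" using assms by (simp add: isometric_aut_def)
  then have "f' = f \<circ> N \<circ> (inv N \<circ> M)"
    by (simp add: M fun_eq_iff lie_automorphismD)
  then show "f' \<in> {f \<circ> N \<circ> M | M. isometric_aut M}"
    using isometric_aut_comp[OF isometric_aut_inv[OF assms] M(1)] by blast
qed

subsection \<open>The action on the abelian factor\<close>

lemma P_inner: "P u \<bullet> v = P u \<bullet> P v" "u \<bullet> P v = P u \<bullet> P v"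
  by (auto simp: inner_eq_sum coord_P intro!: sum.cong)

text \<open>
  The image of \<open>P\<close> is the orthogonal complement of the derived algebra in the center, so it is
  preserved, and its orthogonal projection commutes with isometries.
\<close>

lemma isometric_aut_P:
  assumes N: "isometric_aut N"
  shows "N (P u) = P (N u)"
proof -
  have N': "lie_automorphism N" and iso: "\<And>u v. N u \<bullet> N v = u \<bullet> v"
    using N by (auto simp: isometric_aut_def)
  have 1: "P (M (P u)) = M (P u)" if M: "isometric_aut M" for M u
  proof (rule coord_eqI)
    fix i assume i: "i \<in> {1..n}"
    have M': "lie_automorphism M" and iso: "\<And>u v. M u \<bullet> M v = u \<bullet> v"
      using M by (auto simp: isometric_aut_def)
    have 12: "coord \<iota> 1 (M (P u)) = 0" "coord \<iota> 2 (M (P u)) = 0"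
      using lie_automorphism_center[OF M', of "P u"] by simp_all
    have "M (E 3) \<bullet> M (P u) = 0"
      using iso[of "E 3" "P u"] by (simp add: inner_commute[of _ "P u"] flip: coord_eq_inner)
    moreover have "M (E 3) \<noteq> 0"
      using iso[of "E 3" "E 3"] by (metis E3_neq_0 inner_eq_zero_iff)
    ultimately have "coord \<iota> 3 (M (P u)) = 0"
      unfolding lie_automorphism_E3[OF M'] by (simp add: coord_eq_inner inner_commute)
    with 12 i show "coord \<iota> i (P (M (P u))) = coord \<iota> i (M (P u))"
      by (auto simp: coord_P not_le less_Suc_eq numeral_eq_Suc)
  qed
  show ?thesis
  proof (rule inner_product_eqI[OF inner_product_inner])
    fix w
    have i: "N x \<bullet> y = x \<bullet> inv N y" for x y
      using iso[of x "inv N y"] by (simp add: lie_automorphismD[OF N'])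
    have "N (P u) \<bullet> w = N (P u) \<bullet> P w"
      using 1[OF N, of u] P_inner(1)[of "N (P u)" w] by (metis P_inner)
    also have "\<dots> = P u \<bullet> inv N (P w)" by (rule i)
    also have "\<dots> = u \<bullet> inv N (P w)"
      using 1[OF isometric_aut_inv[OF N], of w] by (metis P_inner)
    also have "\<dots> = P (N u) \<bullet> w"
      using i[of u "P w"] P_inner by metis
    finally show "N (P u) \<bullet> w = P (N u) \<bullet> w" .
  qed
qed

text \<open>The isometric automorphism with the Heisenberg block of \<open>N\<close> replaced by the identity.\<close>

definition ab_part :: "(real ^ 'n \<Rightarrow> real ^ 'n) \<Rightarrow> real ^ 'n \<Rightarrow> real ^ 'n" where
  "ab_part N u = u - P u + P (N u)"

lemma isometric_aut_ab_part:
  assumes N: "isometric_aut N"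
  shows "isometric_aut (ab_part N)" "ab_part N (E 1) = E 1" "ab_part N (E 2) = E 2" "ab_part N (E 3) = E 3"
    "P (ab_part N u) = P (N u)"
proof -
  have N': "lie_automorphism N" and iso: "\<And>u v. N u \<bullet> N v = u \<bullet> v"
    using N by (auto simp: isometric_aut_def)
  have lin: "linear (ab_part N)"
    unfolding ab_part_def
    by (rule linearI) (simp_all add: linear_add[OF linear_P] linear_scale[OF linear_P]
        linear_add[OF lie_automorphismD(1)[OF N']] linear_scale[OF lie_automorphismD(1)[OF N']] algebra_simps)
  have iso': "ab_part N u \<bullet> ab_part N v = u \<bullet> v" for u v
  proof -
    have "P (N u) \<bullet> P (N v) = P u \<bullet> P v"
      using iso[of "P u" "P v"] by (simp add: isometric_aut_P[OF N])
    moreover have z: "(x - P x) \<bullet> P y = 0" "P y \<bullet> (x - P x) = 0" for x y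
      using P_inner(2)[of x y] by (simp_all add: inner_diff_left inner_diff_right inner_commute)
    moreover have "u \<bullet> v = ((u - P u) + P u) \<bullet> ((v - P v) + P v)" by simp
    ultimately show ?thesis
      unfolding ab_part_def by (simp only: inner_add_left inner_add_right z)
  qed
  note bij = isometry_bij[OF lin iso']
  have c: "coord \<iota> 1 (ab_part N u) = coord \<iota> 1 u" "coord \<iota> 2 (ab_part N u) = coord \<iota> 2 u" for u
    by (simp_all add: ab_part_def)
  have P0: "P (br u v) = 0" for u v
    by (simp add: br_def linear_scale[OF linear_P])
  have "ab_part N (br u v) = br (ab_part N u) (ab_part N v)" for u v
  proof -
    have "P (N (br u v)) = 0"
      using P0 by (simp add: lie_automorphismD(3)[OF N'])
    then have "ab_part N (br u v) = br u v" by (simp add: ab_part_def P0)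
    also have "\<dots> = br (ab_part N u) (ab_part N v)"
      unfolding br_def c ..
    finally show ?thesis .
  qed
  then show "isometric_aut (ab_part N)"
    using lin bij iso' by (simp add: isometric_aut_def lie_automorphism_def)
  have "ab_part N u = u" if "P u = 0" for u
    using that isometric_aut_P[OF N, of u] linear_0[OF lie_automorphismD(1)[OF N']]
    by (simp add: ab_part_def)
  then show "ab_part N (E 1) = E 1" "ab_part N (E 2) = E 2" "ab_part N (E 3) = E 3" by simp_all
  show "P (ab_part N u) = P (N u)"
    by (simp add: ab_part_def linear_add[OF linear_P] linear_diff[OF linear_P])
qed

lemma ab_part_O_ab:
  assumes N: "isometric_aut N"
  shows "matrix (ab_part N) \<in> O_ab \<iota> n"
proof -
  note M = isometric_aut_matrix[OF isometric_aut_ab_part(1)[OF N]]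
  have "upper_block \<iota> (matrix (ab_part N)) = mat 1"
    by (simp add: upper_block_def matrix_coord M(2) isometric_aut_ab_part(2-4)[OF N, unfolded One_nat_def]
        vec_eq_iff forall_2 mat_def)
  moreover have "matrix (ab_part N) $ \<iota> 3 $ \<iota> 3 = 1"
    by (simp add: matrix_coord M(2) isometric_aut_ab_part(2-4)[OF N, unfolded One_nat_def])
  ultimately show ?thesis
    using M(1) by (simp add: O_ab_def SO21_O_def)
qed

lemma O_ab_subset: "O_ab \<iota> n \<subseteq> SO21_O \<iota> n"
  by (auto simp: O_ab_def SO21_O_def)

abbreviation pair_act where
  "pair_act \<equiv> \<lambda>h (f1 :: real ^ 'n \<Rightarrow> real, f3 :: real ^ 'n \<Rightarrow> real). (poly_act h f1, poly_act h f3)"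

text \<open>
  Forms on the abelian factor do not see the Heisenberg block, so \<open>O_ab\<close> has the same orbits on them as
  the group of all isometric automorphisms.
\<close>

lemma orbit_pair_act_eq:
  assumes "f1 \<circ> P = f1" "f3 \<circ> P = f3"
  shows "orbit pair_act (O_ab \<iota> n) (f1, f3) = {(f1 \<circ> N, f3 \<circ> N) | N. isometric_aut N}"
proof (intro set_eqI iffI)
  fix x assume "x \<in> orbit pair_act (O_ab \<iota> n) (f1, f3)"
  then obtain h where h: "h \<in> O_ab \<iota> n" "x = (poly_act h f1, poly_act h f3)"
    by (auto simp: orbit_def)
  then have h': "h \<in> SO21_O \<iota> n" using O_ab_subset by blast
  have "isometric_aut (inv ((*v) h))"
    using h' by (intro isometric_aut_inv) (simp add: SO21_O_iff)
  moreover have "poly_act h f = f \<circ> inv ((*v) h)" for f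
    by (simp add: fun_eq_iff poly_act_def flip: SO21_O_matrix_inv[OF h'])
  ultimately show "x \<in> {(f1 \<circ> N, f3 \<circ> N) | N. isometric_aut N}"
    using h(2) by blast
next
  fix x assume "x \<in> {(f1 \<circ> N, f3 \<circ> N) | N. isometric_aut N}"
  then obtain N where N: "isometric_aut N" "x = (f1 \<circ> N, f3 \<circ> N)" by blast
  have lN: "lie_automorphism N" using N by (simp add: isometric_aut_def)
  note iN = isometric_aut_inv[OF N(1)]
  let ?A = "ab_part (inv N)"
  have A: "isometric_aut ?A" by (rule isometric_aut_ab_part(1)[OF iN])
  have lA: "lie_automorphism ?A" using A by (simp add: isometric_aut_def)
  note M = isometric_aut_matrix[OF A]
  have PA: "P (inv ?A y) = P (N y)" for y
  proof -
    have "P (?A (inv ?A y)) = P (inv N (inv ?A y))"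
      by (rule isometric_aut_ab_part(5)[OF iN])
    then have "P y = inv N (P (inv ?A y))"
      by (simp add: lie_automorphismD(5)[OF lA] isometric_aut_P[OF iN])
    then have "N (P y) = P (inv ?A y)"
      by (simp add: lie_automorphismD(5)[OF lN])
    then show ?thesis by (simp add: isometric_aut_P[OF N(1)])
  qed
  have "poly_act (matrix ?A) f = f \<circ> N" if "f \<circ> P = f" for f
  proof
    fix y
    have "poly_act (matrix ?A) f y = f (inv ?A y)"
      by (simp add: poly_act_def SO21_O_matrix_inv[OF M(1)] M(2))
    also have "\<dots> = f (P (inv ?A y))" using that by (metis comp_apply)
    also have "\<dots> = f (N y)" unfolding PA using that by (metis comp_apply)
    finally show "poly_act (matrix ?A) f y = (f \<circ> N) y" by simp
  qed
  then have "x = pair_act (matrix ?A) (f1, f3)"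
    using assms by (simp add: N(2))
  then show "x \<in> orbit pair_act (O_ab \<iota> n) (f1, f3)"
    using ab_part_O_ab[OF iN] unfolding orbit_def by blast
qed

lemma comp_isometric_aut_P:
  assumes "isometric_aut N" "f \<circ> P = f"
  shows "f \<circ> N \<circ> P = f \<circ> N"
proof
  fix y
  have "(f \<circ> N \<circ> P) y = f (P (N y))" by (simp add: isometric_aut_P[OF assms(1)])
  then show "(f \<circ> N \<circ> P) y = (f \<circ> N) y" using assms(2) by (metis comp_apply)
qed

lemma orbit_pair_act_invariant:
  assumes "f1 \<circ> P = f1" "f3 \<circ> P = f3" and N: "isometric_aut N"
  shows "orbit pair_act (O_ab \<iota> n) (f1 \<circ> N, f3 \<circ> N) = orbit pair_act (O_ab \<iota> n) (f1, f3)"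
  unfolding orbit_pair_act_eq[OF assms(1,2)]
    orbit_pair_act_eq[OF comp_isometric_aut_P[OF N assms(1)] comp_isometric_aut_P[OF N assms(2)]]
proof (intro set_eqI iffI)
  fix x assume "x \<in> {(f1 \<circ> N \<circ> M, f3 \<circ> N \<circ> M) | M. isometric_aut M}"
  then show "x \<in> {(f1 \<circ> M, f3 \<circ> M) | M. isometric_aut M}"
    using isometric_aut_comp[OF N] by (auto simp: comp_assoc)
next
  fix x assume "x \<in> {(f1 \<circ> M, f3 \<circ> M) | M. isometric_aut M}"
  then obtain M where M: "isometric_aut M" "x = (f1 \<circ> M, f3 \<circ> M)" by blast
  have "lie_automorphism N" using N by (simp add: isometric_aut_def)
  then have "f \<circ> M = f \<circ> N \<circ> (inv N \<circ> M)" for f :: "real ^ 'n \<Rightarrow> real"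
    by (simp add: fun_eq_iff lie_automorphismD)
  then show "x \<in> {(f1 \<circ> N \<circ> M, f3 \<circ> N \<circ> M) | M. isometric_aut M}"
    using isometric_aut_comp[OF isometric_aut_inv[OF N] M(1)] M(2) by blast
qed

subsection \<open>Orbits of left-invariant statistical structures\<close>

lemma lact_comp: "lact r N (lact s M x) = lact (r * s) (M \<circ> N) x"
  by (cases x) (simp add: lact_def fun_eq_iff)

lemma lact_closed:
  assumes "inner_product b" "c \<in> S3" "r > 0" "lie_automorphism N"
  obtains b' c' where "lact r N (b, c) = (b', c')" "inner_product b'" "c' \<in> S3"
  using that[of "\<lambda>u v. r * b (N u) (N v)" "\<lambda>u v w. r * c (N u) (N v) (N w)"] assms
  by (auto simp: lact_def inner_product_lact S3_lact lie_automorphismD bij_is_inj)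

abbreviation stat_orbit where
  "stat_orbit \<equiv> orbit stat_act ({0<..} \<times> lie_Aut mul)"

lemma stat_orbit_eq:
  assumes "inner_product b" "c \<in> S3"
  shows "stat_orbit (lstruct (b, c)) = {lstruct (lact r N (b, c)) | r N. r > 0 \<and> lie_automorphism N}"
proof (intro set_eqI iffI)
  fix x assume "x \<in> stat_orbit (lstruct (b, c))"
  then obtain r M where rM: "r > 0" "lie_automorphism M" "x = stat_act (r, M) (lstruct (b, c))"
    by (auto simp: orbit_def lie_Aut_eq)
  then show "x \<in> {lstruct (lact r N (b, c)) | r N. r > 0 \<and> lie_automorphism N}"
    using stat_act_lstruct[OF assms rM(2,1)] lie_automorphism_inv[OF rM(2)] by blast
next
  fix x assume "x \<in> {lstruct (lact r N (b, c)) | r N. r > 0 \<and> lie_automorphism N}"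
  then obtain r N where rN: "r > 0" "lie_automorphism N" "x = lstruct (lact r N (b, c))" by blast
  have "x = stat_act (r, inv N) (lstruct (b, c))"
    using stat_act_lstruct[OF assms lie_automorphism_inv[OF rN(2)] rN(1)]
    by (simp add: rN(3) lie_automorphismD(6)[OF rN(2)])
  then show "x \<in> stat_orbit (lstruct (b, c))"
    using rN lie_automorphism_inv[OF rN(2)] unfolding orbit_def lie_Aut_eq by auto
qed

lemma stat_orbit_invariant:
  assumes b: "inner_product b" and c: "c \<in> S3" and r: "r > 0" and N: "lie_automorphism N"
  shows "stat_orbit (lstruct (lact r N (b, c))) = stat_orbit (lstruct (b, c))"
proof -
  obtain b' c' where l: "lact r N (b, c) = (b', c')" "inner_product b'" "c' \<in> S3"
    using lact_closed[OF assms] .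
  have "{lstruct (lact s M (lact r N (b, c))) | s M. s > 0 \<and> lie_automorphism M} =
      {lstruct (lact s M (b, c)) | s M. s > 0 \<and> lie_automorphism M}"
  proof (intro set_eqI iffI)
    fix x assume "x \<in> {lstruct (lact s M (lact r N (b, c))) | s M. s > 0 \<and> lie_automorphism M}"
    then obtain s M where "s > 0" "lie_automorphism M" "x = lstruct (lact (s * r) (N \<circ> M) (b, c))"
      by (auto simp: lact_comp)
    then show "x \<in> {lstruct (lact s M (b, c)) | s M. s > 0 \<and> lie_automorphism M}"
      using r lie_automorphism_comp[OF N] mult_pos_pos by blast
  next
    fix x assume "x \<in> {lstruct (lact s M (b, c)) | s M. s > 0 \<and> lie_automorphism M}"
    then obtain s M where M: "s > 0" "lie_automorphism M" "x = lstruct (lact s M (b, c))" by blast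
    have "N \<circ> (inv N \<circ> M) = M"
      by (simp add: fun_eq_iff lie_automorphismD[OF N])
    then have "x = lstruct (lact (s / r) (inv N \<circ> M) (lact r N (b, c)))"
      using r by (simp add: M(3) lact_comp)
    then show "x \<in> {lstruct (lact s M (lact r N (b, c))) | s M. s > 0 \<and> lie_automorphism M}"
      using M(1) r lie_automorphism_comp[OF lie_automorphism_inv[OF N] M(2)] divide_pos_pos by blast
  qed
  then show ?thesis
    unfolding stat_orbit_eq[OF b c] using stat_orbit_eq[OF l(2,3)] by (simp add: l(1))
qed

text \<open>
  Two cubic forms over the standard metric are in one orbit only through automorphisms preserving
  that metric up to scale, which are isometries.
\<close>

lemma stat_orbit_eq_imp_isometric:
  assumes c: "c \<in> S3" "c' \<in> S3"
    and eq: "stat_orbit (lstruct ((\<bullet>), c)) = stat_orbit (lstruct ((\<bullet>), c'))"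
  shows "\<exists>N. isometric_aut N \<and> c' = (\<lambda>u v w. c (N u) (N v) (N w))"
proof -
  note ip = inner_product_inner[where 'a = "real ^ 'n"]
  have "lact 1 id x = x" for x by (cases x) (simp add: lact_def fun_eq_iff)
  then have "lstruct ((\<bullet>), c') \<in> stat_orbit (lstruct ((\<bullet>), c'))"
    unfolding stat_orbit_eq[OF ip c(2)] using lie_automorphism_id zero_less_one by (metis (mono_tags, lifting) mem_Collect_eq)
  then obtain r N where rN: "r > 0" "lie_automorphism N" "lstruct ((\<bullet>), c') = lstruct (lact r N ((\<bullet>), c))"
    unfolding eq[symmetric] stat_orbit_eq[OF ip c(1)] by blast
  obtain b'' c'' where l: "lact r N ((\<bullet>), c) = (b'', c'')" "inner_product b''" "c'' \<in> S3"
    using lact_closed[OF ip c(1) rN(1,2)] .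
  have "ldata (lstruct ((\<bullet>), c')) = ldata (lstruct (b'', c''))"
    using arg_cong[OF rN(3), of ldata] unfolding l(1) .
  then have "((\<bullet>), c') = lact r N ((\<bullet>), c)"
    unfolding l(1) ldata_lstruct[OF ip c(2)] ldata_lstruct[OF l(2,3)] .
  then have 1: "(\<bullet>) = (\<lambda>u v. r * (N u \<bullet> N v))" and 2: "c' = (\<lambda>u v w. r * c (N u) (N v) (N w))"
    unfolding lact_def prod.case prod.inject by blast+
  have e: "r * (N u \<bullet> N v) = u \<bullet> v" for u v
    by (rule fun_cong[OF fun_cong[OF 1], symmetric])
  have "r = 1" by (rule similar_aut_isometric[OF rN(2,1) e])
  then have "isometric_aut N" "c' = (\<lambda>u v w. c (N u) (N v) (N w))"
    using e rN(2) 2 by (simp_all add: isometric_aut_def)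
  then show ?thesis by blast
qed

subsection \<open>Invariance of the curvature conditions\<close>

lemma curv_conjugate:
  assumes "lie_automorphism M"
  shows "curv (\<lambda>u v. M (\<Gamma> (inv M u) (inv M v))) x y z = M (curv \<Gamma> (inv M x) (inv M y) (inv M z))"
  by (simp add: curv_def lie_automorphismD[OF assms] linear_diff[OF lie_automorphismD(1)[OF assms]]
      lie_automorphismD(3)[OF lie_automorphism_inv[OF assms]])

lemma curv_gam_lact:
  assumes b: "inner_product b" and c: "c \<in> S3" and N: "lie_automorphism N" and r: "r > 0"
    and l: "lact r N (b, c) = (b', c')"
  shows "curv (gam b' c') x y z = inv N (curv (gam b c) (N x) (N y) (N z))"
    "curv (gam b' (\<lambda>u v w. - c' u v w)) x y z = inv N (curv (gam b (\<lambda>u v w. - c u v w)) (N x) (N y) (N z))"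
proof -
  note iN = lie_automorphism_inv[OF N]
  have bc: "b' = (\<lambda>u v. r * b (N u) (N v))" "c' = (\<lambda>u v w. r * c (N u) (N v) (N w))"
    using l by (auto simp: lact_def)
  show "curv (gam b' c') x y z = inv N (curv (gam b c) (N x) (N y) (N z))"
    using gam_lact[OF b c iN r] curv_conjugate[OF iN, of "gam b c" x y z]
    by (simp add: bc lie_automorphismD(6)[OF N])
  show "curv (gam b' (\<lambda>u v w. - c' u v w)) x y z = inv N (curv (gam b (\<lambda>u v w. - c u v w)) (N x) (N y) (N z))"
    using gam_lact[OF b S3_uminus[OF c] iN r] curv_conjugate[OF iN, of "gam b (\<lambda>u v w. - c u v w)" x y z]
    by (simp add: bc lie_automorphismD(6)[OF N])
qed

text \<open>
  Automorphisms carry the curvatures of a structure and of its dual along, so their equality can be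
  tested in normal form.
\<close>

lemma conjugate_symmetric_iff_nf_form:
  assumes b: "inner_product b" and c: "c \<in> S3"
  shows "conjugate_symmetric (lmetric b) (conn (gam b c)) \<longleftrightarrow> nf_form (b, c) \<in> CS"
proof -
  note N = lie_automorphism_nf_map[OF b]
  have r: "(nf_ratio b)\<^sup>2 > 0" using nf_ratio_pos[OF b] by simp
  let ?N = "nf_map b" and ?c = "nf_form (b, c)"
  note l = curv_gam_lact[OF b c N r lact_normal_form[OF b]]
  have "curv (gam b c) = curv (gam b (\<lambda>u v w. - c u v w)) \<longleftrightarrow>
      curv (gam (\<bullet>) ?c) = curv (gam (\<bullet>) (\<lambda>u v w. - ?c u v w))"
  proof
    assume "curv (gam (\<bullet>) ?c) = curv (gam (\<bullet>) (\<lambda>u v w. - ?c u v w))"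
    then have "inv ?N (curv (gam b c) (?N x) (?N y) (?N z)) =
        inv ?N (curv (gam b (\<lambda>u v w. - c u v w)) (?N x) (?N y) (?N z))" for x y z
      by (simp flip: l)
    then have "curv (gam b c) (?N x) (?N y) (?N z) = curv (gam b (\<lambda>u v w. - c u v w)) (?N x) (?N y) (?N z)" for x y z
      by (metis lie_automorphismD(5)[OF N])
    from this[of "inv ?N _" "inv ?N _" "inv ?N _"]
    show "curv (gam b c) = curv (gam b (\<lambda>u v w. - c u v w))"
      by (simp add: fun_eq_iff lie_automorphismD(5)[OF N])
  qed (simp add: fun_eq_iff l)
  then show ?thesis
    using conjugate_symmetric_lmetric[OF b c] conjugate_symmetric_inner_iff[OF nf_form_S3[OF c]]
      conjugate_symmetric_lmetric[OF inner_product_inner nf_form_S3[OF c]] by simp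
qed

lemma not_dually_flat:
  assumes b: "inner_product b" and c: "c \<in> S3"
  shows "\<not> dually_flat (conn (gam b c))"
proof
  assume "dually_flat (conn (gam b c))"
  then have flat: "curv (gam b c) x y z = 0" for x y z
    by (simp add: dually_flat_conn_iff[OF bilinear_gam[OF b c]])
  note N = lie_automorphism_nf_map[OF b]
  have r: "(nf_ratio b)\<^sup>2 > 0" using nf_ratio_pos[OF b] by simp
  have "curv (gam (\<bullet>) (nf_form (b, c))) x y z = 0" for x y z
    using curv_gam_lact(1)[OF b c N r lact_normal_form[OF b]]
      linear_0[OF lie_automorphismD(1)[OF lie_automorphism_inv[OF N]]] by (simp add: flat)
  then show False using not_flat_inner[OF nf_form_S3[OF c]] by blast
qed

end

section \<open>Homogeneous polynomials\<close>

definition exponents :: "'n::finite set \<Rightarrow> nat \<Rightarrow> ('n \<Rightarrow> nat) set" where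
  "exponents I k = {m. (\<forall>i. i \<notin> I \<longrightarrow> m i = 0) \<and> (\<Sum>i\<in>UNIV. m i) = k}"

definition monomial :: "('n::finite \<Rightarrow> nat) \<Rightarrow> real ^ 'n \<Rightarrow> real" where
  "monomial m x = (\<Prod>i\<in>UNIV. (x $ i) ^ m i)"

lemma homog_iff: "f \<in> homog I k \<longleftrightarrow> (\<exists>a. f = (\<lambda>x. \<Sum>m\<in>exponents I k. a m * monomial m x))"
  by (simp add: homog_def exponents_def monomial_def)

lemma finite_exponents: "finite (exponents I k)"
proof (rule finite_subset)
  show "exponents I k \<subseteq> {m. \<forall>i. i \<in> UNIV \<longrightarrow> m i \<in> {..k}}"
  proof
    fix m assume "m \<in> exponents I k"
    then have "(\<Sum>i\<in>UNIV. m i) = k" by (simp add: exponents_def)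
    then have "m i \<le> k" for i
      using member_le_sum[of i UNIV m] by simp
    then show "m \<in> {m. \<forall>i. i \<in> UNIV \<longrightarrow> m i \<in> {..k}}" by simp
  qed
  show "finite {m::'a \<Rightarrow> nat. \<forall>i. i \<in> UNIV \<longrightarrow> m i \<in> {..k}}"
    using finite_set_of_finite_funs[of "UNIV :: 'a set" "{..k}" undefined] by simp
qed

lemma homog_monomial:
  assumes "m \<in> exponents I k"
  shows "monomial m \<in> homog I k"
  unfolding homog_iff
proof (intro exI ext)
  fix x
  have "(\<Sum>m'\<in>exponents I k. (if m' = m then 1 else 0) * monomial m' x) =
      (\<Sum>m'\<in>exponents I k. if m' = m then monomial m' x else 0)"
    by (intro sum.cong) auto
  then show "monomial m x = (\<Sum>m'\<in>exponents I k. (if m' = m then 1 else 0) * monomial m' x)"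
    using assms by (simp add: finite_exponents)
qed

lemma homog_add: "f \<in> homog I k \<Longrightarrow> g \<in> homog I k \<Longrightarrow> (\<lambda>x. f x + g x) \<in> homog I k"
  unfolding homog_iff
proof (elim exE)
  fix a b assume "f = (\<lambda>x. \<Sum>m\<in>exponents I k. a m * monomial m x)" "g = (\<lambda>x. \<Sum>m\<in>exponents I k. b m * monomial m x)"
  then show "\<exists>a. (\<lambda>x. f x + g x) = (\<lambda>x. \<Sum>m\<in>exponents I k. a m * monomial m x)"
    by (intro exI[of _ "\<lambda>m. a m + b m"]) (simp add: sum.distrib distrib_right)
qed

lemma homog_scale: "f \<in> homog I k \<Longrightarrow> (\<lambda>x. r * f x) \<in> homog I k"
  unfolding homog_iff
proof (elim exE)
  fix a assume "f = (\<lambda>x. \<Sum>m\<in>exponents I k. a m * monomial m x)"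
  then show "\<exists>a. (\<lambda>x. r * f x) = (\<lambda>x. \<Sum>m\<in>exponents I k. a m * monomial m x)"
    by (intro exI[of _ "\<lambda>m. r * a m"]) (simp add: sum_distrib_left mult.assoc)
qed

lemma homog_zero: "(\<lambda>x. 0) \<in> homog I k"
  unfolding homog_iff by (intro exI[of _ "\<lambda>_. 0"]) simp

lemma homog_sum: "(\<And>i. i \<in> A \<Longrightarrow> f i \<in> homog I k) \<Longrightarrow> (\<lambda>x. \<Sum>i\<in>A. f i x) \<in> homog I k"
  by (induction A rule: infinite_finite_induct) (simp_all add: homog_zero homog_add)

lemma homog_const: "(\<lambda>x. r) \<in> homog I 0"
proof -
  have "(\<lambda>_. 0) \<in> exponents I 0" by (simp add: exponents_def)
  from homog_scale[OF homog_monomial[OF this], of r] show ?thesis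
    by (simp add: monomial_def)
qed

lemma homog_0_const: "f \<in> homog I 0 \<Longrightarrow> \<exists>r. f = (\<lambda>x. r)"
proof -
  assume "f \<in> homog I 0"
  then obtain a where a: "f = (\<lambda>x. \<Sum>m\<in>exponents I 0. a m * monomial m x)"
    by (auto simp: homog_iff)
  have "exponents I 0 = {\<lambda>_. 0}" by (auto simp: exponents_def)
  then have "f = (\<lambda>x. a (\<lambda>_. 0))" by (simp add: a monomial_def)
  then show ?thesis by (rule exI)
qed

lemma monomial_upd: "monomial (m(i := Suc (m i))) x = x $ i * monomial m x"
proof -
  have "(\<Prod>j\<in>UNIV - {i}. x $ j ^ (m(i := Suc (m i))) j) = (\<Prod>j\<in>UNIV - {i}. x $ j ^ m j)"
    by (intro prod.cong) auto
  then show ?thesis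
    unfolding monomial_def by (simp add: prod.remove[of UNIV i])
qed

lemma sum_fun_upd_Suc: "(\<Sum>j\<in>UNIV. (m(i := Suc (m i))) j) = Suc (\<Sum>j\<in>UNIV. m j)"
  for m :: "'n::finite \<Rightarrow> nat"
proof -
  have "(\<Sum>j\<in>UNIV - {i}. (m(i := Suc (m i))) j) = (\<Sum>j\<in>UNIV - {i}. m j)"
    by (intro sum.cong) auto
  then show ?thesis
    by (simp add: sum.remove[of UNIV i])
qed

lemma homog_coord_mult:
  assumes "f \<in> homog I k" "i \<in> I"
  shows "(\<lambda>x. x $ i * f x) \<in> homog I (Suc k)"
proof -
  obtain a where a: "f = (\<lambda>x. \<Sum>m\<in>exponents I k. a m * monomial m x)"
    using assms(1) by (auto simp: homog_iff)
  have "(\<lambda>x. \<Sum>m\<in>exponents I k. a m * monomial (m(i := Suc (m i))) x) \<in> homog I (Suc k)"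
  proof (intro homog_sum homog_scale homog_monomial)
    fix m assume "m \<in> exponents I k"
    then show "m(i := Suc (m i)) \<in> exponents I (Suc k)"
      using assms(2) sum_fun_upd_Suc[of m i] by (simp add: exponents_def)
  qed
  then show ?thesis
    by (simp add: monomial_upd a sum_distrib_left mult.left_commute)
qed

text \<open>
  Polynomials of positive degree are sums of products of a coordinate and a polynomial of lower degree;
  with this rule properties of \<open>homog\<close> follow without reference to exponents.
\<close>

lemma homog_Suc_induct:
  assumes f: "f \<in> homog I (Suc k)"
    and zero: "Q (\<lambda>x. 0)" and add: "\<And>f g. Q f \<Longrightarrow> Q g \<Longrightarrow> Q (\<lambda>x. f x + g x)"
    and gen: "\<And>i g. i \<in> I \<Longrightarrow> g \<in> homog I k \<Longrightarrow> Q (\<lambda>x. x $ i * g x)"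
  shows "Q f"
proof -
  obtain a where a: "f = (\<lambda>x. \<Sum>m\<in>exponents I (Suc k). a m * monomial m x)"
    using f by (auto simp: homog_iff)
  have Qm: "Q (\<lambda>x. a m * monomial m x)" if m: "m \<in> exponents I (Suc k)" for m
  proof -
    have "(\<Sum>i\<in>UNIV. m i) \<noteq> 0" using m by (simp add: exponents_def)
    then obtain i where i: "m i \<noteq> 0" by auto
    define m' where "m' = m(i := m i - 1)"
    have mm': "m = m'(i := Suc (m' i))" using i by (simp add: m'_def)
    have "i \<in> I" using i m by (auto simp: exponents_def)
    moreover have "sum m UNIV = Suc (sum m' UNIV)"
      using sum_fun_upd_Suc[of m' i] unfolding mm'[symmetric] .
    then have "m' \<in> exponents I k"
      using m by (auto simp: exponents_def m'_def)
    then have "(\<lambda>x. a m * monomial m' x) \<in> homog I k"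
      by (intro homog_scale homog_monomial)
    ultimately have "Q (\<lambda>x. x $ i * (a m * monomial m' x))" by (rule gen)
    moreover have "monomial m x = x $ i * monomial m' x" for x
      by (subst mm') (rule monomial_upd)
    ultimately show ?thesis by (simp add: mult.left_commute)
  qed
  have "Q (\<lambda>x. \<Sum>m\<in>A. a m * monomial m x)" if "A \<subseteq> exponents I (Suc k)" for A
    using finite_subset[OF that finite_exponents] that
    by (induction A rule: finite_induct) (simp_all add: zero add Qm)
  then show ?thesis by (simp add: a)
qed

definition coord_proj :: "'n::finite set \<Rightarrow> real ^ 'n \<Rightarrow> real ^ 'n" where
  "coord_proj I x = (\<chi> i. if i \<in> I then x $ i else 0)"

lemma coord_proj_nth [simp]: "coord_proj I x $ i = (if i \<in> I then x $ i else 0)"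
  by (simp add: coord_proj_def)

lemma coord_proj_sum: "coord_proj I x = (\<Sum>i\<in>I. (x $ i) *\<^sub>R axis i 1)"
  by (simp add: vec_eq_iff axis_def if_distrib cong: if_cong)

lemma homog_1_iff: "p \<in> homog I 1 \<longleftrightarrow> linear p \<and> (\<forall>x. p (coord_proj I x) = p x)"
proof
  let ?Q = "\<lambda>p. linear p \<and> (\<forall>x. p (coord_proj I x) = p x)"
  assume "p \<in> homog I 1"
  then have "p \<in> homog I (Suc 0)" by simp
  then show "?Q p"
  proof (rule homog_Suc_induct[where Q = ?Q])
    fix i g assume "i \<in> I" "g \<in> homog I 0"
    moreover obtain r where "g = (\<lambda>x. r)"
      using homog_0_const[OF \<open>g \<in> homog I 0\<close>] by blast
    ultimately show "?Q (\<lambda>x. x $ i * g x)"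
      by (auto intro!: linearI simp: algebra_simps)
  qed (auto intro!: linearI simp: linear_add linear_scale algebra_simps)
next
  assume p: "linear p \<and> (\<forall>x. p (coord_proj I x) = p x)"
  have e: "p = (\<lambda>x. \<Sum>i\<in>I. x $ i * p (axis i 1))"
  proof
    fix x
    have "p x = p (coord_proj I x)" using p by simp
    also have "\<dots> = (\<Sum>i\<in>I. x $ i * p (axis i 1))"
      by (simp only: coord_proj_sum linear_sum[OF conjunct1[OF p]] linear_scale[OF conjunct1[OF p]] real_scaleR_def)
    finally show "p x = (\<Sum>i\<in>I. x $ i * p (axis i 1))" .
  qed
  have "(\<lambda>x. \<Sum>i\<in>I. x $ i * p (axis i 1)) \<in> homog I (Suc 0)"
    by (intro homog_sum homog_coord_mult homog_const)
  then show "p \<in> homog I 1" unfolding e[symmetric] by simp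
qed

definition cubic_poly :: "('a \<Rightarrow> 'a \<Rightarrow> 'a \<Rightarrow> real) \<Rightarrow> 'a \<Rightarrow> real" where
  "cubic_poly c x = c x x x"

text \<open>The polarization identity for cubic forms, which inverts \<open>cubic_poly\<close>.\<close>

definition polarize :: "('a::real_vector \<Rightarrow> real) \<Rightarrow> 'a \<Rightarrow> 'a \<Rightarrow> 'a \<Rightarrow> real" where
  "polarize f u v w = (f (u + v + w) - f (u + v) - f (u + w) - f (v + w) + f u + f v + f w) / 6"

lemma polarize_cubic_poly:
  assumes c: "c \<in> S3"
  shows "polarize (cubic_poly c) = c"
proof (intro ext)
  fix u v w
  have "c v u w = c u v w" "c u w v = c u v w" "c w v u = c u v w" "c v w u = c u v w" "c w u v = c u v w"
    "c v u u = c u u v" "c u v u = c u u v" "c w u u = c u u w" "c u w u = c u u w"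
    "c u v v = c v v u" "c v u v = c v v u" "c w v v = c v v w" "c v w v = c v v w"
    "c u w w = c w w u" "c w u w = c w w u" "c v w w = c w w v" "c w v w = c w w v"
    using S3_sym[OF c] by metis+
  then show "polarize (cubic_poly c) u v w = c u v w"
    by (simp add: polarize_def cubic_poly_def S3_simps[OF c])
qed

text \<open>Products of three linear forms are polarized by averaging over the permutations.\<close>

lemma cubic_poly_product:
  assumes "linear p" "linear q" "linear r" "\<And>x. p (\<pi> x) = p x" "\<And>x. q (\<pi> x) = q x" "\<And>x. r (\<pi> x) = r x"
  shows "\<exists>c\<in>S3. (\<forall>u v w. c (\<pi> u) (\<pi> v) (\<pi> w) = c u v w) \<and> (\<lambda>x. p x * (q x * r x)) = cubic_poly c"
proof -
  define c where "c = (\<lambda>u v w. sym_prod [p, q, r] [u, v, w])"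
  have "c \<in> S3"
    unfolding c_def sym_prod_3
    by (rule S3_I) (simp_all add: linear_add assms(1-3) linear_scale algebra_simps add_divide_distrib)
  moreover have "c (\<pi> u) (\<pi> v) (\<pi> w) = c u v w" for u v w
    by (simp add: c_def sym_prod_3 assms(4-6))
  moreover have "(\<lambda>x. p x * (q x * r x)) = cubic_poly c"
    by (simp add: fun_eq_iff cubic_poly_def c_def sym_prod_3 mult_ac)
  ultimately show ?thesis by blast
qed

lemma homog_3_iff: "f \<in> homog I 3 \<longleftrightarrow>
  (\<exists>c\<in>S3. (\<forall>u v w. c (coord_proj I u) (coord_proj I v) (coord_proj I w) = c u v w) \<and> f = cubic_poly c)"
proof
  let ?Q = "\<lambda>f. \<exists>c\<in>S3. (\<forall>u v w. c (coord_proj I u) (coord_proj I v) (coord_proj I w) = c u v w) \<and> f = cubic_poly c"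
  have zero: "?Q (\<lambda>x. 0)"
    by (rule bexI[OF _ S3_zero]) (simp add: cubic_poly_def fun_eq_iff)
  have add: "?Q (\<lambda>x. f x + g x)" if f: "?Q f" and g: "?Q g" for f g
  proof -
    obtain c d where cd: "c \<in> S3" "d \<in> S3" "f = cubic_poly c" "g = cubic_poly d"
      "\<And>u v w. c (coord_proj I u) (coord_proj I v) (coord_proj I w) = c u v w"
      "\<And>u v w. d (coord_proj I u) (coord_proj I v) (coord_proj I w) = d u v w"
      using f g by blast
    show ?thesis
    proof (rule bexI[of _ "\<lambda>u v w. c u v w + d u v w"])
      show "(\<lambda>u v w. c u v w + d u v w) \<in> S3"
      proof (rule S3_I)
        fix u v w
        show "c u v w + d u v w = c v u w + d v u w" "c u v w + d u v w = c u w v + d u w v"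
          using S3_sym(1,2)[OF cd(1), of u v w] S3_sym(1,2)[OF cd(2), of u v w] by simp_all
      qed (simp_all add: S3_simps[OF cd(1)] S3_simps[OF cd(2)] algebra_simps)
    qed (simp add: cd cubic_poly_def fun_eq_iff)
  qed
  assume "f \<in> homog I 3"
  then have "f \<in> homog I (Suc 2)" by simp
  then show "?Q f"
  proof (rule homog_Suc_induct[where Q = ?Q])
    fix i g assume i: "i \<in> I" and "g \<in> homog I 2"
    then have "g \<in> homog I (Suc 1)" by (simp add: numeral_2_eq_2)
    then show "?Q (\<lambda>x. x $ i * g x)"
    proof (rule homog_Suc_induct[where Q = "\<lambda>g. ?Q (\<lambda>x. x $ i * g x)"])
      fix j h assume j: "j \<in> I" and "h \<in> homog I 1"
      then have "linear h" "\<And>x. h (coord_proj I x) = h x"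
        unfolding homog_1_iff by blast+
      then show "?Q (\<lambda>x. x $ i * (x $ j * h x))"
        using i j by (intro cubic_poly_product) (auto intro: linearI)
    next
      fix g g' assume "?Q (\<lambda>x. x $ i * g x)" "?Q (\<lambda>x. x $ i * g' x)"
      from add[OF this] show "?Q (\<lambda>x. x $ i * (g x + g' x))" by (simp add: distrib_left)
    qed (use zero in simp)
  qed (rule zero, rule add)
next
  assume "\<exists>c\<in>S3. (\<forall>u v w. c (coord_proj I u) (coord_proj I v) (coord_proj I w) = c u v w) \<and> f = cubic_poly c"
  then obtain c where c: "c \<in> S3" "\<And>u v w. c (coord_proj I u) (coord_proj I v) (coord_proj I w) = c u v w"
    "f = cubic_poly c" by blast
  have "f x = (\<Sum>i\<in>I. x $ i * (\<Sum>j\<in>I. x $ j * (\<Sum>k\<in>I. x $ k * c (axis k 1) (axis j 1) (axis i 1))))" for x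
  proof -
    have lin: "c (\<Sum>i\<in>I. a i *\<^sub>R b i) v w = (\<Sum>i\<in>I. a i * c (b i) v w)"
      "c u (\<Sum>i\<in>I. a i *\<^sub>R b i) w = (\<Sum>i\<in>I. a i * c u (b i) w)"
      "c u v (\<Sum>i\<in>I. a i *\<^sub>R b i) = (\<Sum>i\<in>I. a i * c u v (b i))" for a b u v w
      by (simp_all add: linear_sum[OF S3_linear(1)[OF c(1)]] linear_sum[OF S3_linear(2)[OF c(1)]]
        linear_sum[OF S3_linear(3)[OF c(1)]] S3_simps[OF c(1)])
    have "f x = c (coord_proj I x) (coord_proj I x) (coord_proj I x)"
      by (simp add: c(2,3) cubic_poly_def)
    then show ?thesis by (simp only: coord_proj_sum lin)
  qed
  moreover have "(\<lambda>x. \<Sum>i\<in>I. x $ i * (\<Sum>j\<in>I. x $ j * (\<Sum>k\<in>I. x $ k * c (axis k 1) (axis j 1) (axis i 1))))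
      \<in> homog I (Suc (Suc (Suc 0)))"
    by (intro homog_sum homog_coord_mult homog_const)
  ultimately show "f \<in> homog I 3" unfolding numeral_3_eq_3 by presburger
qed

section \<open>Homeomorphic orbit spaces\<close>

lemma continuous_map_orbit_space:
  assumes F: "continuous_map T T' F"
    and f: "\<And>x. x \<in> topspace T \<Longrightarrow> f (orbit act K x) = orbit act' K' (F x)"
  shows "continuous_map (orbit_space act K T) (orbit_space act' K' T') f"
  unfolding continuous_map_def
proof (intro conjI allI impI)
  have FT: "F x \<in> topspace T'" if "x \<in> topspace T" for x
    using continuous_map_image_subset_topspace[OF F] that by blast
  show "f \<in> topspace (orbit_space act K T) \<rightarrow> topspace (orbit_space act' K' T')"
    using FT by (auto simp: topspace_orbit_space f)
  fix V assume V: "openin (orbit_space act' K' T') V"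
  have "{x \<in> topspace T. orbit act K x \<in> {U \<in> topspace (orbit_space act K T). f U \<in> V}} =
      {x \<in> topspace T. F x \<in> {y \<in> topspace T'. orbit act' K' y \<in> V}}"
    using FT by (auto simp: topspace_orbit_space f)
  moreover have "openin T {x \<in> topspace T. F x \<in> {y \<in> topspace T'. orbit act' K' y \<in> V}}"
    using V by (intro openin_continuous_map_preimage[OF F]) (simp add: openin_orbit_space)
  ultimately show "openin (orbit_space act K T) {U \<in> topspace (orbit_space act K T). f U \<in> V}"
    by (auto simp: openin_orbit_space topspace_orbit_space)
qed

text \<open>
  The maps \<open>F\<close> and \<open>G\<close> relate spaces of different size, such as all structures and those over the
  standard metric, and are inverse to each other only up to orbits.
\<close>

lemma orbit_spaces_homeomorphic:
  assumes F: "continuous_map T T' F" and G: "continuous_map T' T G"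
    and FF: "\<And>x y. x \<in> topspace T \<Longrightarrow> y \<in> topspace T \<Longrightarrow> orbit act K x = orbit act K y \<Longrightarrow>
      orbit act' K' (F x) = orbit act' K' (F y)"
    and GG: "\<And>x y. x \<in> topspace T' \<Longrightarrow> y \<in> topspace T' \<Longrightarrow> orbit act' K' x = orbit act' K' y \<Longrightarrow>
      orbit act K (G x) = orbit act K (G y)"
    and GF: "\<And>x. x \<in> topspace T \<Longrightarrow> orbit act K (G (F x)) = orbit act K x"
    and FG: "\<And>y. y \<in> topspace T' \<Longrightarrow> orbit act' K' (F (G y)) = orbit act' K' y"
  shows "orbit_space act K T homeomorphic_space orbit_space act' K' T'"
proof -
  define f where "f = (\<lambda>U. orbit act' K' (F (SOME x. x \<in> topspace T \<and> orbit act K x = U)))"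
  define g where "g = (\<lambda>U. orbit act K (G (SOME x. x \<in> topspace T' \<and> orbit act' K' x = U)))"
  have f: "f (orbit act K x) = orbit act' K' (F x)" if x: "x \<in> topspace T" for x
  proof -
    have "\<exists>y. y \<in> topspace T \<and> orbit act K y = orbit act K x" using x by blast
    from someI_ex[OF this] show ?thesis unfolding f_def using FF x by blast
  qed
  have g: "g (orbit act' K' x) = orbit act K (G x)" if x: "x \<in> topspace T'" for x
  proof -
    have "\<exists>y. y \<in> topspace T' \<and> orbit act' K' y = orbit act' K' x" using x by blast
    from someI_ex[OF this] show ?thesis unfolding g_def using GG x by blast
  qed
  have "F x \<in> topspace T'" if "x \<in> topspace T" for x
    using continuous_map_image_subset_topspace[OF F] that by blast
  moreover have "G x \<in> topspace T" if "x \<in> topspace T'" for x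
    using continuous_map_image_subset_topspace[OF G] that by blast
  ultimately have "homeomorphic_maps (orbit_space act K T) (orbit_space act' K' T') f g"
    unfolding homeomorphic_maps_def
    using continuous_map_orbit_space[OF F f] continuous_map_orbit_space[OF G g]
    by (auto simp: topspace_orbit_space f g GF FG)
  then show ?thesis unfolding homeomorphic_space_def by blast
qed

section \<open>The moduli spaces\<close>

lemma continuous_on_cubic_poly:
  fixes F :: "'x::topological_space \<Rightarrow> 'a \<Rightarrow> 'a \<Rightarrow> 'a \<Rightarrow> real"
  assumes "continuous_on S F"
  shows "continuous_on S (\<lambda>x. cubic_poly (F x))"
  by (rule continuous_on_coordinatewise_then_product)
     (simp add: cubic_poly_def continuous_on_eval3[OF assms])

lemma continuous_on_polarize:
  fixes F :: "'x::topological_space \<Rightarrow> 'a::real_vector \<Rightarrow> real"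
  assumes "continuous_on S F"
  shows "continuous_on S (\<lambda>x. polarize (F x))"
proof -
  have "continuous_on S (\<lambda>x. polarize (F x) u v w)" for u v w
    unfolding polarize_def
    by (intro continuous_on_divide continuous_on_add continuous_on_diff continuous_on_const
        continuous_on_product_then_coordinatewise[OF assms]) simp
  then show ?thesis
    by (intro continuous_on_coordinatewise_then_product)
qed

lemma polarize_comp: "linear N \<Longrightarrow> polarize (f \<circ> N) u v w = polarize f (N u) (N v) (N w)"
  by (simp add: polarize_def linear_add)

context heisenberg
begin

lemma coord_proj_all: "coord_proj (\<iota> ` {1..n}) = (\<lambda>x. x)"
  using bij by (simp add: fun_eq_iff vec_eq_iff bij_betw_def)

lemma coord_proj_ab: "coord_proj (\<iota> ` {4..n}) = P"
proof (intro ext coord_eqI)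
  fix x i assume i: "i \<in> {1..n}"
  have "\<iota> i \<in> \<iota> ` {4..n} \<longleftrightarrow> i \<ge> 4"
  proof
    assume "\<iota> i \<in> \<iota> ` {4..n}"
    then obtain j where j: "j \<in> {4..n}" "\<iota> i = \<iota> j" by auto
    then have "i = j" using inj_iota[OF i, of j] by simp
    then show "i \<ge> 4" using j by simp
  qed (use i in auto)
  then show "coord \<iota> i (coord_proj (\<iota> ` {4..n}) x) = coord \<iota> i (P x)"
    by (simp add: coord_P[OF i]) (simp add: coord_def)
qed

lemma homog_all_iff: "f \<in> homog (\<iota> ` {1..n}) 3 \<longleftrightarrow> (\<exists>c\<in>S3. f = cubic_poly c)"
  unfolding homog_3_iff coord_proj_all by simp

lemma homog_ab_1_iff: "f \<in> homog (\<iota> ` {4..n}) 1 \<longleftrightarrow> f \<in> S1_ab \<iota> n"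
  unfolding homog_1_iff coord_proj_ab S1_ab_iff ..

lemma homog_ab_3_iff: "f \<in> homog (\<iota> ` {4..n}) 3 \<longleftrightarrow> (\<exists>c\<in>S3_ab \<iota> n. f = cubic_poly c)"
  unfolding homog_3_iff coord_proj_ab Bex_def S3_ab_iff by blast

lemma LStat_topology_eq: "LStat_topology mul = pullback_topology (LStat mul) ldata euclidean"
  by (simp add: LStat_topology_def ldata_def[abs_def])

lemma topspace_LStat [simp]: "topspace (LStat_topology mul) = LStat mul"
  by (simp add: LStat_topology_eq topspace_pullback_topology)

abbreviation data_space :: "((real ^ 'n \<Rightarrow> real ^ 'n \<Rightarrow> real) \<times> (real ^ 'n \<Rightarrow> real ^ 'n \<Rightarrow> real ^ 'n \<Rightarrow> real)) set" where
  "data_space \<equiv> Collect inner_product \<times> S3"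

lemma ldata_in: "x \<in> LStat mul \<Longrightarrow> ldata x \<in> data_space"
  by (erule LStat_cases) (simp add: ldata_lstruct)

lemma continuous_map_ldata: "continuous_map (LStat_topology mul) (top_of_set data_space) ldata"
proof -
  have "continuous_map (LStat_topology mul) euclidean (id \<circ> ldata)"
    unfolding LStat_topology_eq by (rule continuous_map_pullback) simp
  then show ?thesis
    by (auto intro!: continuous_map_into_subtopology ldata_in)
qed

lemma continuous_map_to_LStat:
  assumes "continuous_on S c" "\<And>x. x \<in> S \<Longrightarrow> c x \<in> S3"
  shows "continuous_map (top_of_set S) (LStat_topology mul) (\<lambda>x. lstruct ((\<bullet>), c x))"
  unfolding LStat_topology_eq
proof (rule continuous_map_pullback')
  have "continuous_map (top_of_set S) euclidean (\<lambda>x. ((\<bullet>), c x))"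
    using assms(1) by (simp add: continuous_on_Pair continuous_on_const)
  then show "continuous_map (top_of_set S) euclidean (ldata \<circ> (\<lambda>x. lstruct ((\<bullet>), c x)))"
    by (rule continuous_map_eq) (simp add: ldata_lstruct inner_product_inner assms(2))
  show "topspace (top_of_set S) \<subseteq> (\<lambda>x. lstruct ((\<bullet>), c x)) -` LStat mul"
    by (auto simp: lstruct_LStat inner_product_inner assms(2))
qed

lemma stat_orbit_normal_form:
  assumes "x \<in> LStat mul"
  shows "stat_orbit x = stat_orbit (lstruct ((\<bullet>), nf_form (ldata x)))" "nf_form (ldata x) \<in> S3"
proof -
  obtain b c where x: "inner_product b" "c \<in> S3" "x = lstruct (b, c)"
    using LStat_cases[OF assms] .
  have "(nf_ratio b)\<^sup>2 > 0" using nf_ratio_pos[OF x(1)] by simp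
  from stat_orbit_invariant[OF x(1,2) this lie_automorphism_nf_map[OF x(1)]]
  show "stat_orbit x = stat_orbit (lstruct ((\<bullet>), nf_form (ldata x)))"
    by (simp add: lact_normal_form[OF x(1)] x ldata_lstruct)
  show "nf_form (ldata x) \<in> S3"
    by (simp add: x ldata_lstruct nf_form_S3)
qed

lemma stat_orbit_isometric:
  assumes "c \<in> S3" "isometric_aut N"
  shows "stat_orbit (lstruct ((\<bullet>), \<lambda>u v w. c (N u) (N v) (N w))) = stat_orbit (lstruct ((\<bullet>), c))"
  using stat_orbit_invariant[OF inner_product_inner assms(1) zero_less_one, of N] assms(2)
  by (simp add: lact_def isometric_aut_def)

lemma nf_form_eq_of_stat_orbit:
  assumes "x \<in> LStat mul" "c \<in> S3" "stat_orbit (lstruct ((\<bullet>), c)) = stat_orbit x"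
  obtains N where "isometric_aut N" "nf_form (ldata x) = (\<lambda>u v w. c (N u) (N v) (N w))"
  using stat_orbit_eq_imp_isometric[OF assms(2) stat_orbit_normal_form(2)[OF assms(1)]]
    stat_orbit_normal_form(1)[OF assms(1)] assms(3) by metis

text \<open>
  One map brings a structure to normal form and takes the polynomial of its cubic form, the other puts
  the polarization of a polynomial over the standard metric.
\<close>

theorem MLStat_homeomorphic:
  "MLStat mul homeomorphic_space
    orbit_space poly_act (SO21_O \<iota> n) (top_of_set (homog (\<iota> ` {1..n}) 3))"
  unfolding MLStat_def
proof (rule orbit_spaces_homeomorphic)
  let ?H = "homog (\<iota> ` {1..n}) 3"
  let ?F = "\<lambda>x. cubic_poly (nf_form (ldata x))" and ?G = "\<lambda>f. lstruct ((\<bullet>), polarize f)"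
  have pol: "polarize f \<in> S3" "cubic_poly (polarize f) = f" if "f \<in> ?H" for f
    using that unfolding homog_all_iff by (auto simp: polarize_cubic_poly)
  have "continuous_map (top_of_set data_space) (top_of_set ?H) (\<lambda>p. cubic_poly (nf_form p))"
  proof (rule continuous_map_into_subtopology)
    show "continuous_map (top_of_set data_space) euclidean (\<lambda>p. cubic_poly (nf_form p))"
      unfolding continuous_map_iff_continuous by (rule continuous_on_cubic_poly[OF continuous_on_nf_form])
    have "cubic_poly (nf_form p) \<in> ?H" if "p \<in> data_space" for p
      unfolding homog_all_iff using that nf_form_S3 by (cases p) blast
    then show "(\<lambda>p. cubic_poly (nf_form p)) \<in> topspace (top_of_set data_space) \<rightarrow> ?H"
      by auto
  qed
  from continuous_map_compose[OF continuous_map_ldata this]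
  show "continuous_map (LStat_topology mul) (top_of_set ?H) ?F" by (simp add: o_def)
  show "continuous_map (top_of_set ?H) (LStat_topology mul) ?G"
    by (rule continuous_map_to_LStat[OF continuous_on_polarize[OF continuous_on_id] pol(1)])
  have orb: "orbit poly_act (SO21_O \<iota> n) (?F x) = orbit poly_act (SO21_O \<iota> n) (cubic_poly c)"
    if x: "x \<in> LStat mul" and c: "c \<in> S3" and eq: "stat_orbit (lstruct ((\<bullet>), c)) = stat_orbit x" for x c
  proof -
    obtain N where N: "isometric_aut N" "nf_form (ldata x) = (\<lambda>u v w. c (N u) (N v) (N w))"
      using nf_form_eq_of_stat_orbit[OF x c eq] .
    then have "?F x = cubic_poly c \<circ> N"
      by (simp add: fun_eq_iff cubic_poly_def)
    then show ?thesis by (simp add: orbit_poly_act_invariant[OF N(1)])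
  qed
  show "orbit poly_act (SO21_O \<iota> n) (?F x) = orbit poly_act (SO21_O \<iota> n) (?F y)"
    if "x \<in> topspace (LStat_topology mul)" "y \<in> topspace (LStat_topology mul)" "stat_orbit x = stat_orbit y" for x y
    using that stat_orbit_normal_form[of y] by (intro orb) auto
  show "orbit poly_act (SO21_O \<iota> n) (?F (?G f)) = orbit poly_act (SO21_O \<iota> n) f"
    if "f \<in> topspace (top_of_set ?H)" for f
    using orb[OF lstruct_LStat[OF inner_product_inner pol(1)] pol(1) refl, of f] that pol(2)[of f] by simp
  show "stat_orbit (?G (?F x)) = stat_orbit x" if "x \<in> topspace (LStat_topology mul)" for x
    using that stat_orbit_normal_form[of x] by (simp add: polarize_cubic_poly)
  show "stat_orbit (?G f) = stat_orbit (?G f')"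
    if f: "f \<in> topspace (top_of_set ?H)" "f' \<in> topspace (top_of_set ?H)"
      and eq: "orbit poly_act (SO21_O \<iota> n) f = orbit poly_act (SO21_O \<iota> n) f'" for f f'
  proof -
    have "f \<circ> id \<in> orbit poly_act (SO21_O \<iota> n) f"
      unfolding orbit_poly_act_eq using isometric_aut_id by blast
    then obtain N where N: "isometric_aut N" "f = f' \<circ> N"
      unfolding eq unfolding orbit_poly_act_eq by auto
    have "linear N" using N(1) by (simp add: isometric_aut_def lie_automorphism_def)
    then have "polarize f = (\<lambda>u v w. polarize f' (N u) (N v) (N w))"
      by (simp add: N(2) fun_eq_iff polarize_comp)
    then show ?thesis
      using stat_orbit_isometric[OF pol(1) N(1), of f'] f by simp
  qed
qed

subsection \<open>Conjugate symmetric structures\<close>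

text \<open>
  Recovers \<open>p\<^sub>1\<close> and the polynomial of \<open>p\<^sub>3\<close> from \<open>w\<^sub>0 p\<^sub>1 + p\<^sub>3\<close>; the factor 3 is due to the symmetric
  product, as \<open>(w\<^sub>0 p\<^sub>1)(e\<^sub>1, e\<^sub>1, w) = p\<^sub>1(w) / 3\<close>.
\<close>

definition cs_split :: "(real ^ 'n \<Rightarrow> real ^ 'n \<Rightarrow> real ^ 'n \<Rightarrow> real) \<Rightarrow> (real ^ 'n \<Rightarrow> real) \<times> (real ^ 'n \<Rightarrow> real)" where
  "cs_split c = (\<lambda>w. 3 * c (E 1) (E 1) w, \<lambda>x. c (P x) (P x) (P x))"

lemma cs_split_cs_form:
  assumes "q1 \<in> S1_ab \<iota> n" "q3 \<in> S3_ab \<iota> n"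
  shows "cs_split (cs_form q1 q3) = (q1, cubic_poly q3)"
proof -
  have "q1 (E (Suc 0)) = 0" "q3 (E (Suc 0)) v w = 0" for v w
    using S1_ab_zero[OF assms(1)] S3_ab_zero[OF assms(2)] by simp_all
  moreover have "q3 (P x) (P x) (P x) = q3 x x x" for x
    using assms(2) by (simp add: S3_ab_iff)
  ultimately show ?thesis
    by (simp add: cs_split_def cs_form_def w0_prod_eq dot3_def cubic_poly_def fun_eq_iff)
qed

lemma dot3_eq: "dot3 u v = u \<bullet> v - P u \<bullet> P v"
proof -
  have "{3..n} = insert 3 {4..n}" using n3 by auto
  then have 1: "u \<bullet> v = dot3 u v + (\<Sum>i\<in>{4..n}. coord \<iota> i u * coord \<iota> i v)"
    unfolding inner_eq_sum split_sum_n by (simp add: dot3_def)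
  have "P u \<bullet> P v = (\<Sum>i\<in>{3..n}. coord \<iota> i (P u) * coord \<iota> i (P v))"
    unfolding inner_eq_sum split_sum_n by simp
  also have "\<dots> = (\<Sum>i\<in>{4..n}. coord \<iota> i u * coord \<iota> i v)"
    using \<open>{3..n} = insert 3 {4..n}\<close> by (simp add: coord_P)
  finally show ?thesis using 1 by simp
qed

text \<open>\<open>w\<^sub>0\<close> is invariant, so the action on \<open>w\<^sub>0 p\<^sub>1 + p\<^sub>3\<close> is the action on \<open>(p\<^sub>1, p\<^sub>3)\<close>.\<close>

lemma dot3_isometric_aut:
  assumes "isometric_aut N"
  shows "dot3 (N u) (N v) = dot3 u v"
proof -
  have "\<And>u v. N u \<bullet> N v = u \<bullet> v" using assms by (auto simp: isometric_aut_def)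
  then show ?thesis by (simp add: dot3_eq flip: isometric_aut_P[OF assms])
qed

lemma cs_form_isometric_aut:
  assumes "isometric_aut N"
  shows "cs_form q1 q3 (N u) (N v) (N w) = cs_form (q1 \<circ> N) (\<lambda>u v w. q3 (N u) (N v) (N w)) u v w"
  by (simp add: cs_form_def w0_prod_eq dot3_isometric_aut[OF assms])

lemma S_ab_isometric_aut:
  assumes N: "isometric_aut N"
  shows "q1 \<in> S1_ab \<iota> n \<Longrightarrow> q1 \<circ> N \<in> S1_ab \<iota> n"
    "q3 \<in> S3_ab \<iota> n \<Longrightarrow> (\<lambda>u v w. q3 (N u) (N v) (N w)) \<in> S3_ab \<iota> n"
proof -
  have lin: "linear N" using N by (simp add: isometric_aut_def lie_automorphism_def)
  show "q1 \<circ> N \<in> S1_ab \<iota> n" if "q1 \<in> S1_ab \<iota> n"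
    using that lin by (simp add: S1_ab_iff isometric_aut_P[OF N] linear_compose)
  show "(\<lambda>u v w. q3 (N u) (N v) (N w)) \<in> S3_ab \<iota> n" if "q3 \<in> S3_ab \<iota> n"
    using that S3_lact[OF _ lin, of q3 1] by (simp add: S3_ab_iff isometric_aut_P[OF N])
qed

theorem MLStat_CS_homeomorphic:
  "MLStat_CS mul homeomorphic_space orbit_space pair_act (O_ab \<iota> n)
    (top_of_set (homog (\<iota> ` {4..n}) 1 \<times> homog (\<iota> ` {4..n}) 3))"
  unfolding MLStat_CS_def
proof (rule orbit_spaces_homeomorphic)
  let ?H = "homog (\<iota> ` {4..n}) 1 \<times> homog (\<iota> ` {4..n}) 3"
  let ?CS = "{(g, D). conjugate_symmetric g D} :: ((real ^ 'n) tensor2 \<times> (real ^ 'n) connection) set"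
  let ?T = "subtopology (LStat_topology mul) ?CS"
  let ?F = "\<lambda>x. cs_split (nf_form (ldata x))"
  let ?c = "\<lambda>f. cs_form (fst f) (polarize (snd f))"
  let ?G = "\<lambda>f. lstruct ((\<bullet>), ?c f)"
  have T: "x \<in> topspace ?T \<longleftrightarrow> x \<in> LStat mul \<and> nf_form (ldata x) \<in> CS" for x
  proof (cases "x \<in> LStat mul")
    case True
    then obtain b c where x: "inner_product b" "c \<in> S3" "x = lstruct (b, c)"
      using LStat_cases by blast
    have "x \<in> ?CS \<longleftrightarrow> nf_form (b, c) \<in> CS"
      using conjugate_symmetric_iff_nf_form[OF x(1,2)] by (simp add: x(3) lstruct_def)
    then show ?thesis using True by (simp add: x ldata_lstruct)
  qed simp
  have H: "fst f \<in> S1_ab \<iota> n" "polarize (snd f) \<in> S3_ab \<iota> n" "cubic_poly (polarize (snd f)) = snd f"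
    "fst f \<circ> P = fst f" "snd f \<circ> P = snd f" if f: "f \<in> ?H" for f
  proof -
    have f': "fst f \<in> homog (\<iota> ` {4..n}) 1" "snd f \<in> homog (\<iota> ` {4..n}) 3"
      using f by (simp_all only: mem_Times_iff)
    show 1: "fst f \<in> S1_ab \<iota> n" using f'(1) unfolding homog_ab_1_iff .
    obtain c where c: "c \<in> S3_ab \<iota> n" "snd f = cubic_poly c"
      using f'(2) unfolding homog_ab_3_iff by blast
    then have "polarize (snd f) = c" by (simp add: S3_ab_iff polarize_cubic_poly)
    then show "polarize (snd f) \<in> S3_ab \<iota> n" "cubic_poly (polarize (snd f)) = snd f" using c by simp_all
    show "fst f \<circ> P = fst f" "snd f \<circ> P = snd f"
      using 1 c by (simp_all add: S1_ab_iff S3_ab_iff cubic_poly_def fun_eq_iff)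
  qed
  have G_in: "?G f \<in> LStat mul" "?c f \<in> S3" "?c f \<in> CS" "cs_split (?c f) = f" if "f \<in> ?H" for f
  proof -
    show "?c f \<in> S3" by (rule cs_form_S3[OF H(1,2)[OF that]])
    then show "?G f \<in> LStat mul" by (rule lstruct_LStat[OF inner_product_inner])
    show "?c f \<in> CS" using H(1,2)[OF that] by (auto simp: CS_def)
    show "cs_split (?c f) = f" by (simp add: cs_split_cs_form[OF H(1,2)[OF that]] H(3)[OF that])
  qed
  have CS: "\<exists>f\<in>?H. c = ?c f" if cCS: "c \<in> CS" for c
  proof -
    obtain q1 q3 where q: "c = cs_form q1 q3" "q1 \<in> S1_ab \<iota> n" "q3 \<in> S3_ab \<iota> n"
      using cCS by (auto simp: CS_def)
    then have "(q1, cubic_poly q3) \<in> ?H"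
      unfolding mem_Times_iff homog_ab_1_iff homog_ab_3_iff by auto
    moreover have "polarize (cubic_poly q3) = q3"
      using q(3) by (simp add: S3_ab_iff polarize_cubic_poly)
    ultimately show ?thesis using q(1) by (intro bexI[of _ "(q1, cubic_poly q3)"]) simp_all
  qed
  show "continuous_map ?T (top_of_set ?H) ?F"
  proof (rule continuous_map_into_subtopology)
    have cont: "continuous_on data_space (\<lambda>p. cs_split (nf_form p))"
    proof -
      have "continuous_on data_space (\<lambda>p. 3 * nf_form p (E 1) (E 1) w)" for w
        by (intro continuous_on_mult continuous_on_const continuous_on_eval3[OF continuous_on_nf_form])
      moreover have "continuous_on data_space (\<lambda>p. nf_form p (P x) (P x) (P x))" for x
        by (rule continuous_on_eval3[OF continuous_on_nf_form])
      ultimately show ?thesis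
        unfolding cs_split_def by (intro continuous_on_Pair continuous_on_coordinatewise_then_product)
    qed
    then have "continuous_map (top_of_set data_space) euclidean (\<lambda>p. cs_split (nf_form p))" by simp
    from continuous_map_from_subtopology[OF continuous_map_compose[OF continuous_map_ldata this]]
    show "continuous_map ?T euclidean ?F" by (simp add: o_def)
    have "?F x \<in> ?H" if "x \<in> topspace ?T" for x
    proof -
      have "nf_form (ldata x) \<in> CS" using that T by blast
      then obtain f where "f \<in> ?H" "nf_form (ldata x) = ?c f" using CS by blast
      then show ?thesis using G_in(4) by metis
    qed
    then show "?F \<in> topspace ?T \<rightarrow> ?H" by blast
  qed
  show "continuous_map (top_of_set ?H) ?T ?G"
  proof (rule continuous_map_into_subtopology)
    have "continuous_on ?H (\<lambda>f. ?c f u v w)" for u v w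
    proof -
      have "continuous_on ?H (\<lambda>f. fst f x)" for x
        by (rule continuous_on_product_then_coordinatewise[OF continuous_on_fst[OF continuous_on_id]])
      moreover have "continuous_on ?H (\<lambda>f. polarize (snd f) u v w)"
        by (rule continuous_on_eval3[OF continuous_on_polarize[OF continuous_on_snd[OF continuous_on_id]]])
      ultimately show ?thesis
        unfolding cs_form_def w0_prod_eq
        by (intro continuous_on_add continuous_on_divide continuous_on_mult continuous_on_const) auto
    qed
    then have "continuous_on ?H ?c"
      by (intro continuous_on_coordinatewise_then_product)
    then show "continuous_map (top_of_set ?H) (LStat_topology mul) ?G"
      by (rule continuous_map_to_LStat) (rule G_in(2))
    have "?G f \<in> ?CS" if "f \<in> ?H" for f
      using conjugate_symmetric_inner_iff[OF G_in(2)[OF that]] G_in(3)[OF that] by (simp add: lstruct_def)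
    then show "?G \<in> topspace (top_of_set ?H) \<rightarrow> ?CS" by auto
  qed
  have orb: "orbit pair_act (O_ab \<iota> n) (?F x) = orbit pair_act (O_ab \<iota> n) f"
    if x: "x \<in> LStat mul" and f: "f \<in> ?H" and eq: "stat_orbit (?G f) = stat_orbit x" for x f
  proof -
    obtain N where N: "isometric_aut N" "nf_form (ldata x) = (\<lambda>u v w. ?c f (N u) (N v) (N w))"
      using nf_form_eq_of_stat_orbit[OF x G_in(2)[OF f] eq] .
    then have "nf_form (ldata x) = cs_form (fst f \<circ> N) (\<lambda>u v w. polarize (snd f) (N u) (N v) (N w))"
      by (simp add: fun_eq_iff cs_form_isometric_aut[OF N(1)])
    then have "?F x = (fst f \<circ> N, cubic_poly (\<lambda>u v w. polarize (snd f) (N u) (N v) (N w)))"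
      by (simp add: cs_split_cs_form S_ab_isometric_aut[OF N(1)] H[OF f])
    also have "cubic_poly (\<lambda>u v w. polarize (snd f) (N u) (N v) (N w)) = cubic_poly (polarize (snd f)) \<circ> N"
      by (simp add: cubic_poly_def fun_eq_iff)
    finally have "?F x = (fst f \<circ> N, snd f \<circ> N)"
      unfolding H(3)[OF f] .
    then show ?thesis
      using orbit_pair_act_invariant[OF H(4,5)[OF f] N(1)] by simp
  qed
  have nf: "\<exists>f\<in>?H. nf_form (ldata x) = ?c f \<and> ?F x = f \<and> stat_orbit (?G f) = stat_orbit x"
    if "x \<in> topspace ?T" for x
  proof -
    have x: "x \<in> LStat mul" "nf_form (ldata x) \<in> CS" using that T by blast+
    then obtain f where f: "f \<in> ?H" "nf_form (ldata x) = ?c f" using CS by blast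
    then show ?thesis
      using G_in(4)[OF f(1)] stat_orbit_normal_form(1)[OF x(1)] by (intro bexI[OF _ f(1)]) simp
  qed
  show "orbit pair_act (O_ab \<iota> n) (?F x) = orbit pair_act (O_ab \<iota> n) (?F y)"
    if x: "x \<in> topspace ?T" and y: "y \<in> topspace ?T" and eq: "stat_orbit x = stat_orbit y" for x y
  proof -
    obtain f where f: "f \<in> ?H" "?F y = f" "stat_orbit (?G f) = stat_orbit y" using nf[OF y] by blast
    have "x \<in> LStat mul" using x T by blast
    from orb[OF this f(1)] show ?thesis using f(2,3) eq by simp
  qed
  show "stat_orbit (?G (?F x)) = stat_orbit x" if x: "x \<in> topspace ?T" for x
  proof -
    obtain f where f: "?F x = f" "stat_orbit (?G f) = stat_orbit x" using nf[OF x] by blast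
    show ?thesis unfolding f(1) by (rule f(2))
  qed
  show "orbit pair_act (O_ab \<iota> n) (?F (?G f)) = orbit pair_act (O_ab \<iota> n) f"
    if "f \<in> topspace (top_of_set ?H)" for f
    using that by (intro orb G_in) auto
  show "stat_orbit (?G f) = stat_orbit (?G f')"
    if f: "f \<in> topspace (top_of_set ?H)" "f' \<in> topspace (top_of_set ?H)"
      and eq: "orbit pair_act (O_ab \<iota> n) f = orbit pair_act (O_ab \<iota> n) f'" for f f'
  proof -
    have fH: "f \<in> ?H" "f' \<in> ?H" using f by auto
    have o: "orbit pair_act (O_ab \<iota> n) f = {(fst f \<circ> N, snd f \<circ> N) | N. isometric_aut N}" if "f \<in> ?H" for f
      using orbit_pair_act_eq[OF H(4,5)[OF that]] by simp
    have "f = (fst f \<circ> id, snd f \<circ> id)" by simp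
    then have "f \<in> orbit pair_act (O_ab \<iota> n) f"
      unfolding o[OF fH(1)] using isometric_aut_id by blast
    then obtain N where N: "isometric_aut N" "f = (fst f' \<circ> N, snd f' \<circ> N)"
      unfolding eq o[OF fH(2)] by blast
    have lin: "linear N" using N(1) by (simp add: isometric_aut_def lie_automorphism_def)
    have fN: "fst f = fst f' \<circ> N" "snd f = snd f' \<circ> N"
      using arg_cong[OF N(2), of fst] arg_cong[OF N(2), of snd] by (simp_all only: fst_conv snd_conv)
    have "?c f = (\<lambda>u v w. ?c f' (N u) (N v) (N w))"
      unfolding fN cs_form_isometric_aut[OF N(1)] by (simp add: fun_eq_iff cs_form_def polarize_comp[OF lin])
    then show ?thesis
      using stat_orbit_isometric[OF G_in(2)[OF fH(2)] N(1)] by simp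
  qed
qed

lemma topspace_MLStat_DF: "topspace (MLStat_DF mul) = {}"
proof -
  have "\<not> dually_flat D" if "(g, D) \<in> LStat mul" for g D
    using that by (rule LStat_cases) (auto simp: lstruct_def not_dually_flat)
  then show ?thesis
    by (auto simp: MLStat_DF_def topspace_orbit_space)
qed

lemma S3_CS_inner: "S3_CS mul (lmetric (\<bullet>)) = CS"
  using CS_subset_S3 conjugate_symmetric_inner_iff
  by (auto simp: S3_CS_def statistical_connection_lmetric[OF inner_product_inner])

lemma S3_DF_inner: "S3_DF mul (lmetric (\<bullet>)) = {}"
  using not_dually_flat[OF inner_product_inner]
  by (auto simp: S3_DF_def statistical_connection_lmetric[OF inner_product_inner])

lemma standard_metric:
  assumes "left_invariant_metric mul g"
    and "\<And>p i j. i \<in> {1..n} \<Longrightarrow> j \<in> {1..n} \<Longrightarrow> g p (L p (E i)) (L p (E j)) = (if i = j then 1 else 0)"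
  shows "g = lmetric (\<bullet>)"
proof -
  have "g 0 = (\<bullet>)"
    using left_invariant_metric_eq_lmetric(2)[OF assms(1)] assms(2)[of _ _ 0]
    by (intro inner_eq_if_orthonormal_frame) (simp_all add: inner_productD(1))
  then show ?thesis
    using left_invariant_metric_eq_lmetric(1)[OF assms(1)] by simp
qed

end

theorem theorem7p1:
  fixes n :: nat and \<iota> :: "nat \<Rightarrow> 'n::finite" and g :: "(real ^ 'n) tensor2"
  assumes "n \<ge> 3"
    and "bij_betw \<iota> {1..n} UNIV"
    and "left_invariant_metric (heis_mul \<iota>) g"
    and "\<And>p i j. i \<in> {1..n} \<Longrightarrow> j \<in> {1..n} \<Longrightarrow>
      g p (lfield (heis_mul \<iota>) (basis_vec \<iota> i) p) (lfield (heis_mul \<iota>) (basis_vec \<iota> j) p) =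
        (if i = j then 1 else 0)"
  shows "S3_CS (heis_mul \<iota>) g =
      {(\<lambda>u v w. w0_prod \<iota> p1 u v w + p3 u v w) | p1 p3. p1 \<in> S1_ab \<iota> n \<and> p3 \<in> S3_ab \<iota> n}
    \<and> S3_DF (heis_mul \<iota>) g = {}
    \<and> (\<forall>c \<in> S3_CS (heis_mul \<iota>) g.
        parallel3 (levi_civita g) (left_form3 (heis_mul \<iota>) c) \<and>
        (\<forall>p. let s = sect g (statistical_connection g (left_form3 (heis_mul \<iota>) c)) p
                    (lfield (heis_mul \<iota>) (basis_vec \<iota> 1) p)
                    (lfield (heis_mul \<iota>) (basis_vec \<iota> 3) p)
             in s \<ge> 1 / 4 \<and> s > 0))
    \<and> MLStat (heis_mul \<iota>) homeomorphic_space
        orbit_space poly_act (SO21_O \<iota> n) (top_of_set (homog (\<iota> ` {1..n}) 3))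
    \<and> MLStat_CS (heis_mul \<iota>) homeomorphic_space
        orbit_space (\<lambda>h (f1, f3). (poly_act h f1, poly_act h f3)) (O_ab \<iota> n)
          (top_of_set (homog (\<iota> ` {4..n}) 1 \<times> homog (\<iota> ` {4..n}) 3))
    \<and> topspace (MLStat_DF (heis_mul \<iota>)) = {}"
proof -
  interpret heisenberg \<iota> n
    by unfold_locales (fact assms)+
  have g: "g = lmetric (\<bullet>)"
    by (rule standard_metric[OF assms(3,4)])
  have "CS = {(\<lambda>u v w. w0_prod \<iota> p1 u v w + p3 u v w) | p1 p3. p1 \<in> S1_ab \<iota> n \<and> p3 \<in> S3_ab \<iota> n}"
    unfolding CS_def cs_form_def[abs_def] by blast
  moreover have "let s = sect g (statistical_connection g (left_form3 mul c)) p (L p (E 1)) (L p (E 3))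
      in s \<ge> 1 / 4 \<and> s > 0" if "c \<in> CS" for c p
    using sect_CS[OF that, of p] that CS_subset_S3
    by (auto simp: g statistical_connection_lmetric[OF inner_product_inner] Let_def)
  ultimately show ?thesis
    using S3_CS_inner S3_DF_inner parallel3_CS MLStat_homeomorphic MLStat_CS_homeomorphic topspace_MLStat_DF
    by (simp add: g)
qed

end
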